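(* Assume model $\mathcal M_{\mathrm s}$ and Assumption A1, and let $\alpha\in(0,1)$. For each $K$, let $\mathbb T^*_K$ be the proposed procedure applied to streams $1,\dots,K$ (all $K$ being defined on one probability space carrying an infinite i.i.d. family of streams), with filtration $\mathcal F^*_{K,t}$, active sets $S^*_{K,t}$ and posteriors $W_{k,t}$. Define $V_0=0$ and $V_{t+1}=\dfrac{q(X_{1,t+1})/p(X_{1,t+1})}{(1-\theta)(1-V_t)/(\theta+(1-\theta)V_t)+q(X_{1,t+1})/p(X_{1,t+1})}$, and thresholds $\lambda_0=1$ and, for $t\ge1$, $$\lambda_t=\sup\{\lambda\in[0,1]:\ \mathbb E(V_t\mid V_t\le\lambda,\ V_s\le\lambda_s,\ 0\le s\le t-1)\le\alpha\}.$$ Then for each $t\ge1$: (1) $\lim_{K\to\infty}\hat\lambda_{K,t}=\lambda_t$ a.s., where $\hat\lambda_{K,t}=\max\{W_{k,t}:k\in S^*_{K,t+1}\}$; (2) $\lim_{K\to\infty}\mathrm{LFNR}_{t+1}(\mathbb T^*_K)=\mathbb E(V_t\mid V_s\le\lambda_s,\ 0\le s\le t)$ a.s., and $$\mathbb E(V_t\mid V_s\le\lambda_s,0\le s\le t)=\begin{cases}1-(1-\theta)^t,& t<\frac{\log(1-\alpha)}{\log(1-\theta)},\\ \alpha,& t\ge\frac{\log(1-\alpha)}{\log(1-\theta)};\end{cases}$$ (3) $\lim_{K\to\infty}K^{-1}|S^*_{K,t+1}|=\mathbb P(V_1\le\lambda_1,\dots,V_t\le\lambda_t)$ a.s.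
   Context: Data streams $k=1,2,\dots$ with change points $\tau_k\in\{0,1,2,\dots\}$. Model $\mathcal M_{\mathrm s}$: $\tau_k$ are i.i.d. with $\mathbb P(\tau_k=m)=\theta(1-\theta)^m$, $m\ge0$, $\theta\in(0,1)$; conditionally on the change points, observations $X_{k,t}$ ($t=1,2,\dots$) are independent with density $p$ if $t\le\tau_k$ and $q$ if $t>\tau_k$ (w.r.t. a baseline measure). Assumption A1: for $Z_1\sim p$ and $Z_2\sim q$, the likelihood ratios $q(Z_1)/p(Z_1)$ and $q(Z_2)/p(Z_2)$ have continuous and strictly positive Lebesgue densities on $\mathbb R_+$. A compound sequential detection procedure for $K$ streams consists of index sets $S_1=\{1,\dots,K\}\supseteq S_2\supseteq\cdots$ and a filtration defined inductively by $\mathcal F_1=\sigma(X_{k,1}:1\le k\le K)$ and $\mathcal F_t=\sigma(\mathcal F_{t-1},S_t,X_{k,t}:k\in S_t)$, where $S_t$ is $\mathcal F_{t-1}$-measurable. For $t\ge1$, $\mathrm{FNP}_{t+1}=\sum_{k\in S_{t+1}}\mathbf 1(\tau_k<t)/(|S_{t+1}|\vee1)$ and $\mathrm{LFNR}_{t+1}=\mathbb E(\mathrm{FNP}_{t+1}\mid\mathcal F_t)$. Posteriors: $W_{k,t}=\mathbb P(\tau_k<t\mid\mathcal F_t)$. One-step update rule: given $\alpha$, $S_t$ and $(W_{k,t})_{k\in S_t}$, write $S_t=\{k_1,\dots,k_m\}$ ordered so that $W_{k_1,t}\le\cdots\le W_{k_m,t}$, ties broken by increasing index; set $R_0=0$,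 $R_n=\frac1n\sum_{i=1}^nW_{k_i,t}$; let $n$ be the largest element of $\{0,\dots,m\}$ with $R_n\le\alpha$; output $S_{t+1}=\{k_1,\dots,k_n\}$. The proposed procedure: $S_1=\{1,\dots,K\}$ and for each $t\ge1$, $S_{t+1}$ is the output of the one-step rule applied to $S_t$ and its current posteriors. *)

theory Defs
  imports "HOL-Probability.Probability"
begin

(* One-step update rule: sort S by W; sort_key is a stable insertion sort applied to the
   increasingly sorted index list, so ties are broken by increasing index (lemma sort_key_stable), running averages R n, keep the largest prefix with R n \<le> alpha. *)
definition onestep :: "real \<Rightarrow> nat set \<Rightarrow> (nat \<Rightarrow> real) \<Rightarrow> nat set" where
  "onestep \<alpha> S W =
    (let ks = sort_key W (sorted_list_of_set S);
         R = (\<lambda>n. (\<Sum>i<n. W (ks ! i)) / real n);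
         n = Max {n. n \<le> length ks \<and> R n \<le> \<alpha>}
     in set (take n ks))"

definition fil1 :: "'a measure \<Rightarrow> 'b measure \<Rightarrow> (nat \<Rightarrow> nat \<Rightarrow> 'a \<Rightarrow> 'b) \<Rightarrow> nat \<Rightarrow> 'a measure" where
  "fil1 M N X K = sigma (space M)
     {{\<omega> \<in> space M. X k 1 \<omega> \<in> A} | k A. k \<in> {1..K} \<and> A \<in> sets N}"

(* sigma(F, S, X_{k,t} : k \<in> S), with the randomly indexed observations rendered as the
   masked variables (if k \<in> S then X_{k,t} else "unobserved") *)
definition filstep :: "'a measure \<Rightarrow> 'b measure \<Rightarrow> 'a measure \<Rightarrow> ('a \<Rightarrow> nat set) \<Rightarrow> (nat \<Rightarrow> 'a \<Rightarrow> 'b) \<Rightarrow> 'a measure" where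
  "filstep M N F S Y = sigma (space M)
     (sets F \<union> {{\<omega> \<in> space M. k \<in> S \<omega>} | k. True}
             \<union> {{\<omega> \<in> space M. k \<in> S \<omega> \<and> Y k \<omega> \<in> A} | k A. A \<in> sets N})"

(* proc n = (S_{n+1}, F_{n+1}) for the proposed procedure on streams 1..K *)
primrec proc :: "'a measure \<Rightarrow> 'b measure \<Rightarrow> (nat \<Rightarrow> nat \<Rightarrow> 'a \<Rightarrow> 'b) \<Rightarrow> (nat \<Rightarrow> 'a \<Rightarrow> nat)
     \<Rightarrow> real \<Rightarrow> nat \<Rightarrow> nat \<Rightarrow> ('a \<Rightarrow> nat set) \<times> 'a measure" where
  "proc M N X tau \<alpha> K 0 = ((\<lambda>\<omega>. {1..K}), fil1 M N X K)"
| "proc M N X tau \<alpha> K (Suc n) =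
     (let S = fst (proc M N X tau \<alpha> K n);
          F = snd (proc M N X tau \<alpha> K n);
          t = Suc n;
          W = (\<lambda>k. real_cond_exp M F (\<lambda>\<omega>. if tau k \<omega> < t then 1 else 0));
          S' = (\<lambda>\<omega>. onestep \<alpha> (S \<omega>) (\<lambda>k. W k \<omega>))
      in (S', filstep M N F S' (\<lambda>k. X k (Suc t))))"

definition Sset where "Sset M N X tau \<alpha> K t = fst (proc M N X tau \<alpha> K (t - 1))"
definition Fil where "Fil M N X tau \<alpha> K t = snd (proc M N X tau \<alpha> K (t - 1))"

definition Wpost where
  "Wpost M N X tau \<alpha> K k t = real_cond_exp M (Fil M N X tau \<alpha> K t) (\<lambda>\<omega>. if tau k \<omega> < t then 1 else 0)"

definition lamhat where
  "lamhat M N X tau \<alpha> K t \<omega> = Max ((\<lambda>k. Wpost M N X tau \<alpha> K k t \<omega>) ` Sset M N X tau \<alpha> K (Suc t) \<omega>)"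

(* FNP_{t+1} *)
definition FNP where
  "FNP M N X tau \<alpha> K t \<omega> =
     (\<Sum>k \<in> Sset M N X tau \<alpha> K (Suc t) \<omega>. if tau k \<omega> < t then 1 else 0)
       / real (max (card (Sset M N X tau \<alpha> K (Suc t) \<omega>)) 1)"

(* LFNR_{t+1} = E(FNP_{t+1} | F_t) *)
definition LFNR where
  "LFNR M N X tau \<alpha> K t = real_cond_exp M (Fil M N X tau \<alpha> K t) (FNP M N X tau \<alpha> K t)"

primrec Vseq :: "real \<Rightarrow> ('b \<Rightarrow> real) \<Rightarrow> ('b \<Rightarrow> real) \<Rightarrow> (nat \<Rightarrow> nat \<Rightarrow> 'a \<Rightarrow> 'b) \<Rightarrow> nat \<Rightarrow> 'a \<Rightarrow> real" where
  "Vseq \<theta> p q X 0 \<omega> = 0"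
| "Vseq \<theta> p q X (Suc t) \<omega> =
     (let L = q (X 1 (Suc t) \<omega>) / p (X 1 (Suc t) \<omega>); v = Vseq \<theta> p q X t \<omega>
      in L / ((1 - \<theta>) * (1 - v) / (\<theta> + (1 - \<theta>) * v) + L))"

definition cexp_event :: "'a measure \<Rightarrow> ('a \<Rightarrow> real) \<Rightarrow> 'a set \<Rightarrow> real" where
  "cexp_event M f A = integral\<^sup>L M (\<lambda>\<omega>. f \<omega> * indicator A \<omega>) / measure M A"

primrec lamlist :: "'a measure \<Rightarrow> (nat \<Rightarrow> 'a \<Rightarrow> real) \<Rightarrow> real \<Rightarrow> nat \<Rightarrow> real list" where
  "lamlist M V \<alpha> 0 = [1]"
| "lamlist M V \<alpha> (Suc n) = lamlist M V \<alpha> n @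
     [Sup {l \<in> {0..1}. cexp_event M (V (Suc n))
            {\<omega> \<in> space M. V (Suc n) \<omega> \<le> l \<and> (\<forall>s\<le>n. V s \<omega> \<le> lamlist M V \<alpha> n ! s)} \<le> \<alpha>}]"

definition lam :: "'a measure \<Rightarrow> (nat \<Rightarrow> 'a \<Rightarrow> real) \<Rightarrow> real \<Rightarrow> nat \<Rightarrow> real" where
  "lam M V \<alpha> t = lamlist M V \<alpha> t ! t"

definition LR_has_good_density :: "'b measure \<Rightarrow> ('b \<Rightarrow> real) \<Rightarrow> ('b \<Rightarrow> real) \<Rightarrow> bool" where
  "LR_has_good_density P p q =
     (\<exists>f :: real \<Rightarrow> real. (\<forall>x. x \<le> 0 \<longrightarrow> f x = 0) \<and> continuous_on {0<..} f \<and> (\<forall>x>0. f x > 0)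
        \<and> distributed P lborel (\<lambda>y. q y / p y) (\<lambda>x. ennreal (f x)))"

end

(*
  Let V_k,t be the posterior probability of tau_k < t given the observations of stream k alone.
  By independence of the streams it is also the posterior given all streams, and since it is
  measurable with respect to the filtration of the procedure as long as stream k is active, the
  posteriors W_k,t of active streams are V_k,t. Hence the procedure applies the one-step rule to
  i.i.d. copies of V.

  The one-step rule keeps {W <= l} whenever the sum of W - alpha over {W <= l} is nonpositive,
  and keeps nothing outside {W <= l} whenever this sum is positive. By the law of large numbers
  the sum divided by K tends to psi(l) = E((V_t - alpha) 1(V_t <= l, V_s <= lambda_s, s < t)),
  provided that the active set agrees with {V_s <= lambda_s, s < t} up to o(K) streams. Since the
  law of V_t given the past has full support in (0,1), psi is negative below lambda_t and positive
  above it, and as V_t has no atoms, the agreement up to o(K) streams passes to the next time.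

  Finally E(V_t | V_s <= lambda_s, s < t) = theta + (1 - theta) c with c the value at time t - 1,
  and the threshold truncates it at alpha, so the limiting LFNR is min(alpha, 1 - (1 - theta)^t).
*)
theory Submission
  imports Defs
begin

text \<open>The filtration is adaptive: whether a stream is observed depends on earlier data of all
  streams, so Bayes' formula cannot be applied to it directly. It is proved on boxes of fully
  observed data, extended to the sigma-algebra they generate, and then tested on the events of the
  smaller, adaptive filtration.

  Membership in the active set couples the streams, so no law of large numbers applies to it
  directly. The comparison set \<open>Acc\<close>, defined by the limiting thresholds, has
  independent membership, and the two sets are compared only through the size of their symmetric
  difference.

  Posteriors are fixed only up to null sets, and the law of large numbers has one null set per
  function. The levels at distance 1/(m+1) from the threshold keep the family of test functions
  countable; one null set then covers everything, and the rest is deterministic on one trajectory.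

  All block densities are taken relative to the law of T pre-change observations. There the event
  tau \<ge> T has the constant weight (1 - \<theta>)^T, which makes the posterior odds
  explicit.\<close>

section \<open>The one-step rule in terms of lexicographic prefixes\<close>

definition lex_less :: "('i::linorder \<Rightarrow> real) \<Rightarrow> 'i \<Rightarrow> 'i \<Rightarrow> bool" where
  "lex_less W i j \<longleftrightarrow> W i < W j \<or> (W i = W j \<and> i < j)"

text \<open>Set version of a prefix of the sorted list. It is expressed by comparisons of values and
  indices only, which makes measurability and dependence on W visible.\<close>

definition lex_prefix :: "nat set \<Rightarrow> (nat \<Rightarrow> real) \<Rightarrow> nat \<Rightarrow> nat set" where
  "lex_prefix S W j = {i \<in> S. W i < W j \<or> (W i = W j \<and> i \<le> j)}"

text \<open>\<open>insort_key\<close> puts x in front of entries with an equal key, which is the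
  right tie-break when x has the smallest index. \<open>sort_key\<close> inserts from the right end
  of its input, so on an increasing list this hypothesis holds at each insertion.\<close>

lemma sorted_wrt_lex_less_insort_key:
  assumes "sorted_wrt (lex_less W) ys" "\<And>y. y \<in> set ys \<Longrightarrow> x < y"
  shows "sorted_wrt (lex_less W) (insort_key W x ys)"
  using assms
  by (induction ys) (fastforce simp: set_insort_key lex_less_def)+

lemma sorted_wrt_lex_less_sort_key:
  assumes "sorted_wrt (<) xs"
  shows "sorted_wrt (lex_less W) (sort_key W xs)"
  using assms
  by (induction xs) (auto simp: sort_key_def intro!: sorted_wrt_lex_less_insort_key simp flip: sort_key_def)

lemma onestep_lex_list:
  fixes W :: "nat \<Rightarrow> real"
  assumes "finite S"
  defines "ks \<equiv> sort_key W (sorted_list_of_set S)"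
  shows "set ks = S" "distinct ks" "sorted_wrt (lex_less W) ks"
  using assms by (auto simp: ks_def intro!: sorted_wrt_lex_less_sort_key)

lemma set_take_lex_sorted:
  assumes "sorted_wrt (lex_less W) ks" "i < length ks"
  shows "set (take (Suc i) ks) = lex_prefix (set ks) W (ks ! i)"
proof -
  have *: "ks ! a \<in> lex_prefix (set ks) W (ks ! i) \<longleftrightarrow> a \<le> i" if "a < length ks" for a
    using sorted_wrt_nth_less[OF assms(1), of a i] sorted_wrt_nth_less[OF assms(1), of i a] that assms(2)
    by (cases a i rule: linorder_cases) (auto simp: lex_prefix_def lex_less_def)
  have "lex_prefix (set ks) W (ks ! i) \<subseteq> set ks"
    by (auto simp: lex_prefix_def)
  then show ?thesis
    using * assms(2) by (force simp: set_conv_nth in_set_conv_nth less_Suc_eq_le)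
qed

lemma sum_list_prefix:
  assumes "distinct ks" "n \<le> length ks"
  shows "(\<Sum>i<n. W (ks ! i)) = sum W (set (take n ks))"
proof -
  have "set (take n ks) = (!) ks ` {..<n}"
    using assms(2) nth_image[of n ks] by (simp add: lessThan_atLeast0)
  moreover have "inj_on ((!) ks) {..<n}"
    using assms by (auto simp: inj_on_def nth_eq_iff_index_eq)
  ultimately show ?thesis
    by (simp add: sum.reindex)
qed

text \<open>The nonempty prefixes of the sorted list are the initial segments
  of the lexicographic order on pairs (posterior, index).\<close>
lemma onestep_eq:
  assumes "finite S" and "0 < \<alpha>"
  shows "onestep \<alpha> S W = {k \<in> S. \<exists>j\<in>S. k \<in> lex_prefix S W j \<and> (\<Sum>i\<in>lex_prefix S W j. W i - \<alpha>) \<le> 0}"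
proof -
  define ks where "ks = sort_key W (sorted_list_of_set S)"
  note ks = onestep_lex_list[OF assms(1), of W, folded ks_def]
  define G where "G = {n. n \<le> length ks \<and> (\<Sum>i<n. W (ks ! i)) / real n \<le> \<alpha>}"
  have one: "onestep \<alpha> S W = set (take (Max G) ks)"
    by (simp add: onestep_def Let_def ks_def G_def)
  \<comment> \<open>The empty average is 0 / 0 = 0, in accordance with R_0 = 0, so the maximum is
    over a nonempty set.\<close>
  have G: "finite G" "0 \<in> G"
    using assms by (auto simp: G_def)
  \<comment> \<open>Multiplying out the length turns the bound on the running average into a sign
    condition on the sum of W - \<alpha>, a form that is additive over sets of streams.\<close>
  have G_iff: "Suc i \<in> G \<longleftrightarrow> (\<Sum>k\<in>lex_prefix S W (ks ! i). W k - \<alpha>) \<le> 0" if "i < length ks" for i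
  proof -
    have "(\<Sum>k\<in>lex_prefix S W (ks ! i). W k - \<alpha>) = (\<Sum>a<Suc i. W (ks ! a) - \<alpha>)"
      using sum_list_prefix[OF ks(2), of "Suc i" "\<lambda>k. W k - \<alpha>"] set_take_lex_sorted[OF ks(3) that] that ks(1)
      by simp
    also have "\<dots> = (\<Sum>a<Suc i. W (ks ! a)) - real (Suc i) * \<alpha>"
      by (simp only: sum_subtractf) simp
    finally have "(\<Sum>k\<in>lex_prefix S W (ks ! i). W k - \<alpha>) \<le> 0 \<longleftrightarrow> (\<Sum>a<Suc i. W (ks ! a)) \<le> \<alpha> * real (Suc i)"
      by (simp only: diff_le_0_iff_le mult.commute)
    then show ?thesis
      using that by (simp only: G_def mem_Collect_eq pos_divide_le_eq of_nat_0_less_iff zero_less_Suc Suc_le_eq simp_thms)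
  qed
  show ?thesis
  proof (intro set_eqI iffI)
    fix k assume k: "k \<in> onestep \<alpha> S W"
    then have "Max G \<noteq> 0"
      by (metis one take_0 list.set(1) empty_iff)
    then obtain i where i: "Max G = Suc i"
      using not0_implies_Suc by blast
    have mem: "Suc i \<in> G"
      using Max_in[of G] G i by auto
    then have len: "i < length ks"
      by (simp add: G_def)
    have "k \<in> lex_prefix S W (ks ! i)"
      using k set_take_lex_sorted[OF ks(3) len] by (simp add: one i ks)
    moreover have "ks ! i \<in> S"
      using len ks(1) by auto
    ultimately show "k \<in> {k \<in> S. \<exists>j\<in>S. k \<in> lex_prefix S W j \<and> (\<Sum>i\<in>lex_prefix S W j. W i - \<alpha>) \<le> 0}"
      using G_iff[OF len] mem by (auto simp: lex_prefix_def)
  next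
    fix k assume "k \<in> {k \<in> S. \<exists>j\<in>S. k \<in> lex_prefix S W j \<and> (\<Sum>i\<in>lex_prefix S W j. W i - \<alpha>) \<le> 0}"
    then obtain j where j: "j \<in> S" "k \<in> lex_prefix S W j" "(\<Sum>i\<in>lex_prefix S W j. W i - \<alpha>) \<le> 0"
      by auto
    then obtain i where i: "i < length ks" "j = ks ! i"
      using ks(1) by (metis in_set_conv_nth)
    then have "Suc i \<in> G"
      using G_iff j by auto
    \<comment> \<open>Prefixes are nested, so lying in some admissible prefix is the same as lying
      in the largest one.\<close>
    then have "Suc i \<le> Max G"
      using G by auto
    then have "set (take (Suc i) ks) \<subseteq> set (take (Max G) ks)"
      by (rule set_take_subset_set_take)
    then show "k \<in> onestep \<alpha> S W"
      using j(2) set_take_lex_sorted[OF ks(3) i(1)] by (auto simp: one i ks)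
  qed
qed

lemma onestep_subset: "finite S \<Longrightarrow> 0 < \<alpha> \<Longrightarrow> onestep \<alpha> S W \<subseteq> S"
  by (auto simp: onestep_eq)

lemma lex_prefix_cong:
  assumes "\<And>k. k \<in> S \<Longrightarrow> W k = W' k" "j \<in> S"
  shows "lex_prefix S W j = lex_prefix S W' j"
  using assms by (auto simp: lex_prefix_def)

text \<open>The posteriors coincide with V on active streams only; the rule sees nothing
  else.\<close>

lemma onestep_cong:
  assumes "finite S" "0 < \<alpha>" "\<And>k. k \<in> S \<Longrightarrow> W k = W' k"
  shows "onestep \<alpha> S W = onestep \<alpha> S W'"
proof -
  have "(\<Sum>i\<in>lex_prefix S W j. W i - \<alpha>) = (\<Sum>i\<in>lex_prefix S W' j. W' i - \<alpha>)" if "j \<in> S" for j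
    by (rule sum.cong) (use assms that in \<open>auto simp: lex_prefix_def\<close>)
  then show ?thesis
    using assms lex_prefix_cong[of S W W'] by (auto simp: onestep_eq)
qed

text \<open>The witness is the lexicographically last member of the level set: the largest index
  among those with maximal W.\<close>

lemma lex_prefix_level_set:
  assumes "finite S" "{k \<in> S. W k \<le> l} \<noteq> {}"
  obtains j where "j \<in> S" "lex_prefix S W j = {k \<in> S. W k \<le> l}"
proof -
  define B where "B = {k \<in> S. W k \<le> l}"
  have B: "finite B" "B \<noteq> {}"
    using assms by (auto simp: B_def)
  define w where "w = Max (W ` B)"
  define j where "j = Max {k \<in> B. W k = w}"
  have "w \<in> W ` B"
    unfolding w_def using B by (intro Max_in) auto
  then have "{k \<in> B. W k = w} \<noteq> {}"
    by auto
  then have "j \<in> {k \<in> B. W k = w}"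
    unfolding j_def using B by (intro Max_in) auto
  then have j: "j \<in> B" "W j = w"
    by auto
  have "W k \<le> w" if "k \<in> B" for k
    unfolding w_def using that B by auto
  moreover have "k \<le> j" if "k \<in> B" "W k = w" for k
    unfolding j_def using that B by (intro Max_ge) auto
  ultimately have "lex_prefix S W j = B"
    using j by (fastforce simp: lex_prefix_def B_def)
  with j(1) show ?thesis
    by (intro that[of j]) (auto simp: B_def)
qed

text \<open>A nonempty level set is itself a prefix, and the sign condition makes it an admissible
  one.\<close>

lemma level_set_subset_onestep:
  assumes "finite S" "0 < \<alpha>" "(\<Sum>k\<in>{k \<in> S. W k \<le> l}. W k - \<alpha>) \<le> 0"
  shows "{k \<in> S. W k \<le> l} \<subseteq> onestep \<alpha> S W"
proof (cases "{k \<in> S. W k \<le> l} = {}")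
  case False
  obtain j where "j \<in> S" "lex_prefix S W j = {k \<in> S. W k \<le> l}"
    using lex_prefix_level_set[OF assms(1) False] .
  then show ?thesis
    using assms by (auto simp: onestep_eq)
next
  case True
  then show ?thesis by blast
qed

text \<open>A positive sum has a positive term, so l > \<alpha>. Every stream beyond level l then
  adds a positive term, and no prefix reaching beyond l can return to a nonpositive sum.\<close>

lemma onestep_subset_level_set:
  assumes "finite S" "0 < \<alpha>" "(\<Sum>k\<in>{k \<in> S. W k \<le> l}. W k - \<alpha>) > 0"
  shows "onestep \<alpha> S W \<subseteq> {k \<in> S. W k \<le> l}"
proof
  fix k assume "k \<in> onestep \<alpha> S W"
  then obtain j where j: "k \<in> S" "j \<in> S" "k \<in> lex_prefix S W j" "(\<Sum>i\<in>lex_prefix S W j. W i - \<alpha>) \<le> 0"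
    using assms by (auto simp: onestep_eq)
  have "\<exists>i\<in>{k \<in> S. W k \<le> l}. W i - \<alpha> > 0"
    using assms(3) by (meson not_less sum_nonpos)
  then have l: "\<alpha> < l"
    by auto
  show "k \<in> {k \<in> S. W k \<le> l}"
  proof (rule ccontr)
    assume "k \<notin> {k \<in> S. W k \<le> l}"
    with j have kl: "W j > l"
      by (auto simp: lex_prefix_def)
    have fin: "finite (lex_prefix S W j)"
      using assms by (auto simp: lex_prefix_def)
    have sub: "{k \<in> S. W k \<le> l} \<subseteq> lex_prefix S W j"
      using kl by (auto simp: lex_prefix_def)
    have "(\<Sum>i\<in>lex_prefix S W j. W i - \<alpha>) = (\<Sum>i\<in>lex_prefix S W j - {k \<in> S. W k \<le> l}. W i - \<alpha>) + (\<Sum>k\<in>{k \<in> S. W k \<le> l}. W k - \<alpha>)"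
      by (rule sum.subset_diff[OF sub fin])
    moreover have "(\<Sum>i\<in>lex_prefix S W j - {k \<in> S. W k \<le> l}. W i - \<alpha>) \<ge> 0"
      using l by (intro sum_nonneg) (auto simp: lex_prefix_def)
    ultimately show False
      using j assms by auto
  qed
qed

text \<open>The sums in \<open>onestep_eq\<close> run over random sets. Rewritten as sums over the
  fixed finite set A with a condition inside, they are visibly measurable.\<close>

lemma measurable_onestep:
  assumes A: "finite A" "\<And>\<omega>. S \<omega> \<subseteq> A" and \<alpha>: "0 < \<alpha>"
    and [measurable]: "\<And>k. Measurable.pred F (\<lambda>\<omega>. k \<in> S \<omega>)" "\<And>k. W k \<in> borel_measurable F"
  shows "Measurable.pred F (\<lambda>\<omega>. k \<in> onestep \<alpha> (S \<omega>) (\<lambda>k. W k \<omega>))"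
proof -
  have fin: "finite (S \<omega>)" for \<omega>
    using A finite_subset by blast
  have eq: "(\<Sum>i\<in>lex_prefix (S \<omega>) (\<lambda>k. W k \<omega>) j. W i \<omega> - \<alpha>)
     = (\<Sum>i\<in>A. if i \<in> S \<omega> \<and> (W i \<omega> < W j \<omega> \<or> (W i \<omega> = W j \<omega> \<and> i \<le> j)) then W i \<omega> - \<alpha> else 0)" for j \<omega>
    by (intro sum.mono_neutral_cong_left) (use A in \<open>auto simp: lex_prefix_def\<close>)
  have "(\<lambda>\<omega>. k \<in> onestep \<alpha> (S \<omega>) (\<lambda>k. W k \<omega>)) = (\<lambda>\<omega>. k \<in> S \<omega> \<and> (\<exists>j. j \<in> S \<omega> \<and>
      (W k \<omega> < W j \<omega> \<or> (W k \<omega> = W j \<omega> \<and> k \<le> j)) \<and>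
      (\<Sum>i\<in>A. if i \<in> S \<omega> \<and> (W i \<omega> < W j \<omega> \<or> (W i \<omega> = W j \<omega> \<and> i \<le> j)) then W i \<omega> - \<alpha> else 0) \<le> 0))"
    by (intro ext) (simp add: onestep_eq[OF fin \<alpha>] eq[symmetric], auto simp: lex_prefix_def)
  then show ?thesis
    by simp
qed

section \<open>A strong law for bounded variables\<close>

text \<open>Hoeffding's inequality makes the deviation probabilities geometric, hence summable, and
  Borel-Cantelli applies for each tolerance; tolerances 1/(m+1) suffice, so countably many null sets
  are merged. Hoeffding is used for each n separately, whence independence is asked for initial
  families only.\<close>

lemma (in prob_space) strong_law_bounded:
  fixes Y :: "nat \<Rightarrow> 'a \<Rightarrow> real"
  assumes indep: "\<And>n. indep_vars (\<lambda>_. borel) Y {1..n}"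
    and bnd: "\<And>k \<omega>. \<omega> \<in> space M \<Longrightarrow> Y k \<omega> \<in> {-1..1}"
    and mean: "\<And>k. 1 \<le> k \<Longrightarrow> expectation (Y k) = \<mu>"
  shows "AE \<omega> in M. (\<lambda>n. (\<Sum>k\<in>{1..n}. Y k \<omega>) / real n) \<longlonglongrightarrow> \<mu>"
proof -
  have [measurable]: "random_variable borel (Y k)" if "k \<in> {1..n}" for k n
    using indep[of n] that unfolding indep_vars_def by auto
  have sum_meas [measurable]: "(\<lambda>\<omega>. \<Sum>k\<in>{1..n}. Y k \<omega>) \<in> borel_measurable M" for n
    by (rule borel_measurable_sum) auto
  have small: "AE \<omega> in M. eventually (\<lambda>n. \<bar>(\<Sum>k\<in>{1..n}. Y k \<omega>) - real n * \<mu>\<bar> < e * real n) sequentially"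
    if e: "e > 0" for e :: real
  proof -
    define B where "B n = {\<omega> \<in> space M. \<bar>(\<Sum>k\<in>{1..n}. Y k \<omega>) - real n * \<mu>\<bar> \<ge> e * real n}" for n
    have [measurable]: "B n \<in> sets M" for n
      unfolding B_def by measurable
    \<comment> \<open>The variables range over an interval of length 2, so the exponent is -2 (e
      n)^2 / (4 n) = -n e^2 / 2. At n = 0 the bound is 2.\<close>
    have bound: "prob (B n) \<le> 2 * exp (- e\<^sup>2 / 2) ^ n" for n
    proof (cases "n = 0")
      case False
      interpret H: Hoeffding_ineq M "{1..n}" Y "\<lambda>_. -1" "\<lambda>_. 1" "\<Sum>i\<in>{1..n}. expectation (Y i)"
        by unfold_locales (use indep bnd in auto)
      have "(\<Sum>i\<in>{1..n}. expectation (Y i)) = real n * \<mu>"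
        using mean by simp
      then have "prob (B n) \<le> 2 * exp (-2 * (e * real n)\<^sup>2 / (real n * 4))"
        using H.Hoeffding_ineq_abs_ge[of "e * real n"] e False by (simp add: B_def)
      also have "-2 * (e * real n)\<^sup>2 / (real n * 4) = real n * (- e\<^sup>2 / 2)"
        using False by (simp add: power2_eq_square field_simps)
      finally show ?thesis
        by (simp only: exp_of_nat_mult)
    qed (use prob_le_1[of "B 0"] in \<open>simp, linarith\<close>)
    have "summable (\<lambda>n. 2 * exp (- e\<^sup>2 / 2) ^ n)"
      using e by (intro summable_mult summable_geometric) simp
    then have "summable (\<lambda>n. prob (B n))"
      by (rule summable_comparison_test'[where N = 0]) (use bound in auto)
    then have "AE \<omega> in M. eventually (\<lambda>n. \<omega> \<in> space M - B n) sequentially"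
      by (intro borel_cantelli_AE1) (auto simp: emeasure_eq_measure)
    then show ?thesis
      by (rule AE_mp) (auto simp: B_def elim!: eventually_mono)
  qed
  have "AE \<omega> in M. \<forall>m. eventually (\<lambda>n. \<bar>(\<Sum>k\<in>{1..n}. Y k \<omega>) - real n * \<mu>\<bar> < (1 / real (Suc m)) * real n) sequentially"
    unfolding AE_all_countable by (intro allI small) auto
  then show ?thesis
  proof (rule AE_mp, intro AE_I2 impI)
    fix \<omega> assume *: "\<forall>m. eventually (\<lambda>n. \<bar>(\<Sum>k\<in>{1..n}. Y k \<omega>) - real n * \<mu>\<bar> < (1 / real (Suc m)) * real n) sequentially"
    show "(\<lambda>n. (\<Sum>k\<in>{1..n}. Y k \<omega>) / real n) \<longlonglongrightarrow> \<mu>"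
    proof (rule tendstoI)
      fix e :: real assume "e > 0"
      then obtain m where m: "1 / real (Suc m) < e"
        using nat_approx_posE by blast
      have "eventually (\<lambda>n. \<bar>(\<Sum>k\<in>{1..n}. Y k \<omega>) - real n * \<mu>\<bar> < (1 / real (Suc m)) * real n) sequentially"
        using * by blast
      with eventually_gt_at_top[of 0] show "eventually (\<lambda>n. dist ((\<Sum>k\<in>{1..n}. Y k \<omega>) / real n) \<mu> < e) sequentially"
      proof eventually_elim
        case (elim n)
        have "dist ((\<Sum>k\<in>{1..n}. Y k \<omega>) / real n) \<mu> = \<bar>(\<Sum>k\<in>{1..n}. Y k \<omega>) - real n * \<mu>\<bar> / real n"
        proof -
          have "(\<Sum>k\<in>{1..n}. Y k \<omega>) / real n - \<mu> = ((\<Sum>k\<in>{1..n}. Y k \<omega>) - real n * \<mu>) / real n"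
            using elim by (simp add: field_simps)
          then show ?thesis
            by (simp only: dist_real_def abs_divide abs_of_nat)
        qed
        also have "\<dots> < 1 / real (Suc m)"
          using elim by (simp add: pos_divide_less_eq)
        finally show ?case
          using m by simp
      qed
    qed
  qed
qed


declare One_nat_def [simp del]

section \<open>Consequences of Assumption A1 for the likelihood ratio\<close>

lemma LR_good_density_atomless:
  assumes "LR_has_good_density P p q"
  shows "emeasure P {y \<in> space P. q y / p y = c} = 0"
proof -
  obtain f where D: "distributed P lborel (\<lambda>y. q y / p y) (\<lambda>x. ennreal (f x))"
    using assms by (auto simp: LR_has_good_density_def)
  have [measurable]: "(\<lambda>y. q y / p y) \<in> borel_measurable P" "(\<lambda>x. ennreal (f x)) \<in> borel_measurable lborel"
    using distributed_measurable[OF D] distributed_borel_measurable[OF D] by simp_all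
  have "emeasure P {y \<in> space P. q y / p y = c} = emeasure (distr P lborel (\<lambda>y. q y / p y)) {c}"
    by (subst emeasure_distr) (auto intro!: arg_cong[where f = "emeasure P"])
  also have "\<dots> = emeasure (density lborel (\<lambda>x. ennreal (f x))) {c}"
    using distributed_distr_eq_density[OF D] by simp
  also have "\<dots> = 0"
    by (subst emeasure_density) (auto simp: nn_integral_0_iff_AE intro!: AE_mp[OF AE_lborel_singleton[of c]])
  finally show ?thesis .
qed

lemma LR_good_density_pos:
  assumes "LR_has_good_density P p q" "0 \<le> a" "a < b"
  shows "emeasure P {y \<in> space P. a < q y / p y \<and> q y / p y < b} > 0"
proof -
  obtain f where D: "distributed P lborel (\<lambda>y. q y / p y) (\<lambda>x. ennreal (f x))"
    and f: "\<And>x. x > 0 \<Longrightarrow> f x > 0"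
    using assms by (auto simp: LR_has_good_density_def)
  have [measurable]: "(\<lambda>y. q y / p y) \<in> borel_measurable P" "(\<lambda>x. ennreal (f x)) \<in> borel_measurable lborel"
    using distributed_measurable[OF D] distributed_borel_measurable[OF D] by simp_all
  have "emeasure P {y \<in> space P. a < q y / p y \<and> q y / p y < b}
      = emeasure (distr P lborel (\<lambda>y. q y / p y)) {a<..<b}"
    by (subst emeasure_distr) (auto intro!: arg_cong[where f = "emeasure P"])
  also have "\<dots> = emeasure (density lborel (\<lambda>x. ennreal (f x))) {a<..<b}"
    using distributed_distr_eq_density[OF D] by simp
  also have "\<dots> > 0"
  proof (rule ccontr)
    assume "\<not> ?thesis"
    then have "{a<..<b} \<in> null_sets (density lborel (\<lambda>x. ennreal (f x)))"
      by (simp add: null_sets_def)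
    then have "AE x in lborel. x \<in> {a<..<b} \<longrightarrow> ennreal (f x) = 0"
      by (subst (asm) null_sets_density_iff) simp_all
    then have "AE x in lborel. x \<notin> {a<..<b}"
    proof eventually_elim
      case (elim x)
      show ?case
      proof
        assume x: "x \<in> {a<..<b}"
        then have "f x > 0"
          using assms by (intro f) simp
        with elim x show False
          by (simp add: ennreal_eq_0_iff)
      qed
    qed
    then have "emeasure lborel {a<..<b} = 0"
      by (subst (asm) AE_iff_measurable[of "{a<..<b}"]) auto
    then show False
      using assms by simp
  qed
  finally show ?thesis .
qed

lemma LR_good_density_AE_pos:
  assumes "LR_has_good_density P p q"
  shows "AE y in P. q y / p y > 0"
proof -
  obtain f where D: "distributed P lborel (\<lambda>y. q y / p y) (\<lambda>x. ennreal (f x))"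
    and f: "\<And>x. x \<le> 0 \<Longrightarrow> f x = 0"
    using assms by (auto simp: LR_has_good_density_def)
  have [measurable]: "(\<lambda>y. q y / p y) \<in> borel_measurable P" "(\<lambda>x. ennreal (f x)) \<in> borel_measurable lborel"
    using distributed_measurable[OF D] distributed_borel_measurable[OF D] by simp_all
  have "AE x in density lborel (\<lambda>x. ennreal (f x)). x > 0"
  proof (subst AE_density, simp, intro AE_I2 impI, rule ccontr)
    fix x assume "0 < ennreal (f x)" "\<not> 0 < x"
    then show False
      using f[of x] by simp
  qed
  then have "AE x in distr P lborel (\<lambda>y. q y / p y). x > 0"
    unfolding distributed_distr_eq_density[OF D] .
  then show ?thesis
    by (subst (asm) AE_distr_iff) auto
qed

section \<open>The model and the law of a block of observations\<close>

text \<open>\<open>model\<close> prescribes probabilities of cylinder events with every change point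
  fixed. Independence of the streams and Bayes' formula are recovered from it by summing over change
  points and by arguments on generators closed under intersection.\<close>

locale stream_model = prob_space M for M :: "'a measure" +
  fixes N :: "'b measure" and p q :: "'b \<Rightarrow> real" and \<theta> :: real
    and tau :: "nat \<Rightarrow> 'a \<Rightarrow> nat" and X :: "nat \<Rightarrow> nat \<Rightarrow> 'a \<Rightarrow> 'b"
  assumes theta: "0 < \<theta>" "\<theta> < 1"
    and p_meas [measurable]: "p \<in> borel_measurable N" and q_meas [measurable]: "q \<in> borel_measurable N"
    and p_nn: "\<And>y. p y \<ge> 0" and q_nn: "\<And>y. q y \<ge> 0"
    and p_prob: "prob_space (density N (\<lambda>y. ennreal (p y)))"
    and q_prob: "prob_space (density N (\<lambda>y. ennreal (q y)))"
    and tau_meas [measurable]: "\<And>k. tau k \<in> measurable M (count_space UNIV)"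
    and X_meas [measurable]: "\<And>k t. X k t \<in> measurable M N"
    and model: "\<And>n T (m :: nat \<Rightarrow> nat) (A :: nat \<Rightarrow> nat \<Rightarrow> 'b set).
        (\<And>k t. A k t \<in> sets N) \<Longrightarrow>
        measure M {\<omega> \<in> space M. \<forall>k\<in>{1..n}. tau k \<omega> = m k \<and> (\<forall>t\<in>{1..T}. X k t \<omega> \<in> A k t)}
        = (\<Prod>k\<in>{1..n}. \<theta> * (1 - \<theta>) ^ m k *
             (\<Prod>t\<in>{1..T}. measure (density N (\<lambda>y. ennreal (if t \<le> m k then p y else q y))) (A k t)))"
    and A1_p: "LR_has_good_density (density N (\<lambda>y. ennreal (p y))) p q"
    and A1_q: "LR_has_good_density (density N (\<lambda>y. ennreal (q y))) p q"
begin

definition "P = density N (\<lambda>y. ennreal (p y))"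
definition "Q = density N (\<lambda>y. ennreal (q y))"
definition L :: "'b \<Rightarrow> real" where "L y = q y / p y"
definition "PT T = (\<Pi>\<^sub>M s\<in>{1..T::nat}. P)"
definition "XT T = (\<Pi>\<^sub>M s\<in>{1..T::nat}. N)"
definition block :: "nat \<Rightarrow> nat \<Rightarrow> 'a \<Rightarrow> nat \<Rightarrow> 'b" where
  "block k T \<omega> = (\<lambda>s\<in>{1..T}. X k s \<omega>)"

lemma sets_P [measurable_cong, simp]: "sets P = sets N" and space_P [simp]: "space P = space N"
  and sets_Q [measurable_cong, simp]: "sets Q = sets N" and space_Q [simp]: "space Q = space N"
  by (auto simp: P_def Q_def)

lemma sets_PT [measurable_cong, simp]: "sets (PT T) = sets (XT T)"
  by (auto simp: PT_def XT_def intro!: sets_PiM_cong)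

lemma space_PT [simp]: "space (PT T) = space (XT T)"
  by (rule sets_eq_imp_space_eq) simp

sublocale P: prob_space P unfolding P_def by (rule p_prob)
sublocale Q: prob_space Q unfolding Q_def by (rule q_prob)
sublocale PT: prob_space "PT T" for T
  unfolding PT_def by (intro prob_space_PiM P.prob_space_axioms)
sublocale PS: product_sigma_finite "\<lambda>_::nat. P" ..

lemma L_meas [measurable]: "L \<in> borel_measurable N"
  unfolding L_def by measurable

lemma L_nonneg [simp]: "L y \<ge> 0"
  by (simp add: L_def p_nn q_nn)

lemma block_meas [measurable]: "block k T \<in> measurable M (XT T)"
  unfolding block_def XT_def by measurable

lemma block_in_PiE: "\<omega> \<in> space M \<Longrightarrow> block k T \<omega> \<in> Pi\<^sub>E {1..T} A \<longleftrightarrow> (\<forall>s\<in>{1..T}. X k s \<omega> \<in> A s)"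
  by (auto simp: block_def PiE_def Pi_def)

text \<open>Where \<open>p\<close> vanishes the quotient is the junk value 0; this set is \<open>q\<close>-null
  because the likelihood ratio has a density on the positive reals under \<open>q\<close>.\<close>
lemma Q_eq_density: "Q = density P (\<lambda>y. ennreal (L y))"
proof -
  have "AE y in N. q y > 0 \<longrightarrow> q y / p y > 0"
    using LR_good_density_AE_pos[OF A1_q] by (subst (asm) AE_density) auto
  then have "AE y in N. ennreal (q y) = ennreal (p y) * ennreal (L y)"
  proof eventually_elim
    case (elim y)
    then show ?case
      using p_nn[of y] q_nn[of y]
      by (cases "q y = 0"; cases "p y = 0") (auto simp: L_def simp flip: ennreal_mult)
  qed
  then have "Q = density N (\<lambda>y. ennreal (p y) * ennreal (L y))"
    unfolding Q_def by (intro density_cong) auto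
  also have "\<dots> = density P (\<lambda>y. ennreal (L y))"
    unfolding P_def by (intro density_density_eq[symmetric]) auto
  finally show ?thesis .
qed

definition w :: "nat \<Rightarrow> real" where "w m = \<theta> * (1 - \<theta>) ^ m"

lemma w_nonneg [simp]: "w m \<ge> 0"
  using theta by (simp add: w_def)

definition box_weight :: "nat \<Rightarrow> nat \<Rightarrow> (nat \<Rightarrow> 'b set) \<Rightarrow> ennreal" where
  "box_weight T m A = ennreal (w m) * (\<Prod>s\<in>{1..T}. emeasure (if s \<le> m then P else Q) (A s))"

text \<open>An extended nonnegative integral over the counting measure covers infinite B, such as
  \<open>UNIV\<close>, without summability conditions.\<close>

definition box_mass :: "nat \<Rightarrow> nat set \<Rightarrow> (nat \<Rightarrow> 'b set) \<Rightarrow> ennreal" where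
  "box_mass T B A = (\<integral>\<^sup>+m. box_weight T m A \<partial>count_space B)"

lemma box_mass_singleton: "box_mass T {m} A = box_weight T m A"
  by (simp add: box_mass_def nn_integral_count_space_finite)

lemma model_emeasure:
  assumes "\<And>k t. A k t \<in> sets N"
  shows "emeasure M {\<omega> \<in> space M. \<forall>k\<in>{1..n}. tau k \<omega> = m k \<and> (\<forall>t\<in>{1..T}. X k t \<omega> \<in> A k t)}
    = (\<Prod>k\<in>{1..n}. box_weight T (m k) (A k))"
proof -
  have eq: "density N (\<lambda>y. ennreal (if t \<le> j then p y else q y)) = (if t \<le> j then P else Q)" for t j
    by (auto simp: P_def Q_def)
  have "box_weight T (m k) (A k) = ennreal (\<theta> * (1 - \<theta>) ^ m k *
             (\<Prod>t\<in>{1..T}. measure (if t \<le> m k then P else Q) (A k t)))" for k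
    using theta by (auto simp: box_weight_def w_def ennreal_mult prod_nonneg P.emeasure_eq_measure Q.emeasure_eq_measure
        simp flip: prod_ennreal intro!: arg_cong2[where f = "(*)"] prod.cong)
  then show ?thesis
    unfolding emeasure_eq_measure model[OF assms] eq
    using theta by (subst prod_ennreal[symmetric]) (auto intro!: mult_nonneg_nonneg prod_nonneg)
qed

text \<open>J collects the streams whose change-point constraint is arbitrary; outside J it is a
  single value. The induction frees one stream at a time: split by the value of its change point,
  use the hypothesis for each value, and integrate, the other factors being constant.\<close>

lemma emeasure_boxes_partial:
  assumes A: "\<And>k t. A k t \<in> sets N"
    and J: "finite J" "J \<subseteq> {1..n}" "\<And>k. k \<in> {1..n} - J \<Longrightarrow> \<exists>m. B k = {m}"
  shows "emeasure M {\<omega> \<in> space M. \<forall>k\<in>{1..n}. tau k \<omega> \<in> B k \<and> (\<forall>t\<in>{1..T}. X k t \<omega> \<in> A k t)}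
    = (\<Prod>k\<in>{1..n}. box_mass T (B k) (A k))"
  using J
proof (induction J arbitrary: B rule: finite_induct)
  case empty
  then obtain m where m: "\<And>k. k \<in> {1..n} \<Longrightarrow> B k = {m k}"
    by (metis Diff_empty)
  have "{\<omega> \<in> space M. \<forall>k\<in>{1..n}. tau k \<omega> \<in> B k \<and> (\<forall>t\<in>{1..T}. X k t \<omega> \<in> A k t)}
      = {\<omega> \<in> space M. \<forall>k\<in>{1..n}. tau k \<omega> = m k \<and> (\<forall>t\<in>{1..T}. X k t \<omega> \<in> A k t)}"
    using m by auto
  also have "emeasure M \<dots> = (\<Prod>k\<in>{1..n}. box_weight T (m k) (A k))"
    using A by (rule model_emeasure)
  finally show ?case
    using m by (simp add: box_mass_singleton)
next
  case (insert j J)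
  define E where "E B = {\<omega> \<in> space M. \<forall>k\<in>{1..n}. tau k \<omega> \<in> B k \<and> (\<forall>t\<in>{1..T}. X k t \<omega> \<in> A k t)}" for B
  have [measurable]: "A k t \<in> sets N" for k t
    by (rule A)
  have [measurable]: "E B \<in> sets M" for B
    unfolding E_def by measurable
  have j: "j \<in> {1..n}"
    using insert by auto
  have upd: "(\<forall>k\<in>I. tau k \<omega> \<in> (B(j := {m})) k \<and> R k) \<longleftrightarrow> (\<forall>k\<in>I. tau k \<omega> \<in> B k \<and> R k) \<and> tau j \<omega> = m"
    if "j \<in> I" "m \<in> B j" for I m \<omega> R
    using that by (auto split: if_split_asm)
  have E_upd: "E (B(j := {m})) = {\<omega> \<in> E B. tau j \<omega> = m}" if "m \<in> B j" for m
    unfolding E_def upd[OF j that] by blast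
  have "\<forall>\<omega>\<in>E B. tau j \<omega> \<in> B j"
    using j unfolding E_def by blast
  then have "E B = (\<Union>m\<in>B j. {\<omega> \<in> E B. tau j \<omega> = m})"
    by blast
  also have "\<dots> = (\<Union>m\<in>B j. E (B(j := {m})))"
    by (intro SUP_cong refl E_upd[symmetric])
  finally have "E B = (\<Union>m\<in>B j. E (B(j := {m})))" .
  moreover have "disjoint_family_on (\<lambda>m. E (B(j := {m}))) (B j)"
    unfolding disjoint_family_on_def
  proof (intro ballI impI)
    fix m m' assume m: "m \<in> B j" "m' \<in> B j" "m \<noteq> m'"
    then show "E (B(j := {m})) \<inter> E (B(j := {m'})) = {}"
      unfolding E_upd[OF m(1)] E_upd[OF m(2)] by blast
  qed
  ultimately have 1: "emeasure M (E B) = (\<integral>\<^sup>+m. emeasure M (E (B(j := {m}))) \<partial>count_space (B j))"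
    by (simp add: emeasure_UN_countable)
  have "(\<integral>\<^sup>+m. emeasure M (E (B(j := {m}))) \<partial>count_space (B j)) =
      (\<integral>\<^sup>+m. (\<Prod>k\<in>{1..n}-{j}. box_mass T (B k) (A k)) * box_weight T m (A j) \<partial>count_space (B j))"
  proof (rule nn_integral_cong)
    fix m assume "m \<in> space (count_space (B j))"
    have "emeasure M (E (B(j := {m}))) = (\<Prod>k\<in>{1..n}. box_mass T ((B(j := {m})) k) (A k))"
      unfolding E_def by (rule insert.IH) (use insert.prems in auto)
    also have "\<dots> = (\<Prod>k\<in>{1..n}-{j}. box_mass T ((B(j := {m})) k) (A k)) * box_mass T {m} (A j)"
      using prod.remove[OF finite_atLeastAtMost j, of "\<lambda>k. box_mass T ((B(j := {m})) k) (A k)"]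
      by (simp only: mult.commute fun_upd_same)
    also have "(\<Prod>k\<in>{1..n}-{j}. box_mass T ((B(j := {m})) k) (A k)) = (\<Prod>k\<in>{1..n}-{j}. box_mass T (B k) (A k))"
      by (intro prod.cong) auto
    finally show "emeasure M (E (B(j := {m}))) = (\<Prod>k\<in>{1..n}-{j}. box_mass T (B k) (A k)) * box_weight T m (A j)"
      by (simp only: box_mass_singleton)
  qed
  also have "\<dots> = (\<Prod>k\<in>{1..n}-{j}. box_mass T (B k) (A k)) * box_mass T (B j) (A j)"
    unfolding box_mass_def[of T "B j"] by (rule nn_integral_cmult) simp
  also have "\<dots> = (\<Prod>k\<in>{1..n}. box_mass T (B k) (A k))"
    using prod.remove[OF finite_atLeastAtMost j, of "\<lambda>k. box_mass T (B k) (A k)"] by (simp only: mult.commute)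
  finally show ?case
    using 1 unfolding E_def by (rule trans[rotated])
qed

lemma emeasure_boxes:
  assumes "\<And>k t. A k t \<in> sets N"
  shows "emeasure M {\<omega> \<in> space M. \<forall>k\<in>{1..n}. tau k \<omega> \<in> B k \<and> (\<forall>t\<in>{1..T}. X k t \<omega> \<in> A k t)}
    = (\<Prod>k\<in>{1..n}. box_mass T (B k) (A k))"
  using assms by (rule emeasure_boxes_partial[where J = "{1..n}"]) auto

text \<open>Read off from the total mass of M with a single unconstrained stream, which avoids
  summing the geometric series.\<close>

lemma box_mass_space: "box_mass T UNIV (\<lambda>_. space N) = 1"
proof -
  have "space M = {\<omega> \<in> space M. \<forall>k\<in>{1..1}. tau k \<omega> \<in> UNIV \<and> (\<forall>t\<in>{1..T}. X k t \<omega> \<in> space N)}"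
    using X_meas[THEN measurable_space] by auto
  also have "emeasure M \<dots> = (\<Prod>k\<in>{1..1::nat}. box_mass T UNIV (\<lambda>_. space N))"
    by (rule emeasure_boxes) simp
  finally show ?thesis
    using emeasure_space_1 by simp
qed

text \<open>Among streams 1..k only the last one is constrained; the others contribute factors 1 by
  \<open>box_mass_space\<close>.\<close>

lemma emeasure_box:
  assumes "1 \<le> k" "\<And>t. A t \<in> sets N"
  shows "emeasure M {\<omega> \<in> space M. tau k \<omega> \<in> B \<and> (\<forall>t\<in>{1..T}. X k t \<omega> \<in> A t)} = box_mass T B A"
proof -
  define A' where "A' j = (if j = k then A else (\<lambda>_. space N))" for j
  define B' where "B' j = (if j = k then B else UNIV)" for j
  have "{\<omega> \<in> space M. tau k \<omega> \<in> B \<and> (\<forall>t\<in>{1..T}. X k t \<omega> \<in> A t)}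
    = {\<omega> \<in> space M. \<forall>j\<in>{1..k}. tau j \<omega> \<in> B' j \<and> (\<forall>t\<in>{1..T}. X j t \<omega> \<in> A' j t)}"
  proof -
    have "(\<forall>j\<in>I. tau j \<omega> \<in> B' j \<and> (\<forall>t\<in>{1..T}. X j t \<omega> \<in> A' j t)) \<longleftrightarrow> tau k \<omega> \<in> B \<and> (\<forall>t\<in>{1..T}. X k t \<omega> \<in> A t)"
      if "k \<in> I" "\<omega> \<in> space M" for I \<omega>
      using that measurable_space[OF X_meas that(2)] by (auto simp: A'_def B'_def)
    from this[of "{1..k}"] show ?thesis
      using assms(1) by (intro Collect_cong conj_cong) auto
  qed
  also have "emeasure M \<dots> = (\<Prod>j\<in>{1..k}. box_mass T (B' j) (A' j))"
    by (rule emeasure_boxes) (auto simp: A'_def assms)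
  also have "\<dots> = (\<Prod>j\<in>{k}. box_mass T (B' j) (A' j))"
    using assms by (intro prod.mono_neutral_right) (auto simp: A'_def B'_def box_mass_space)
  finally show ?thesis
    by (simp add: A'_def B'_def)
qed

lemma prod_algebra_blockD:
  fixes T :: nat
  assumes "Z \<in> prod_algebra {1..T} (\<lambda>_. N)"
  obtains A where "Z = Pi\<^sub>E {1..T} A" "\<And>s. A s \<in> sets N"
proof -
  have "Z \<in> {Pi\<^sub>E {1..T} A |A. A \<in> {1..T} \<rightarrow> sets N}"
    using assms prod_algebra_eq_finite[of "{1..T}" "\<lambda>_. N"] by simp
  then obtain A where A: "Z = Pi\<^sub>E {1..T} A" "A \<in> {1..T} \<rightarrow> sets N"
    by (elim CollectE exE conjE)
  show ?thesis
  proof (rule that[of "\<lambda>s. if s \<in> {1..T} then A s else {}"])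
    show "Z = Pi\<^sub>E {1..T} (\<lambda>s. if s \<in> {1..T} then A s else {})"
      unfolding A(1) by (rule PiE_cong) simp
  qed (use A(2) in \<open>auto simp: Pi_iff\<close>)
qed

text \<open>Boxes generate the block space and are closed under intersection, and on boxes, with
  change points left free, the joint probability is a product of \<open>box_mass\<close> factors,
  each of them a marginal.\<close>

lemma indep_blocks: "indep_vars (\<lambda>_. XT T) (\<lambda>k. block k T) {1..n}"
proof (cases "n = 0")
  case True
  then show ?thesis
    by (simp add: indep_vars_def indep_sets_def)
next
  case False
  show ?thesis
  proof (subst indep_vars_finite[where E = "\<lambda>_. prod_algebra {1..T} (\<lambda>_. N)"])
    show "sets (XT T) = sigma_sets (space (XT T)) (prod_algebra {1..T} (\<lambda>_. N))"
      by (simp add: XT_def sets_PiM space_PiM)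
    show "Int_stable (prod_algebra {1..T} (\<lambda>_. N))"
      by (rule Int_stable_prod_algebra)
    show "space (XT T) \<in> prod_algebra {1..T} (\<lambda>_. N)"
      by (simp add: XT_def space_PiM space_in_prod_algebra)
    show "prod_algebra {1..T} (\<lambda>_. N) \<subseteq> Pow (space (XT T))"
      unfolding XT_def space_PiM by (rule prod_algebra_sets_into_space)
    show "\<forall>A\<in>{1..n} \<rightarrow> prod_algebra {1..T} (\<lambda>_. N).
       prob (\<Inter>j\<in>{1..n}. block j T -` A j \<inter> space M) = (\<Prod>j\<in>{1..n}. prob (block j T -` A j \<inter> space M))"
    proof
      fix A :: "nat \<Rightarrow> (nat \<Rightarrow> 'b) set" assume "A \<in> {1..n} \<rightarrow> prod_algebra {1..T} (\<lambda>_. N)"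
      then have "\<forall>k\<in>{1..n}. \<exists>C. A k = Pi\<^sub>E {1..T} C \<and> (\<forall>s. C s \<in> sets N)"
        by (metis PiE_def Pi_mem prod_algebra_blockD)
      then obtain C' where C': "\<forall>k\<in>{1..n}. A k = Pi\<^sub>E {1..T} (C' k) \<and> (\<forall>s. C' k s \<in> sets N)"
        by metis
      define C where "C k = (if k \<in> {1..n} then C' k else (\<lambda>_. {}))" for k
      have C: "A k = Pi\<^sub>E {1..T} (C k)" if "k \<in> {1..n}" for k
        using C' that by (simp add: C_def)
      have C_sets: "C k s \<in> sets N" for k s
        using C' by (simp add: C_def)
      have eq: "block k T -` A k \<inter> space M = {\<omega> \<in> space M. tau k \<omega> \<in> UNIV \<and> (\<forall>t\<in>{1..T}. X k t \<omega> \<in> C k t)}"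
        if "k \<in> {1..n}" for k
        using C[OF that] block_in_PiE[of _ k T "C k"] by blast
      have "(\<Inter>j\<in>{1..n}. block j T -` A j \<inter> space M)
        = {\<omega> \<in> space M. \<forall>k\<in>{1..n}. tau k \<omega> \<in> UNIV \<and> (\<forall>t\<in>{1..T}. X k t \<omega> \<in> C k t)}"
      proof (intro set_eqI iffI)
        fix \<omega> assume "\<omega> \<in> (\<Inter>j\<in>{1..n}. block j T -` A j \<inter> space M)"
        then have "\<forall>k\<in>{1..n}. \<omega> \<in> {\<omega> \<in> space M. tau k \<omega> \<in> UNIV \<and> (\<forall>t\<in>{1..T}. X k t \<omega> \<in> C k t)}"
          using eq by blast
        \<comment> \<open>Some index is needed to conclude that the point of the intersection lies
          in \<open>space M\<close>; this is why n = 0 is treated apart.\<close>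
        moreover have "1 \<in> {1..n}"
          using False by auto
        ultimately show "\<omega> \<in> {\<omega> \<in> space M. \<forall>k\<in>{1..n}. tau k \<omega> \<in> UNIV \<and> (\<forall>t\<in>{1..T}. X k t \<omega> \<in> C k t)}"
          by blast
      qed (use eq in blast)
      then have "emeasure M (\<Inter>j\<in>{1..n}. block j T -` A j \<inter> space M) = (\<Prod>k\<in>{1..n}. box_mass T UNIV (C k))"
        using C_sets by (simp only: emeasure_boxes)
      also have "\<dots> = (\<Prod>k\<in>{1..n}. emeasure M (block k T -` A k \<inter> space M))"
      proof (rule prod.cong)
        fix k assume k: "k \<in> {1..n}"
        then show "box_mass T UNIV (C k) = emeasure M (block k T -` A k \<inter> space M)"
          unfolding eq[OF k] by (intro emeasure_box[symmetric] C_sets) auto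
      qed simp
      finally show "prob (\<Inter>j\<in>{1..n}. block j T -` A j \<inter> space M) = (\<Prod>j\<in>{1..n}. prob (block j T -` A j \<inter> space M))"
        by (simp add: emeasure_eq_measure prod_ennreal prod_nonneg)
    qed
  qed (use False in auto)
qed

text \<open>Density relative to \<open>PT T\<close> of the block given a change at m; the product is
  empty, hence 1, if m \<ge> T.\<close>

definition like :: "nat \<Rightarrow> nat \<Rightarrow> (nat \<Rightarrow> 'b) \<Rightarrow> real" where
  "like m T x = (\<Prod>s\<in>{m<..T}. L (x s))"

lemma like_meas [measurable]: "like m T \<in> borel_measurable (XT T)"
  unfolding like_def XT_def by measurable

lemma like_nonneg [simp]: "like m T x \<ge> 0"
  by (auto simp: like_def intro!: prod_nonneg)

text \<open>By \<open>Q_eq_density\<close> each post-change factor is an integral of L against P,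
  and the product of one-dimensional integrals is an integral over the product measure.\<close>

lemma box_weight_eq_integral:
  assumes A: "\<And>s. A s \<in> sets N"
  shows "box_weight T m A = (\<integral>\<^sup>+x\<in>Pi\<^sub>E {1..T} A. ennreal (w m * like m T x) \<partial>PT T)"
proof -
  have [measurable]: "A s \<in> sets N" for s by (rule A)
  have "(\<Prod>s\<in>{1..T}. emeasure (if s \<le> m then P else Q) (A s))
     = (\<Prod>s\<in>{1..T}. \<integral>\<^sup>+y. (if s \<le> m then 1 else ennreal (L y)) * indicator (A s) y \<partial>P)"
    by (intro prod.cong) (auto simp: Q_eq_density emeasure_density)
  also have "\<dots> = (\<integral>\<^sup>+x. (\<Prod>s\<in>{1..T}. (if s \<le> m then 1 else ennreal (L (x s))) * indicator (A s) (x s)) \<partial>PT T)"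
    unfolding PT_def by (subst PS.product_nn_integral_prod) auto
  also have "\<dots> = (\<integral>\<^sup>+x\<in>Pi\<^sub>E {1..T} A. ennreal (like m T x) \<partial>PT T)"
  proof (rule nn_integral_cong)
    fix x assume x: "x \<in> space (PT T)"
    have "(\<Prod>s\<in>{1..T}. (if s \<le> m then 1 else ennreal (L (x s)))) = (\<Prod>s\<in>{m<..T}. ennreal (L (x s)))"
      by (intro prod.mono_neutral_cong_right) auto
    also have "\<dots> = ennreal (like m T x)"
      by (simp add: like_def prod_ennreal)
    finally have 1: "(\<Prod>s\<in>{1..T}. (if s \<le> m then 1 else ennreal (L (x s)))) = ennreal (like m T x)" .
    have 2: "(\<Prod>s\<in>{1..T}. indicator (A s) (x s)) = (indicator (Pi\<^sub>E {1..T} A) x :: ennreal)"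
    proof (cases "\<forall>s\<in>{1..T}. x s \<in> A s")
      case True
      moreover have "x \<in> Pi\<^sub>E {1..T} A"
        using x True by (auto simp: XT_def space_PiM PiE_def)
      ultimately show ?thesis
        by simp
    next
      case False
      then obtain s where s: "s \<in> {1..T}" "x s \<notin> A s"
        by blast
      then have "x \<notin> Pi\<^sub>E {1..T} A"
        by blast
      moreover have "(\<Prod>s\<in>{1..T}. indicator (A s) (x s)) = (0 :: ennreal)"
        using s by (intro prod_zero bexI[of _ s]) auto
      ultimately show ?thesis
        by simp
    qed
    show "(\<Prod>s\<in>{1..T}. (if s \<le> m then 1 else ennreal (L (x s))) * indicator (A s) (x s))
      = ennreal (like m T x) * indicator (Pi\<^sub>E {1..T} A) x"
      by (simp only: prod.distrib 1 2)
  qed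
  finally have *: "(\<Prod>s\<in>{1..T}. emeasure (if s \<le> m then P else Q) (A s))
     = (\<integral>\<^sup>+x\<in>Pi\<^sub>E {1..T} A. ennreal (like m T x) \<partial>PT T)" .
  have [measurable]: "Pi\<^sub>E {1..T} A \<in> sets (XT T)"
    unfolding XT_def using A by (intro sets_PiM_I_finite) auto
  show ?thesis
    unfolding box_weight_def *
    by (simp add: ennreal_mult mult.assoc nn_integral_cmult)
qed

text \<open>As functions of A both sides are finite measures; they agree on boxes, which determine
  them.\<close>

lemma law_tau_eq:
  assumes k: "1 \<le> k" and A: "A \<in> sets (XT T)"
  shows "emeasure M {\<omega> \<in> space M. tau k \<omega> = m \<and> block k T \<omega> \<in> A} = (\<integral>\<^sup>+x\<in>A. ennreal (w m * like m T x) \<partial>PT T)"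
proof -
  let ?M1 = "distr (density M (indicator {\<omega> \<in> space M. tau k \<omega> = m})) (XT T) (block k T)"
  let ?M2 = "density (PT T) (\<lambda>x. ennreal (w m * like m T x))"
  have M1: "emeasure ?M1 C = emeasure M {\<omega> \<in> space M. tau k \<omega> = m \<and> block k T \<omega> \<in> C}" if [measurable]: "C \<in> sets (XT T)" for C
  proof -
    have "emeasure ?M1 C = (\<integral>\<^sup>+\<omega>. indicator {\<omega> \<in> space M. tau k \<omega> = m} \<omega> * indicator (block k T -` C \<inter> space M) \<omega> \<partial>M)"
      by (simp add: emeasure_distr emeasure_density)
    also have "\<dots> = (\<integral>\<^sup>+\<omega>. indicator {\<omega> \<in> space M. tau k \<omega> = m \<and> block k T \<omega> \<in> C} \<omega> \<partial>M)"
      by (intro nn_integral_cong) (auto simp: indicator_def)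
    also have "\<dots> = emeasure M {\<omega> \<in> space M. tau k \<omega> = m \<and> block k T \<omega> \<in> C}"
      by (rule nn_integral_indicator) measurable
    finally show ?thesis .
  qed
  have "?M1 = ?M2"
  proof (rule measure_eqI_PiM_finite[where I = "{1..T}" and M = "\<lambda>_. N" and A = "\<lambda>_. space (XT T)"])
    fix A assume A: "\<And>i. i \<in> {1..T} \<Longrightarrow> A i \<in> sets N"
    define A' where "A' s = (if s \<in> {1..T} then A s else {})" for s
    have A'_sets [measurable]: "A' s \<in> sets N" for s
      using A by (auto simp: A'_def)
    have eq: "Pi\<^sub>E {1..T} A = Pi\<^sub>E {1..T} A'"
      by (auto simp: A'_def intro!: PiE_cong)
    have [measurable]: "Pi\<^sub>E {1..T} A' \<in> sets (XT T)"
      unfolding XT_def by (intro sets_PiM_I_finite) auto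
    have "{\<omega> \<in> space M. tau k \<omega> = m \<and> block k T \<omega> \<in> Pi\<^sub>E {1..T} A'}
      = {\<omega> \<in> space M. tau k \<omega> \<in> {m} \<and> (\<forall>t\<in>{1..T}. X k t \<omega> \<in> A' t)}"
      using block_in_PiE[of _ k T A'] by blast
    then have "emeasure ?M1 (Pi\<^sub>E {1..T} A') = box_weight T m A'"
      using emeasure_box[where A = A' and T = T and B = "{m}", OF k A'_sets] by (simp only: M1 box_mass_singleton \<open>Pi\<^sub>E {1..T} A' \<in> sets (XT T)\<close>)
    also have "\<dots> = emeasure ?M2 (Pi\<^sub>E {1..T} A')"
      by (subst emeasure_density) (simp_all add: box_weight_eq_integral)
    finally show "emeasure ?M1 (Pi\<^sub>E {1..T} A) = emeasure ?M2 (Pi\<^sub>E {1..T} A)"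
      by (simp only: eq)
  next
    show "emeasure ?M1 (space (XT T)) \<noteq> \<infinity>"
      unfolding M1[OF sets.top] by simp
    show "range (\<lambda>_. space (XT T)) \<subseteq> prod_algebra {1..T} (\<lambda>_. N)"
      by (simp add: XT_def space_PiM space_in_prod_algebra)
  qed (simp_all add: XT_def)
  then show ?thesis
    using M1[OF A] A by (simp add: emeasure_density)
qed

end


lemma nn_integral_indicator_Collect:
  assumes "{\<omega> \<in> space M. f \<omega> \<in> A} \<in> sets M"
  shows "(\<integral>\<^sup>+\<omega>. indicator A (f \<omega>) \<partial>M) = emeasure M {\<omega> \<in> space M. f \<omega> \<in> A}"
  by (subst nn_integral_indicator[OF assms, symmetric], rule nn_integral_cong) (simp add: indicator_def)

section \<open>The single-stream posterior: Bayes' formula and recursion\<close>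

context stream_model
begin

text \<open>Unnormalised posterior weight of tau < T. The complementary weight is the constant (1 -
  \<theta>)^T, since \<open>like\<close> is 1 when no change falls within the block;
  \<open>vfun\<close> is therefore Bayes' formula.\<close>

definition num :: "nat \<Rightarrow> (nat \<Rightarrow> 'b) \<Rightarrow> real" where
  "num T x = (\<Sum>m<T. w m * like m T x)"

definition vfun :: "nat \<Rightarrow> (nat \<Rightarrow> 'b) \<Rightarrow> real" where
  "vfun T x = num T x / (num T x + (1 - \<theta>) ^ T)"

definition V :: "nat \<Rightarrow> nat \<Rightarrow> 'a \<Rightarrow> real" where
  "V k T \<omega> = vfun T (\<lambda>s. X k s \<omega>)"

lemma num_meas [measurable]: "num T \<in> borel_measurable (XT T)"
  unfolding num_def by measurable

lemma vfun_meas [measurable]: "vfun T \<in> borel_measurable (XT T)"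
  unfolding vfun_def by measurable

lemma num_nonneg [simp]: "num T x \<ge> 0"
  by (auto simp: num_def intro!: sum_nonneg)

lemma num_cong: "(\<And>s. s \<in> {1..T} \<Longrightarrow> x s = y s) \<Longrightarrow> num T x = num T y"
  unfolding num_def like_def by (intro sum.cong refl arg_cong2[where f = "(*)"] prod.cong) auto

lemma vfun_cong: "(\<And>s. s \<in> {1..T} \<Longrightarrow> x s = y s) \<Longrightarrow> vfun T x = vfun T y"
  unfolding vfun_def using num_cong[of T x y] by simp

lemma vfun_block: "t \<le> T \<Longrightarrow> vfun t (block k T \<omega>) = V k t \<omega>"
  unfolding V_def by (rule vfun_cong) (auto simp: block_def)

lemma V_meas [measurable]: "V k T \<in> borel_measurable M"
proof -
  have "(\<lambda>\<omega>. vfun T (block k T \<omega>)) \<in> borel_measurable M"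
    by measurable
  then show ?thesis
    by (simp add: vfun_block)
qed

lemma num_Suc: "num (Suc T) x = L (x (Suc T)) * (num T x + w T)"
proof -
  have "like m (Suc T) x = L (x (Suc T)) * like m T x" if "m \<le> T" for m
  proof -
    have "{m<..Suc T} = insert (Suc T) {m<..T}"
      using that by auto
    then show ?thesis
      by (simp add: like_def)
  qed
  then have "num (Suc T) x = (\<Sum>m<Suc T. w m * (L (x (Suc T)) * like m T x))"
    unfolding num_def by (intro sum.cong) auto
  also have "\<dots> = L (x (Suc T)) * (\<Sum>m<Suc T. w m * like m T x)"
    unfolding sum_distrib_left by (intro sum.cong refl) (simp add: mult_ac)
  also have "(\<Sum>m<Suc T. w m * like m T x) = num T x + w T"
    by (simp add: num_def like_def)
  finally show ?thesis .
qed

lemma vfun_denom_pos: "num T x + (1 - \<theta>) ^ T > 0"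
  using theta by (intro add_nonneg_pos) auto

lemma vfun_nonneg [simp]: "0 \<le> vfun T x"
  using vfun_denom_pos[of T x] by (simp add: vfun_def)

lemma vfun_less_1: "vfun T x < 1"
  using vfun_denom_pos[of T x] theta by (simp add: vfun_def)

lemma V_nonneg [simp]: "0 \<le> V k T \<omega>" and V_less_1: "V k T \<omega> < 1" and V_le_1 [simp]: "V k T \<omega> \<le> 1"
  using vfun_less_1[of T "\<lambda>s. X k s \<omega>"] by (simp_all add: V_def)

lemma V_0 [simp]: "V k 0 \<omega> = 0"
  by (simp add: V_def vfun_def num_def)

text \<open>One more observation multiplies by its likelihood ratio the weight of tau < Suc T, which
  is num T + w T with w T = \<theta> (1 - \<theta>)^T. Normalising this gives the recursion that
  defines \<open>Vseq\<close>.\<close>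

lemma vfun_Suc:
  "vfun (Suc T) x = L (x (Suc T)) / ((1 - \<theta>) * (1 - vfun T x) / (\<theta> + (1 - \<theta>) * vfun T x) + L (x (Suc T)))"
proof -
  define n c l where "n = num T x" "c = (1 - \<theta>) ^ T" "l = L (x (Suc T))"
  have pos: "n \<ge> 0" "c > 0" "l \<ge> 0"
    using theta by (auto simp: n_c_l_def)
  have u: "n + \<theta> * c > 0"
    using pos theta by (intro add_nonneg_pos mult_pos_pos) auto
  have nc: "n + c > 0"
    using pos by simp
  have v: "vfun T x = n / (n + c)"
    by (simp add: vfun_def n_c_l_def)
  have a: "1 - vfun T x = c / (n + c)"
    using nc unfolding v by (simp add: field_simps)
  have b: "\<theta> + (1 - \<theta>) * vfun T x = (n + \<theta> * c) / (n + c)"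
    using nc unfolding v by (simp add: field_simps)
  have "(1 - \<theta>) * (1 - vfun T x) / (\<theta> + (1 - \<theta>) * vfun T x) = (1 - \<theta>) * c / (n + \<theta> * c)"
  proof -
    have "r * (c / s) / (u / s) = r * c / u" if "s \<noteq> 0" for r s u :: real
      using that by (simp add: field_simps)
    then show ?thesis
      unfolding a b using nc by simp
  qed
  moreover have "vfun (Suc T) x = l * (n + \<theta> * c) / (l * (n + \<theta> * c) + (1 - \<theta>) * c)"
    by (simp add: vfun_def num_Suc n_c_l_def w_def)
  moreover have "l * (n + \<theta> * c) / (l * (n + \<theta> * c) + (1 - \<theta>) * c) = l / ((1 - \<theta>) * c / (n + \<theta> * c) + l)"
  proof -
    have "(1 - \<theta>) * c / (n + \<theta> * c) + l = (l * (n + \<theta> * c) + (1 - \<theta>) * c) / (n + \<theta> * c)"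
      using u by (simp add: field_simps)
    then show ?thesis
      by simp
  qed
  ultimately show ?thesis
    by (simp add: n_c_l_def)
qed

lemma Vseq_eq: "Vseq \<theta> p q X t \<omega> = V 1 t \<omega>"
  by (induction t) (simp_all add: V_def vfun_Suc L_def Let_def, simp add: vfun_def num_def)

lemma V_Suc:
  "V k (Suc T) \<omega> = L (X k (Suc T) \<omega>) / ((1 - \<theta>) * (1 - V k T \<omega>) / (\<theta> + (1 - \<theta>) * V k T \<omega>) + L (X k (Suc T) \<omega>))"
  unfolding V_def by (rule vfun_Suc)

lemma law_tau_less:
  assumes k: "1 \<le> k" and A [measurable]: "A \<in> sets (XT T)"
  shows "emeasure M {\<omega> \<in> space M. tau k \<omega> < T \<and> block k T \<omega> \<in> A} = (\<integral>\<^sup>+x\<in>A. ennreal (num T x) \<partial>PT T)"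
proof -
  have "{\<omega> \<in> space M. tau k \<omega> < T \<and> block k T \<omega> \<in> A} = (\<Union>m\<in>{..<T}. {\<omega> \<in> space M. tau k \<omega> = m \<and> block k T \<omega> \<in> A})"
    by auto
  also have "emeasure M \<dots> = (\<Sum>m<T. emeasure M {\<omega> \<in> space M. tau k \<omega> = m \<and> block k T \<omega> \<in> A})"
    by (rule sum_emeasure[symmetric]) (auto simp: disjoint_family_on_def)
  also have "\<dots> = (\<Sum>m<T. (\<integral>\<^sup>+x. ennreal (w m * like m T x) * indicator A x \<partial>PT T))"
    by (simp add: law_tau_eq k)
  also have "\<dots> = (\<integral>\<^sup>+x. (\<Sum>m<T. ennreal (w m * like m T x) * indicator A x) \<partial>PT T)"
    by (subst nn_integral_sum) auto
  also have "\<dots> = (\<integral>\<^sup>+x\<in>A. ennreal (num T x) \<partial>PT T)"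
    by (intro nn_integral_cong) (simp add: num_def sum_distrib_right[symmetric])
  finally show ?thesis .
qed

text \<open>For changes at T or later the block has the pre-change law whatever the change point, so
  only the geometric tail remains. The value j = Suc T serves the one-step prediction in
  \<open>expectation_V_Suc\<close>.\<close>

lemma law_tau_ge:
  assumes k: "1 \<le> k" and A [measurable]: "A \<in> sets (XT T)" and j: "T \<le> j"
  shows "emeasure M {\<omega> \<in> space M. j \<le> tau k \<omega> \<and> block k T \<omega> \<in> A} = ennreal ((1 - \<theta>) ^ j) * emeasure (PT T) A"
proof -
  have *: "emeasure M {\<omega> \<in> space M. tau k \<omega> = m \<and> block k T \<omega> \<in> A} = ennreal (w m) * emeasure (PT T) A"
    if "T \<le> m" for m
    using that by (simp add: law_tau_eq k like_def nn_integral_cmult_indicator)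
  have "{\<omega> \<in> space M. j \<le> tau k \<omega> \<and> block k T \<omega> \<in> A} = (\<Union>i. {\<omega> \<in> space M. tau k \<omega> = j + i \<and> block k T \<omega> \<in> A})"
    using le_Suc_ex by auto
  also have "emeasure M \<dots> = (\<Sum>i. emeasure M {\<omega> \<in> space M. tau k \<omega> = j + i \<and> block k T \<omega> \<in> A})"
    by (rule suminf_emeasure[symmetric]) (auto simp: disjoint_family_on_def)
  also have "\<dots> = (\<Sum>i. ennreal (w (j + i))) * emeasure (PT T) A"
    using j by (subst *) auto
  also have "(\<Sum>i. ennreal (w (j + i))) = ennreal ((1 - \<theta>) ^ j)"
  proof (rule suminf_ennreal_eq)
    have "(\<lambda>i. (1 - \<theta>) ^ i) sums (1 / (1 - (1 - \<theta>)))"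
      using theta by (intro geometric_sums) auto
    from sums_mult[OF this, of "\<theta> * (1 - \<theta>) ^ j"] show "(\<lambda>i. w (j + i)) sums ((1 - \<theta>) ^ j)"
      using theta by (simp add: w_def power_add mult_ac)
  qed simp
  finally show ?thesis .
qed

lemma law_block:
  assumes k: "1 \<le> k"
  shows "distr M (XT T) (block k T) = density (PT T) (\<lambda>x. ennreal (num T x + (1 - \<theta>) ^ T))"
proof (rule measure_eqI)
  fix A assume "A \<in> sets (distr M (XT T) (block k T))"
  then have A [measurable]: "A \<in> sets (XT T)"
    by simp
  have "emeasure (distr M (XT T) (block k T)) A = emeasure M {\<omega> \<in> space M. block k T \<omega> \<in> A}"
    by (subst emeasure_distr) (auto intro!: arg_cong[where f = "emeasure M"])
  also have "\<dots> = emeasure M ({\<omega> \<in> space M. tau k \<omega> < T \<and> block k T \<omega> \<in> A} \<union> {\<omega> \<in> space M. T \<le> tau k \<omega> \<and> block k T \<omega> \<in> A})"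
    by (intro arg_cong[where f = "emeasure M"]) auto
  also have "\<dots> = emeasure M {\<omega> \<in> space M. tau k \<omega> < T \<and> block k T \<omega> \<in> A} + emeasure M {\<omega> \<in> space M. T \<le> tau k \<omega> \<and> block k T \<omega> \<in> A}"
    by (subst plus_emeasure) (auto intro!: arg_cong[where f = "emeasure M"])
  also have "\<dots> = (\<integral>\<^sup>+x\<in>A. ennreal (num T x) \<partial>PT T) + (\<integral>\<^sup>+x\<in>A. ennreal ((1 - \<theta>) ^ T) \<partial>PT T)"
    using theta by (simp add: law_tau_less law_tau_ge k nn_integral_cmult_indicator)
  also have "\<dots> = (\<integral>\<^sup>+x\<in>A. ennreal (num T x + (1 - \<theta>) ^ T) \<partial>PT T)"
    using theta by (subst nn_integral_add[symmetric]) (auto simp: distrib_right intro!: nn_integral_cong)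
  finally show "emeasure (distr M (XT T) (block k T)) A = emeasure (density (PT T) (\<lambda>x. ennreal (num T x + (1 - \<theta>) ^ T))) A"
    by (simp add: emeasure_density)
qed simp

lemma nn_integral_block:
  assumes "1 \<le> k" and [measurable]: "g \<in> borel_measurable (XT T)"
  shows "(\<integral>\<^sup>+\<omega>. g (block k T \<omega>) \<partial>M) = (\<integral>\<^sup>+x. ennreal (num T x + (1 - \<theta>) ^ T) * g x \<partial>PT T)"
proof -
  have "(\<integral>\<^sup>+\<omega>. g (block k T \<omega>) \<partial>M) = (\<integral>\<^sup>+x. g x \<partial>distr M (XT T) (block k T))"
    by (subst nn_integral_distr) auto
  then show ?thesis
    by (simp add: law_block assms nn_integral_density)
qed

lemma distr_block_eq: "1 \<le> k \<Longrightarrow> distr M (XT T) (block k T) = distr M (XT T) (block 1 T)"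
  by (simp add: law_block)

text \<open>The block density from \<open>law_block\<close> cancels the denominator of
  \<open>vfun\<close> and leaves \<open>num\<close>, the density of the block on the event tau <
  T.\<close>

lemma prob_tau_less:
  assumes k: "1 \<le> k" and A [measurable]: "A \<in> sets (XT T)"
  shows "measure M {\<omega> \<in> space M. tau k \<omega> < T \<and> block k T \<omega> \<in> A} = (\<integral>\<omega>. V k T \<omega> * indicator A (block k T \<omega>) \<partial>M)"
proof -
  have "(\<integral>\<^sup>+\<omega>. ennreal (V k T \<omega> * indicator A (block k T \<omega>)) \<partial>M)
     = (\<integral>\<^sup>+\<omega>. ennreal (vfun T (block k T \<omega>)) * indicator A (block k T \<omega>) \<partial>M)"
    by (intro nn_integral_cong) (auto simp: vfun_block ennreal_mult indicator_def)
  also have "\<dots> = (\<integral>\<^sup>+x. ennreal (num T x + (1 - \<theta>) ^ T) * (ennreal (vfun T x) * indicator A x) \<partial>PT T)"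
    using k by (intro nn_integral_block) auto
  also have "\<dots> = (\<integral>\<^sup>+x\<in>A. ennreal (num T x) \<partial>PT T)"
  proof (rule nn_integral_cong)
    fix x
    have "ennreal (num T x + (1 - \<theta>) ^ T) * ennreal (vfun T x) = ennreal (num T x)"
      using vfun_denom_pos[of T x] by (subst ennreal_mult[symmetric]) (auto simp: vfun_def)
    then show "ennreal (num T x + (1 - \<theta>) ^ T) * (ennreal (vfun T x) * indicator A x) = ennreal (num T x) * indicator A x"
      by (simp add: mult.assoc[symmetric])
  qed
  also have "\<dots> = emeasure M {\<omega> \<in> space M. tau k \<omega> < T \<and> block k T \<omega> \<in> A}"
    by (simp add: law_tau_less k)
  finally have "(\<integral>\<omega>. V k T \<omega> * indicator A (block k T \<omega>) \<partial>M)
     = enn2real (emeasure M {\<omega> \<in> space M. tau k \<omega> < T \<and> block k T \<omega> \<in> A})"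
    by (subst integral_eq_nn_integral) auto
  then show ?thesis
    by (simp add: measure_def)
qed

lemma restrict_block: "T \<le> T' \<Longrightarrow> restrict (block k T' \<omega>) {1..T} = block k T \<omega>"
  by (auto simp: block_def restrict_def)

lemma measurable_restrict_XT [measurable]:
  assumes "T \<le> T'"
  shows "(\<lambda>x. restrict x {1..T}) \<in> measurable (XT T') (XT T)"
  unfolding XT_def using assms by (intro measurable_restrict_subset) auto

text \<open>The tower property: the mean of V at Suc T over an event of the first T observations is
  the probability of tau < Suc T there. Memorylessness of the geometric prior turns survival past T
  into survival past Suc T with factor 1 - \<theta>.\<close>

lemma expectation_V_Suc:
  assumes k: "1 \<le> k" and A [measurable]: "A \<in> sets (XT T)"
  shows "(\<integral>\<omega>. V k (Suc T) \<omega> * indicator A (block k T \<omega>) \<partial>M)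
    = \<theta> * measure M {\<omega> \<in> space M. block k T \<omega> \<in> A} + (1 - \<theta>) * (\<integral>\<omega>. V k T \<omega> * indicator A (block k T \<omega>) \<partial>M)"
proof -
  define A' where "A' = {x \<in> space (XT (Suc T)). restrict x {1..T} \<in> A}"
  have [measurable]: "(\<lambda>x. restrict x {1..T}) \<in> measurable (XT (Suc T)) (XT T)"
    by (rule measurable_restrict_XT) simp
  have A' [measurable]: "A' \<in> sets (XT (Suc T))"
    unfolding A'_def by measurable
  have in_A': "block k (Suc T) \<omega> \<in> A' \<longleftrightarrow> block k T \<omega> \<in> A" if "\<omega> \<in> space M" for \<omega>
    using measurable_space[OF block_meas that, of k "Suc T"] by (simp add: A'_def restrict_block)
  have "(\<integral>\<omega>. V k (Suc T) \<omega> * indicator A (block k T \<omega>) \<partial>M) = (\<integral>\<omega>. V k (Suc T) \<omega> * indicator A' (block k (Suc T) \<omega>) \<partial>M)"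
    by (intro Bochner_Integration.integral_cong) (auto simp: indicator_def in_A')
  also have "\<dots> = measure M {\<omega> \<in> space M. tau k \<omega> < Suc T \<and> block k (Suc T) \<omega> \<in> A'}"
    using k by (intro prob_tau_less[symmetric]) auto
  also have "{\<omega> \<in> space M. tau k \<omega> < Suc T \<and> block k (Suc T) \<omega> \<in> A'} = {\<omega> \<in> space M. tau k \<omega> < Suc T \<and> block k T \<omega> \<in> A}"
    using in_A' by auto
  also have "measure M \<dots> = measure M {\<omega> \<in> space M. block k T \<omega> \<in> A} - measure M {\<omega> \<in> space M. Suc T \<le> tau k \<omega> \<and> block k T \<omega> \<in> A}"
    by (subst finite_measure_Diff[symmetric]) (auto intro!: arg_cong[where f = "measure M"])
  also have "measure M {\<omega> \<in> space M. Suc T \<le> tau k \<omega> \<and> block k T \<omega> \<in> A} = (1 - \<theta>) * measure M {\<omega> \<in> space M. T \<le> tau k \<omega> \<and> block k T \<omega> \<in> A}"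
    using theta by (simp add: measure_def law_tau_ge k enn2real_mult)
  also have "measure M {\<omega> \<in> space M. T \<le> tau k \<omega> \<and> block k T \<omega> \<in> A}
      = measure M {\<omega> \<in> space M. block k T \<omega> \<in> A} - measure M {\<omega> \<in> space M. tau k \<omega> < T \<and> block k T \<omega> \<in> A}"
    by (subst finite_measure_Diff[symmetric]) (auto intro!: arg_cong[where f = "measure M"])
  also have "measure M {\<omega> \<in> space M. tau k \<omega> < T \<and> block k T \<omega> \<in> A} = (\<integral>\<omega>. V k T \<omega> * indicator A (block k T \<omega>) \<partial>M)"
    using k by (intro prob_tau_less) auto
  finally show ?thesis
    by (simp add: algebra_simps)
qed

lemma nn_integral_PT_Suc:
  assumes "f \<in> borel_measurable (XT (Suc T))"
  shows "(\<integral>\<^sup>+x. f x \<partial>PT (Suc T)) = (\<integral>\<^sup>+x. \<integral>\<^sup>+y. f (x(Suc T := y)) \<partial>P \<partial>PT T)"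
proof -
  have *: "{1..Suc T} = insert (Suc T) {1..T}"
    by auto
  have "f \<in> borel_measurable (PT (Suc T))"
    using assms by simp
  then show ?thesis
    unfolding PT_def * by (intro PS.product_nn_integral_insert) auto
qed

text \<open>u is the odds of tau < Suc T before the last observation is seen. With the past frozen,
  the posterior is an increasing function of the last likelihood ratio alone.\<close>

lemma vfun_upd:
  defines "u x T \<equiv> (num T x + w T) / (1 - \<theta>) ^ Suc T"
  shows "u x T > 0" "vfun (Suc T) (x(Suc T := y)) = L y * u x T / (L y * u x T + 1)"
proof -
  have w: "w T > 0"
    using theta by (simp add: w_def)
  then show "u x T > 0"
    using theta by (auto simp: u_def intro!: divide_pos_pos add_nonneg_pos)
  have d: "(1 - \<theta>) ^ Suc T > 0"
    using theta by (intro zero_less_power) auto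
  have "num (Suc T) (x(Suc T := y)) = L y * (num T x + w T)"
    using num_cong[of T "x(Suc T := y)" x] unfolding num_Suc by simp
  then show "vfun (Suc T) (x(Suc T := y)) = L y * u x T / (L y * u x T + 1)"
  proof -
    have "l * n / (l * n + d) = l * (n / d) / (l * (n / d) + 1)" if "d > 0" for l n d :: real
    proof -
      have "l * (n / d) + 1 = (l * n + d) / d"
        using that by (simp add: field_simps)
      then show ?thesis
        using that by simp
    qed
    from this[OF d] show ?thesis
      unfolding vfun_def u_def \<open>num (Suc T) (x(Suc T := y)) = L y * (num T x + w T)\<close> .
  qed
qed

section \<open>Atoms and support of the law of the posterior\<close>

lemma L_atomless: "emeasure P {y \<in> space N. L y = c} = 0"
  using LR_good_density_atomless[OF A1_p, of c] by (simp add: L_def P_def)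

lemma L_pos: "0 \<le> a \<Longrightarrow> a < b \<Longrightarrow> emeasure P {y \<in> space N. a < L y \<and> L y < b} > 0"
  using LR_good_density_pos[OF A1_p, of a b] by (simp add: L_def P_def)

text \<open>Given the past, the equation V = c determines the last likelihood ratio, and single
  values of it are P-null. Fubini and the density in \<open>law_block\<close> transfer this to
  M.\<close>

lemma V_atomless:
  assumes k: "1 \<le> k"
  shows "measure M {\<omega> \<in> space M. V k (Suc T) \<omega> = c} = 0"
proof -
  have inner: "(\<integral>\<^sup>+y. indicator {c} (vfun (Suc T) (x(Suc T := y))) \<partial>P) = 0" for x
  proof -
    define u where "u = (num T x + w T) / (1 - \<theta>) ^ Suc T"
    have u: "u > 0" "\<And>y. vfun (Suc T) (x(Suc T := y)) = L y * u / (L y * u + 1)"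
      using vfun_upd[of T x] unfolding u_def by blast+
    have "L y = c / ((1 - c) * u)" if "vfun (Suc T) (x(Suc T := y)) = c" for y
    proof -
      have "L y * u + 1 > 0"
        using u(1) by (intro add_nonneg_pos mult_nonneg_nonneg) auto
      then have "L y * u = c * (L y * u + 1)"
        using that u(2)[of y] by (simp add: field_simps)
      then have "(1 - c) * u * L y = c"
        by (simp add: algebra_simps)
      moreover have "c < 1"
        using that vfun_less_1 by blast
      ultimately show ?thesis
        using u(1) by (simp add: field_simps)
    qed
    then have "(\<integral>\<^sup>+y. indicator {c} (vfun (Suc T) (x(Suc T := y))) \<partial>P) \<le> (\<integral>\<^sup>+y. indicator {y \<in> space N. L y = c / ((1 - c) * u)} y \<partial>P)"
      by (intro nn_integral_mono) (auto simp: indicator_def)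
    also have "\<dots> = emeasure P {y \<in> space N. L y = c / ((1 - c) * u)}"
      by (rule nn_integral_indicator) measurable
    finally show ?thesis
      by (simp add: L_atomless)
  qed
  have "AE x in PT (Suc T). indicator {c} (vfun (Suc T) x) = (0 :: ennreal)"
    by (subst nn_integral_0_iff_AE[symmetric]) (auto simp: nn_integral_PT_Suc inner)
  then have "(\<integral>\<^sup>+x. ennreal (num (Suc T) x + (1 - \<theta>) ^ Suc T) * indicator {c} (vfun (Suc T) x) \<partial>PT (Suc T)) = 0"
    by (subst nn_integral_0_iff_AE) auto
  then have "(\<integral>\<^sup>+\<omega>. indicator {c} (vfun (Suc T) (block k (Suc T) \<omega>)) \<partial>M) = 0"
    using nn_integral_block[OF k, of "\<lambda>x. indicator {c} (vfun (Suc T) x)" "Suc T"] by simp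
  moreover have "(\<integral>\<^sup>+\<omega>. indicator {c} (V k (Suc T) \<omega>) \<partial>M) = emeasure M {\<omega> \<in> space M. V k (Suc T) \<omega> \<in> {c}}"
    by (rule nn_integral_indicator_Collect) measurable
  ultimately have "emeasure M {\<omega> \<in> space M. V k (Suc T) \<omega> = c} = 0"
    by (simp add: vfun_block)
  then show ?thesis
    by (simp add: measure_def)
qed

text \<open>The block law has a strictly positive density relative to \<open>PT\<close>, so the null
  sets are the same and Fubini applies: for every past in A, the posterior falls into (a, b) when
  the last likelihood ratio lies in a suitable interval, which has positive P-mass.\<close>

lemma V_full_support:
  assumes k: "1 \<le> k" and A [measurable]: "A \<in> sets (XT T)"
    and pos: "measure M {\<omega> \<in> space M. block k T \<omega> \<in> A} > 0"
    and ab: "0 \<le> a" "a < b" "b \<le> 1"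
  shows "measure M {\<omega> \<in> space M. block k T \<omega> \<in> A \<and> a < V k (Suc T) \<omega> \<and> V k (Suc T) \<omega> < b} > 0"
proof (rule ccontr)
  define S where "S = {x \<in> space (XT (Suc T)). restrict x {1..T} \<in> A \<and> a < vfun (Suc T) x \<and> vfun (Suc T) x < b}"
  have [measurable]: "(\<lambda>x. restrict x {1..T}) \<in> measurable (XT (Suc T)) (XT T)"
    by (rule measurable_restrict_XT) simp
  have S [measurable]: "S \<in> sets (XT (Suc T))"
    unfolding S_def by measurable
  have in_S: "block k (Suc T) \<omega> \<in> S \<longleftrightarrow> block k T \<omega> \<in> A \<and> a < V k (Suc T) \<omega> \<and> V k (Suc T) \<omega> < b" if "\<omega> \<in> space M" for \<omega>
    using measurable_space[OF block_meas that, of k "Suc T"] by (simp add: S_def restrict_block vfun_block)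
  assume "\<not> ?thesis"
  then have "measure M {\<omega> \<in> space M. block k T \<omega> \<in> A \<and> a < V k (Suc T) \<omega> \<and> V k (Suc T) \<omega> < b} = 0"
    by (simp add: not_less measure_le_0_iff)
  then have "emeasure M {\<omega> \<in> space M. block k T \<omega> \<in> A \<and> a < V k (Suc T) \<omega> \<and> V k (Suc T) \<omega> < b} = 0"
    by (simp add: emeasure_eq_measure)
  also have "{\<omega> \<in> space M. block k T \<omega> \<in> A \<and> a < V k (Suc T) \<omega> \<and> V k (Suc T) \<omega> < b} = {\<omega> \<in> space M. block k (Suc T) \<omega> \<in> S}"
    using in_S by auto
  also have "emeasure M \<dots> = (\<integral>\<^sup>+\<omega>. indicator S (block k (Suc T) \<omega>) \<partial>M)"
    by (rule nn_integral_indicator_Collect[symmetric]) measurable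
  also have "\<dots> = (\<integral>\<^sup>+x. ennreal (num (Suc T) x + (1 - \<theta>) ^ Suc T) * indicator S x \<partial>PT (Suc T))"
    using k by (intro nn_integral_block) auto
  finally have "AE x in PT (Suc T). ennreal (num (Suc T) x + (1 - \<theta>) ^ Suc T) * indicator S x = 0"
    by (subst (asm) nn_integral_0_iff_AE) auto
  then have "AE x in PT (Suc T). indicator S x = (0 :: ennreal)"
  proof eventually_elim
    case (elim x)
    then show ?case
      using vfun_denom_pos[of "Suc T" x] by (auto simp: ennreal_eq_0_iff simp del: power_Suc)
  qed
  then have "0 = (\<integral>\<^sup>+x. indicator S x \<partial>PT (Suc T))"
    by (subst nn_integral_0_iff_AE[THEN iffD2]) auto
  also have "\<dots> = (\<integral>\<^sup>+x. \<integral>\<^sup>+y. indicator S (x(Suc T := y)) \<partial>P \<partial>PT T)"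
    by (rule nn_integral_PT_Suc) simp
  finally have *: "(\<integral>\<^sup>+x. \<integral>\<^sup>+y. indicator S (x(Suc T := y)) \<partial>P \<partial>PT T) = 0"
    by simp
  have m1: "(\<lambda>z. (fst z)(Suc T := snd z)) \<in> measurable (PT T \<Otimes>\<^sub>M P) (PT (Suc T))"
  proof -
    have "{1..Suc T} = insert (Suc T) {1..T}"
      by auto
    then show ?thesis
      unfolding PT_def by (simp add: measurable_add_dim[unfolded case_prod_beta'])
  qed
  have [measurable]: "(\<lambda>x. \<integral>\<^sup>+y. indicator S (x(Suc T := y)) \<partial>P) \<in> borel_measurable (PT T)"
  proof -
    have "(\<lambda>z. indicator S ((fst z)(Suc T := snd z)) :: ennreal) \<in> borel_measurable (PT T \<Otimes>\<^sub>M P)"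
      by (rule measurable_compose[OF m1]) simp
    from P.borel_measurable_nn_integral_fst[OF this] show ?thesis
      by simp
  qed
  have AE0: "AE x in PT T. (\<integral>\<^sup>+y. indicator S (x(Suc T := y)) \<partial>P) = 0"
    using * by (subst (asm) nn_integral_0_iff_AE) auto
  have inner: "(\<integral>\<^sup>+y. indicator S (x(Suc T := y)) \<partial>P) > 0" if x: "x \<in> A" for x
  proof -
    have xs: "x \<in> space (XT T)"
      using x sets.sets_into_space[OF A] by auto
    define u where "u = (num T x + w T) / (1 - \<theta>) ^ Suc T"
    have u: "u > 0" "\<And>y. vfun (Suc T) (x(Suc T := y)) = L y * u / (L y * u + 1)"
      using vfun_upd[of T x] unfolding u_def by blast+
    \<comment> \<open>The midpoint replaces b, because b may be 1 and b / (1 - b) would then break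
      down.\<close>
    define c where "c = (a + b) / 2"
    have c: "a < c" "c < b" "c < 1"
      using ab by (auto simp: c_def)
    \<comment> \<open>The likelihood ratios at which the posterior equals a and c.\<close>
    define l1 l2 where "l1 = a / ((1 - a) * u)" "l2 = c / ((1 - c) * u)"
    have "a / (1 - a) < c / (1 - c)"
      using c ab by (simp add: field_simps)
    then have "a / (1 - a) / u < c / (1 - c) / u"
      using u(1) by (rule divide_strict_right_mono)
    then have l: "0 \<le> l1" "l1 < l2"
      using ab u by (simp_all add: l1_l2_def)
    have "x(Suc T := y) \<in> S" if y: "y \<in> space N" "l1 < L y" "L y < l2" for y
    proof -
      have d: "L y * u + 1 > 0"
        using u(1) by (intro add_nonneg_pos mult_nonneg_nonneg) auto
      have "a < L y * ((1 - a) * u)" "L y * ((1 - c) * u) < c"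
        using y c ab u by (simp_all add: l1_l2_def pos_divide_less_eq pos_less_divide_eq)
      then have "a * (L y * u + 1) < L y * u" "L y * u < c * (L y * u + 1)"
        by (simp_all add: algebra_simps)
      then have "a < vfun (Suc T) (x(Suc T := y))" "vfun (Suc T) (x(Suc T := y)) < b"
        using d c unfolding u(2) by (simp_all add: pos_less_divide_eq pos_divide_less_eq) (smt (verit) mult_right_mono)
      moreover have "x(Suc T := y) \<in> space (XT (Suc T))"
        using xs y by (auto simp: XT_def space_PiM PiE_def extensional_def)
      moreover have "restrict (x(Suc T := y)) {1..T} = x"
        using xs by (auto simp: XT_def space_PiM PiE_def extensional_def restrict_def)
      ultimately show ?thesis
        using x by (simp add: S_def)
    qed
    then have "(\<integral>\<^sup>+y. indicator {y \<in> space N. l1 < L y \<and> L y < l2} y \<partial>P) \<le> (\<integral>\<^sup>+y. indicator S (x(Suc T := y)) \<partial>P)"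
      by (intro nn_integral_mono) (auto simp: indicator_def)
    moreover have "(\<integral>\<^sup>+y. indicator {y \<in> space N. l1 < L y \<and> L y < l2} y \<partial>P) = emeasure P {y \<in> space N. l1 < L y \<and> L y < l2}"
      by (rule nn_integral_indicator) measurable
    ultimately show ?thesis
      using L_pos[OF l] by (metis less_le_trans)
  qed
  have "AE x in PT T. x \<notin> A"
    using AE0
  proof eventually_elim
    case (elim x)
    then show ?case
      using inner[of x] by auto
  qed
  then have "(\<integral>\<^sup>+x. ennreal (num T x + (1 - \<theta>) ^ T) * indicator A x \<partial>PT T) = 0"
    by (subst nn_integral_0_iff_AE) (auto elim!: eventually_mono)
  then have "(\<integral>\<^sup>+\<omega>. indicator A (block k T \<omega>) \<partial>M) = 0"
    using nn_integral_block[OF k, of "indicator A" T] by simp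
  moreover have "(\<integral>\<^sup>+\<omega>. indicator A (block k T \<omega>) \<partial>M) = emeasure M {\<omega> \<in> space M. block k T \<omega> \<in> A}"
    by (rule nn_integral_indicator_Collect) measurable
  ultimately show False
    using pos by (simp add: measure_def)
qed

end


section \<open>Many streams: averages over streams and the posterior given all observations\<close>

context stream_model
begin

lemma strong_law_block:
  assumes [measurable]: "g \<in> borel_measurable (XT T)" and g: "\<And>x. \<bar>g x\<bar> \<le> 1"
  shows "AE \<omega> in M. (\<lambda>n. (\<Sum>k\<in>{1..n}. g (block k T \<omega>)) / real n) \<longlonglongrightarrow> (\<integral>\<omega>. g (block 1 T \<omega>) \<partial>M)"
proof (rule strong_law_bounded)
  show "indep_vars (\<lambda>_. borel) (\<lambda>k \<omega>. g (block k T \<omega>)) {1..n}" for n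
    by (rule indep_vars_compose2[OF indep_blocks]) auto
  show "(\<integral>\<omega>. g (block k T \<omega>) \<partial>M) = (\<integral>\<omega>. g (block 1 T \<omega>) \<partial>M)" if "1 \<le> k" for k
  proof -
    have "(\<integral>\<omega>. g (block j T \<omega>) \<partial>M) = (\<integral>x. g x \<partial>distr M (XT T) (block j T))" for j
      by (subst integral_distr) auto
    then show ?thesis
      using distr_block_eq[OF that] by simp
  qed
qed (use g in \<open>auto simp: abs_le_iff minus_le_iff\<close>)

definition box_event :: "nat \<Rightarrow> nat \<Rightarrow> (nat \<Rightarrow> nat \<Rightarrow> 'b set) \<Rightarrow> 'a set" where
  "box_event n T A = {\<omega> \<in> space M. \<forall>k\<in>{1..n}. \<forall>t\<in>{1..T}. X k t \<omega> \<in> A k t}"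

text \<open>These events constrain observations only, not change points: they generate the
  information of an observer who sees all n streams up to time T.\<close>

definition box_events :: "nat \<Rightarrow> nat \<Rightarrow> 'a set set" where
  "box_events n T = {box_event n T A |A. \<forall>k t. A k t \<in> sets N}"

lemma box_events_Pow: "box_events n T \<subseteq> Pow (space M)"
  by (auto simp: box_events_def box_event_def)

lemma box_events_sets: "box_events n T \<subseteq> sets M"
proof
  fix E assume "E \<in> box_events n T"
  then obtain A where A: "E = box_event n T A" "\<forall>k t. A k t \<in> sets N"
    unfolding box_events_def by blast
  then have [measurable]: "A k t \<in> sets N" for k t
    by blast
  show "E \<in> sets M"
    unfolding A(1) box_event_def by measurable
qed

lemma Int_stable_box_events: "Int_stable (box_events n T)"
proof (rule Int_stableI)
  fix E E' assume "E \<in> box_events n T" "E' \<in> box_events n T"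
  then obtain A A' where A: "E = box_event n T A" "\<forall>k t. A k t \<in> sets N" "E' = box_event n T A'" "\<forall>k t. A' k t \<in> sets N"
    unfolding box_events_def by blast
  then have "E \<inter> E' = box_event n T (\<lambda>k t. A k t \<inter> A' k t)"
    unfolding box_event_def by blast
  then show "E \<inter> E' \<in> box_events n T"
    using A unfolding box_events_def by blast
qed

lemma space_box_events: "space M \<in> box_events n T"
proof -
  have "space M = box_event n T (\<lambda>_ _. space N)"
    using X_meas[THEN measurable_space] by (auto simp: box_event_def)
  then show ?thesis
    unfolding box_events_def by blast
qed

text \<open>On a box the probability factors over streams. The factor of stream k is the mean of V
  times an indicator by \<open>prob_tau_less\<close>, the others are means of indicators, and
  independence of the blocks merges them into a single expectation.\<close>

lemma prob_tau_less_box_event: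
  assumes k: "k \<in> {1..n}" and E: "E \<in> box_events n T"
  shows "measure M {\<omega> \<in> E. tau k \<omega> < T} = (\<integral>\<omega>. V k T \<omega> * indicator E \<omega> \<partial>M)"
proof -
  obtain A where A: "E = box_event n T A" "\<forall>k t. A k t \<in> sets N"
    using E unfolding box_events_def by blast
  then have A_sets: "A k t \<in> sets N" for k t
    by blast
  have C [measurable]: "Pi\<^sub>E {1..T} (A j) \<in> sets (XT T)" for j
    unfolding XT_def by (intro sets_PiM_I_finite A_sets) auto
  define B where "B j = (if j = k then {..<T} else UNIV)" for j
  define h :: "nat \<Rightarrow> (nat \<Rightarrow> 'b) \<Rightarrow> real" where
    "h j x = (if j = k then vfun T x else 1) * indicator (Pi\<^sub>E {1..T} (A j)) x" for j x
  have h_meas [measurable]: "h j \<in> borel_measurable (XT T)" for j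
    unfolding h_def by measurable
  have h_bound: "norm (h j x) \<le> 1" for j x
    using vfun_less_1[of T x] by (auto simp: h_def indicator_def)
  have int: "integrable M (\<lambda>\<omega>. h j (block j T \<omega>))" for j
    by (rule integrable_const_bound[where B = 1]) (use h_bound in auto)
  have mass: "box_mass T (B j) (A j) = ennreal (\<integral>\<omega>. h j (block j T \<omega>) \<partial>M)" if j: "j \<in> {1..n}" for j
  proof -
    have "{\<omega> \<in> space M. tau j \<omega> \<in> B j \<and> (\<forall>t\<in>{1..T}. X j t \<omega> \<in> A j t)}
        = {\<omega> \<in> space M. tau j \<omega> \<in> B j \<and> block j T \<omega> \<in> Pi\<^sub>E {1..T} (A j)}"
      using block_in_PiE[of _ j T "A j"] by blast
    moreover have "emeasure M {\<omega> \<in> space M. tau j \<omega> \<in> B j \<and> (\<forall>t\<in>{1..T}. X j t \<omega> \<in> A j t)} = box_mass T (B j) (A j)"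
      using j A_sets by (intro emeasure_box) auto
    ultimately have "box_mass T (B j) (A j) = ennreal (measure M {\<omega> \<in> space M. tau j \<omega> \<in> B j \<and> block j T \<omega> \<in> Pi\<^sub>E {1..T} (A j)})"
      by (simp add: emeasure_eq_measure)
    also have "measure M {\<omega> \<in> space M. tau j \<omega> \<in> B j \<and> block j T \<omega> \<in> Pi\<^sub>E {1..T} (A j)} = (\<integral>\<omega>. h j (block j T \<omega>) \<partial>M)"
    proof (cases "j = k")
      case True
      then show ?thesis
        using prob_tau_less[of k "Pi\<^sub>E {1..T} (A k)" T] k C[of k] by (simp add: B_def h_def vfun_block)
    next
      case False
      have "(\<integral>\<omega>. h j (block j T \<omega>) \<partial>M) = (\<integral>\<omega>. indicator {\<omega> \<in> space M. block j T \<omega> \<in> Pi\<^sub>E {1..T} (A j)} \<omega> \<partial>M)"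
        using False by (intro Bochner_Integration.integral_cong) (auto simp: h_def indicator_def)
      then show ?thesis
        using False by (simp add: B_def)
    qed
    finally show ?thesis .
  qed
  have h_nonneg: "(\<integral>\<omega>. h j (block j T \<omega>) \<partial>M) \<ge> 0" for j
    by (rule Bochner_Integration.integral_nonneg) (auto simp: h_def)
  have upd: "(\<forall>j\<in>I. tau j \<omega> \<in> B j \<and> R j) \<longleftrightarrow> (\<forall>j\<in>I. R j) \<and> tau k \<omega> < T" if "k \<in> I" for I \<omega> R
    using that by (auto simp: B_def)
  have "{\<omega> \<in> E. tau k \<omega> < T} = {\<omega> \<in> space M. \<forall>j\<in>{1..n}. tau j \<omega> \<in> B j \<and> (\<forall>t\<in>{1..T}. X j t \<omega> \<in> A j t)}"
    unfolding A(1) box_event_def upd[OF k] by blast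
  then have "emeasure M {\<omega> \<in> E. tau k \<omega> < T} = (\<Prod>j\<in>{1..n}. box_mass T (B j) (A j))"
    using emeasure_boxes[where A = A and B = B, OF A_sets] by simp
  also have "\<dots> = (\<Prod>j\<in>{1..n}. ennreal (\<integral>\<omega>. h j (block j T \<omega>) \<partial>M))"
    by (intro prod.cong mass refl)
  also have "\<dots> = ennreal (\<Prod>j\<in>{1..n}. \<integral>\<omega>. h j (block j T \<omega>) \<partial>M)"
    by (intro prod_ennreal h_nonneg)
  finally have "measure M {\<omega> \<in> E. tau k \<omega> < T} = (\<Prod>j\<in>{1..n}. \<integral>\<omega>. h j (block j T \<omega>) \<partial>M)"
    by (simp add: measure_def prod_nonneg h_nonneg)
  also have "\<dots> = (\<integral>\<omega>. (\<Prod>j\<in>{1..n}. h j (block j T \<omega>)) \<partial>M)"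
    by (rule indep_vars_lebesgue_integral[symmetric])
      (use int in \<open>auto intro!: indep_vars_compose2[OF indep_blocks]\<close>)
  also have "\<dots> = (\<integral>\<omega>. V k T \<omega> * indicator E \<omega> \<partial>M)"
  proof (rule Bochner_Integration.integral_cong)
    fix \<omega> assume \<omega>: "\<omega> \<in> space M"
    have "(\<Prod>j\<in>{1..n}. h j (block j T \<omega>)) = (\<Prod>j\<in>{1..n}. if j = k then V k T \<omega> else 1) * (\<Prod>j\<in>{1..n}. indicator (Pi\<^sub>E {1..T} (A j)) (block j T \<omega>))"
      unfolding h_def prod.distrib by (intro arg_cong2[where f = "(*)"] prod.cong) (auto simp: vfun_block)
    also have "(\<Prod>j\<in>{1..n}. if j = k then V k T \<omega> else 1) = V k T \<omega>"
      using k by simp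
    also have "(\<Prod>j\<in>{1..n}. indicator (Pi\<^sub>E {1..T} (A j)) (block j T \<omega>)) = (indicator E \<omega> :: real)"
    proof (cases "\<omega> \<in> E")
      case True
      then have "block j T \<omega> \<in> Pi\<^sub>E {1..T} (A j)" if "j \<in> {1..n}" for j
        using that block_in_PiE[OF \<omega>, of j T "A j"] unfolding A(1) box_event_def by blast
      with True show ?thesis
        by simp
    next
      case False
      then obtain j where j: "j \<in> {1..n}" "block j T \<omega> \<notin> Pi\<^sub>E {1..T} (A j)"
        using \<omega> block_in_PiE[OF \<omega>, of _ T] unfolding A(1) box_event_def by blast
      then have "(\<Prod>j\<in>{1..n}. indicator (Pi\<^sub>E {1..T} (A j)) (block j T \<omega>)) = (0 :: real)"
        by (intro prod_zero bexI[of _ j]) auto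
      with False show ?thesis
        by simp
    qed
    finally show "(\<Prod>j\<in>{1..n}. h j (block j T \<omega>)) = V k T \<omega> * indicator E \<omega>" .
  qed simp
  finally show ?thesis .
qed

lemma V_integrable [simp]: "A \<in> sets M \<Longrightarrow> integrable M (\<lambda>\<omega>. V k T \<omega> * indicator A \<omega>)"
  by (rule integrable_const_bound[where B = 1]) (auto simp: indicator_def)

text \<open>The posterior of stream \<open>k\<close> given the observations of all streams is a function of
  stream \<open>k\<close> alone.\<close>
lemma prob_tau_less_sigma:
  assumes k: "k \<in> {1..n}" and E: "E \<in> sigma_sets (space M) (box_events n T)"
  shows "measure M {\<omega> \<in> E. tau k \<omega> < T} = (\<integral>\<omega>. V k T \<omega> * indicator E \<omega> \<partial>M)"
  using Int_stable_box_events box_events_Pow E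
proof (induction rule: sigma_sets_induct_disjoint)
  case (basic E)
  then show ?case
    by (rule prob_tau_less_box_event[OF k])
next
  case empty
  show ?case by simp
next
  case (compl E)
  have [measurable]: "E \<in> sets M"
    using compl(1) sets.sigma_sets_subset[OF box_events_sets] by blast
  have "{\<omega> \<in> space M - E. tau k \<omega> < T} = {\<omega> \<in> space M. tau k \<omega> < T} - {\<omega> \<in> E. tau k \<omega> < T}"
    using sets.sets_into_space[of E M] by auto
  then have "measure M {\<omega> \<in> space M - E. tau k \<omega> < T} = measure M {\<omega> \<in> space M. tau k \<omega> < T} - measure M {\<omega> \<in> E. tau k \<omega> < T}"
    using sets.sets_into_space[of E M] by (simp add: finite_measure_Diff Collect_mono subset_iff)
  also have "measure M {\<omega> \<in> space M. tau k \<omega> < T} = (\<integral>\<omega>. V k T \<omega> * indicator (space M) \<omega> \<partial>M)"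
    by (rule prob_tau_less_box_event[OF k space_box_events])
  also have "\<dots> - measure M {\<omega> \<in> E. tau k \<omega> < T} = (\<integral>\<omega>. V k T \<omega> * indicator (space M) \<omega> - V k T \<omega> * indicator E \<omega> \<partial>M)"
    by (simp add: compl Bochner_Integration.integral_diff)
  also have "\<dots> = (\<integral>\<omega>. V k T \<omega> * indicator (space M - E) \<omega> \<partial>M)"
    by (intro Bochner_Integration.integral_cong) (auto simp: indicator_def)
  finally show ?case .
next
  case (union E)
  have E [measurable]: "E i \<in> sets M" for i
    using union(2) sets.sigma_sets_subset[OF box_events_sets] by blast
  have "{\<omega> \<in> (\<Union>i. E i). tau k \<omega> < T} = (\<Union>i. {\<omega> \<in> E i. tau k \<omega> < T})"
    by auto
  moreover have "{\<omega> \<in> E i. tau k \<omega> < T} \<in> sets M" for i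
  proof -
    have "{\<omega> \<in> E i. tau k \<omega> < T} = E i \<inter> {\<omega> \<in> space M. tau k \<omega> < T}"
      using sets.sets_into_space[OF E] by auto
    then show ?thesis
      by simp
  qed
  then have "(\<lambda>i. measure M {\<omega> \<in> E i. tau k \<omega> < T}) sums measure M (\<Union>i. {\<omega> \<in> E i. tau k \<omega> < T})"
    using union(1) by (intro finite_measure_UNION) (auto simp: disjoint_family_on_def)
  then have "measure M (\<Union>i. {\<omega> \<in> E i. tau k \<omega> < T}) = (\<Sum>i. measure M {\<omega> \<in> E i. tau k \<omega> < T})"
    by (rule sums_unique)
  moreover have "(\<integral>\<omega>\<in>(\<Union>i. E i). V k T \<omega> \<partial>M) = (\<Sum>i. \<integral>\<omega>\<in>E i. V k T \<omega> \<partial>M)"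
    using union(1) V_integrable[of "\<Union>i. E i" k T] by (intro lebesgue_integral_countable_add)
      (auto simp: set_integrable_def disjoint_family_on_def mult.commute)
  ultimately show ?case
    by (simp add: union(3) set_lebesgue_integral_def mult.commute)
qed

end


section \<open>The adaptive filtration and the posteriors of active streams\<close>

lemma space_fil1 [simp]: "space (fil1 M N X K) = space M"
  by (simp add: fil1_def space_measure_of_conv)

lemma sets_fil1:
  "sets (fil1 M N X K) = sigma_sets (space M) {{\<omega> \<in> space M. X k 1 \<omega> \<in> A} | k A. k \<in> {1..K} \<and> A \<in> sets N}"
  unfolding fil1_def by (rule sets_measure_of) auto

lemma space_filstep [simp]: "space (filstep M N F S Y) = space M"
  by (simp add: filstep_def space_measure_of_conv)

lemma sets_filstep:
  assumes "space F = space M"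
  shows "sets (filstep M N F S Y) = sigma_sets (space M)
     (sets F \<union> {{\<omega> \<in> space M. k \<in> S \<omega>} | k. True}
             \<union> {{\<omega> \<in> space M. k \<in> S \<omega> \<and> Y k \<omega> \<in> A} | k A. A \<in> sets N})"
  unfolding filstep_def using sets.space_closed[of F] assms by (intro sets_measure_of) auto

text \<open>The generators record an observation only together with k \<in> S. The default 0 is
  harmless because the event of not being observed is in the sigma-algebra as well.\<close>

lemma measurable_masked_filstep:
  assumes F: "space F = space M" and Y: "Y k \<in> measurable M N" and [measurable]: "f \<in> borel_measurable N"
  shows "(\<lambda>\<omega>. if k \<in> S \<omega> then f (Y k \<omega>) else 0 :: real) \<in> borel_measurable (filstep M N F S Y)"
proof (rule measurableI)
  fix B :: "real set" assume [measurable]: "B \<in> sets borel"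
  define C where "C = {y \<in> space N. f y \<in> B}"
  have [measurable]: "C \<in> sets N"
    unfolding C_def by measurable
  have gen: "{\<omega> \<in> space M. k \<in> S \<omega>} \<in> sets (filstep M N F S Y)"
    "{\<omega> \<in> space M. k \<in> S \<omega> \<and> Y k \<omega> \<in> C} \<in> sets (filstep M N F S Y)"
    unfolding sets_filstep[OF F]
    by (rule sigma_sets.Basic, rule UnI1, rule UnI2, rule CollectI, rule exI, rule conjI[OF refl TrueI])
      (rule sigma_sets.Basic, rule UnI2, rule CollectI, (rule exI)+, rule conjI[OF refl \<open>C \<in> sets N\<close>])
  have "(\<lambda>\<omega>. if k \<in> S \<omega> then f (Y k \<omega>) else 0) -` B \<inter> space (filstep M N F S Y)
      = {\<omega> \<in> space M. k \<in> S \<omega> \<and> Y k \<omega> \<in> C} \<union> (if 0 \<in> B then space M - {\<omega> \<in> space M. k \<in> S \<omega>} else {})"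
    using measurable_space[OF Y] by (auto simp: C_def split: if_split_asm)
  also have "\<dots> \<in> sets (filstep M N F S Y)"
    using gen sets.top[of "filstep M N F S Y"] by (auto intro!: sets.Un sets.Diff)
  finally show "(\<lambda>\<omega>. if k \<in> S \<omega> then f (Y k \<omega>) else 0) -` B \<inter> space (filstep M N F S Y) \<in> sets (filstep M N F S Y)" .
qed simp

locale detection = stream_model +
  fixes \<alpha> :: real
  assumes alpha: "0 < \<alpha>" "\<alpha> < 1"
begin

text \<open>In the paper's notation \<open>SS K n\<close>, \<open>FF K n\<close> and \<open>post K n k\<close> are the active set, the
  filtration and the posterior of stream \<open>k\<close> at time \<open>n + 1\<close>.\<close>
definition SS :: "nat \<Rightarrow> nat \<Rightarrow> 'a \<Rightarrow> nat set" where
  "SS K n = fst (proc M N X tau \<alpha> K n)"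
definition FF :: "nat \<Rightarrow> nat \<Rightarrow> 'a measure" where
  "FF K n = snd (proc M N X tau \<alpha> K n)"
definition post :: "nat \<Rightarrow> nat \<Rightarrow> nat \<Rightarrow> 'a \<Rightarrow> real" where
  "post K n k = real_cond_exp M (FF K n) (\<lambda>\<omega>. if tau k \<omega> < Suc n then 1 else 0)"

lemma SS_0: "SS K 0 \<omega> = {1..K}"
  by (simp add: SS_def)

lemma FF_0: "FF K 0 = fil1 M N X K"
  by (simp add: FF_def)

lemma SS_Suc: "SS K (Suc n) \<omega> = onestep \<alpha> (SS K n \<omega>) (\<lambda>k. post K n k \<omega>)"
  by (simp add: SS_def FF_def post_def Let_def)

lemma FF_Suc: "FF K (Suc n) = filstep M N (FF K n) (SS K (Suc n)) (\<lambda>k. X k (Suc (Suc n)))"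
  by (simp add: SS_def FF_def post_def Let_def)

lemma finite_SS: "finite (SS K n \<omega>)" and SS_subset: "SS K n \<omega> \<subseteq> {1..K}"
proof (induction n)
  case 0
  { case 1 show ?case by (simp add: SS_0) }
  { case 2 show ?case by (simp add: SS_0) }
next
  case (Suc n)
  have "SS K (Suc n) \<omega> \<subseteq> SS K n \<omega>"
    unfolding SS_Suc by (rule onestep_subset[OF Suc(1) alpha(1)])
  with Suc show "finite (SS K (Suc n) \<omega>)" "SS K (Suc n) \<omega> \<subseteq> {1..K}"
    by (auto intro: finite_subset)
qed

lemma SS_decreasing: "SS K (Suc n) \<omega> \<subseteq> SS K n \<omega>"
  unfolding SS_Suc by (rule onestep_subset[OF finite_SS alpha(1)])

lemma space_FF [simp]: "space (FF K n) = space M"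
  by (cases n) (simp_all add: FF_0 FF_Suc)

lemma FF_increasing: "sets (FF K n) \<subseteq> sets (FF K (Suc n))"
  unfolding FF_Suc sets_filstep[OF space_FF] by (auto intro: sigma_sets.Basic)

lemma FF_increasing_measurable: "f \<in> measurable (FF K n) A \<Longrightarrow> f \<in> measurable (FF K (Suc n)) A"
  using measurable_mono[of A A "FF K n" "FF K (Suc n)"] FF_increasing by auto

lemma post_meas [measurable]: "post K n k \<in> borel_measurable (FF K n)"
  unfolding post_def by measurable

lemma SS_Suc_pred:
  assumes "\<And>k. Measurable.pred (FF K n) (\<lambda>\<omega>. k \<in> SS K n \<omega>)"
  shows "Measurable.pred (FF K n) (\<lambda>\<omega>. k \<in> SS K (Suc n) \<omega>)"
  unfolding SS_Suc
  by (rule measurable_onestep[OF _ _ alpha(1) assms post_meas, of "{1..K}"]) (auto simp: SS_subset)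

lemma SS_pred: "Measurable.pred (FF K n) (\<lambda>\<omega>. k \<in> SS K n \<omega>)"
proof (induction n arbitrary: k)
  case 0
  show ?case by (simp add: SS_0)
next
  case (Suc n)
  show ?case
    by (rule FF_increasing_measurable[OF SS_Suc_pred[OF Suc]])
qed

text \<open>Predictability: in the time indexing of the theorem, S_{t+1} is F_t-measurable. It
  allows the weights of the false non-detection proportion to leave the conditional
  expectation.\<close>

lemma SS_Suc_pred': "Measurable.pred (FF K n) (\<lambda>\<omega>. k \<in> SS K (Suc n) \<omega>)"
  by (rule SS_Suc_pred[OF SS_pred])

lemma box_events_mono:
  assumes "T \<le> T'"
  shows "box_events n T \<subseteq> box_events n T'"
proof
  fix E assume "E \<in> box_events n T"
  then obtain A where A: "E = box_event n T A" "\<And>k t. A k t \<in> sets N"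
    unfolding box_events_def by blast
  define A' where "A' k t = (if t \<le> T then A k t else space N)" for k t
  have "box_event n T A = box_event n T' A'"
  proof -
    have "(\<forall>t\<in>{1..T}. X k t \<omega> \<in> A k t) \<longleftrightarrow> (\<forall>t\<in>{1..T'}. X k t \<omega> \<in> A' k t)" if "\<omega> \<in> space M" for k \<omega>
      using assms measurable_space[OF X_meas that] by (auto simp: A'_def)
    then show ?thesis
      unfolding box_event_def by blast
  qed
  moreover have "\<forall>k t. A' k t \<in> sets N"
    using A(2) by (simp add: A'_def)
  ultimately show "E \<in> box_events n T'"
    unfolding A(1) box_events_def by blast
qed

lemma single_box_event:
  assumes "k \<in> {1..n}" "1 \<le> t" "t \<le> T" "C \<in> sets N"
  shows "{\<omega> \<in> space M. X k t \<omega> \<in> C} \<in> box_events n T"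
proof -
  define A where "A j s = (if j = k \<and> s = t then C else space N)" for j s
  have *: "(\<forall>j\<in>I. \<forall>s\<in>J. X j s \<omega> \<in> A j s) \<longleftrightarrow> X k t \<omega> \<in> C" if "\<omega> \<in> space M" "k \<in> I" "t \<in> J" for \<omega> I J
    using that(2,3) measurable_space[OF X_meas that(1)] by (auto simp: A_def)
  have "{\<omega> \<in> space M. X k t \<omega> \<in> C} = box_event n T A"
    unfolding box_event_def using assms *[of _ "{1..n}" "{1..T}"] by auto
  moreover have "\<forall>j s. A j s \<in> sets N"
    using assms by (simp add: A_def)
  ultimately show ?thesis
    unfolding box_events_def by blast
qed

text \<open>The masking events are themselves determined by observations, so the procedure never
  knows more than an observer of all streams. Hence \<open>prob_tau_less_sigma\<close> may be tested
  on the events of \<open>FF\<close>.\<close>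

lemma FF_subset_sigma: "sets (FF K n) \<subseteq> sigma_sets (space M) (box_events K (Suc n))"
proof (induction n)
  case 0
  show ?case
    unfolding FF_0 sets_fil1
    by (rule sigma_sets_mono') (use single_box_event in auto)
next
  case (Suc n)
  let ?G = "sigma_sets (space M) (box_events K (Suc (Suc n)))"
  interpret G: sigma_algebra "space M" ?G
    by (rule sigma_algebra_sigma_sets) (rule box_events_Pow)
  have F: "sets (FF K n) \<subseteq> ?G"
    using Suc sigma_sets_mono'[OF box_events_mono[of "Suc n" "Suc (Suc n)" K], of "space M"] by auto
  have S: "{\<omega> \<in> space M. k \<in> SS K (Suc n) \<omega>} \<in> ?G" for k
    using SS_Suc_pred'[where K = K and n = n and k = k] F by (auto simp: pred_def)
  show ?case
    unfolding FF_Suc sets_filstep[OF space_FF]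
  proof (rule G.sigma_sets_subset, safe)
    fix E assume "E \<in> sets (FF K n)"
    then show "E \<in> ?G"
      using F by blast
  next
    fix k
    show "{\<omega> \<in> space M. k \<in> SS K (Suc n) \<omega>} \<in> ?G"
      by (rule S)
  next
    fix k A assume A: "A \<in> sets N"
    show "{\<omega> \<in> space M. k \<in> SS K (Suc n) \<omega> \<and> X k (Suc (Suc n)) \<omega> \<in> A} \<in> ?G"
    proof (cases "k \<in> {1..K}")
      case True
      have "{\<omega> \<in> space M. X k (Suc (Suc n)) \<omega> \<in> A} \<in> ?G"
        using True A by (intro sigma_sets.Basic single_box_event) auto
      from G.Int[OF S[of k] this]
      have "{\<omega> \<in> space M. k \<in> SS K (Suc n) \<omega>} \<inter> {\<omega> \<in> space M. X k (Suc (Suc n)) \<omega> \<in> A} \<in> ?G" .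
      also have "{\<omega> \<in> space M. k \<in> SS K (Suc n) \<omega>} \<inter> {\<omega> \<in> space M. X k (Suc (Suc n)) \<omega> \<in> A}
          = {\<omega> \<in> space M. k \<in> SS K (Suc n) \<omega> \<and> X k (Suc (Suc n)) \<omega> \<in> A}"
        by blast
      finally show ?thesis .
    next
      case False
      then have *: "{\<omega> \<in> space M. k \<in> SS K (Suc n) \<omega> \<and> X k (Suc (Suc n)) \<omega> \<in> A} = {}"
        using SS_subset by blast
      show ?thesis
        unfolding * by simp
    qed
  qed
qed

lemma subalgebra_FF: "subalgebra M (FF K n)"
  using FF_subset_sigma[of K n] sets.sigma_sets_subset[OF box_events_sets]
  by (fastforce simp: subalgebra_def)

text \<open>Once a stream is dropped its observations, and with them V, leave the filtration, so the
  statement is masked. The recursion still runs: a stream active now was active before, so the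
  masked previous value and the masked likelihood ratio are the true ones.\<close>

lemma V_masked_meas: "(\<lambda>\<omega>. if k \<in> SS K n \<omega> then V k (Suc n) \<omega> else 0) \<in> borel_measurable (FF K n)"
proof (induction n)
  case 0
  show ?case
  proof (cases "k \<in> {1..K}")
    case True
    have "X k 1 \<in> measurable (FF K 0) N"
    proof (rule measurableI)
      fix A assume "A \<in> sets N"
      then have "{\<omega> \<in> space M. X k 1 \<omega> \<in> A} \<in> sets (FF K 0)"
        unfolding FF_0 sets_fil1 using True by (intro sigma_sets.Basic) blast
      moreover have "X k 1 -` A \<inter> space (FF K 0) = {\<omega> \<in> space M. X k 1 \<omega> \<in> A}"
        by auto
      ultimately show "X k 1 -` A \<inter> space (FF K 0) \<in> sets (FF K 0)"
        by simp
    qed (use measurable_space[OF X_meas] in simp)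
    then have [measurable]: "(\<lambda>\<omega>. L (X k 1 \<omega>)) \<in> borel_measurable (FF K 0)"
      by measurable
    have "(\<lambda>\<omega>. L (X k 1 \<omega>) / ((1 - \<theta>) / \<theta> + L (X k 1 \<omega>))) \<in> borel_measurable (FF K 0)"
      by measurable
    moreover have "V k (Suc 0) \<omega> = L (X k 1 \<omega>) / ((1 - \<theta>) / \<theta> + L (X k 1 \<omega>))" for \<omega>
      using V_Suc[of k 0 \<omega>] by (simp add: One_nat_def)
    ultimately show ?thesis
      unfolding SS_0 using True by (simp only: if_True)
  next
    case False
    then show ?thesis
      unfolding SS_0 if_not_P[OF False] by simp
  qed
next
  case (Suc n)
  define v where "v \<omega> = (if k \<in> SS K n \<omega> then V k (Suc n) \<omega> else 0)" for \<omega>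
  define l where "l \<omega> = (if k \<in> SS K (Suc n) \<omega> then L (X k (Suc (Suc n)) \<omega>) else 0)" for \<omega>
  have [measurable]: "v \<in> borel_measurable (FF K (Suc n))"
    unfolding v_def by (rule FF_increasing_measurable[OF Suc])
  have [measurable]: "l \<in> borel_measurable (FF K (Suc n))"
    unfolding l_def FF_Suc
    by (rule measurable_masked_filstep[where Y = "\<lambda>k. X k (Suc (Suc n))", OF space_FF]) auto
  note [measurable] = SS_pred[where K = K and n = "Suc n" and k = k]
  have "(\<lambda>\<omega>. if k \<in> SS K (Suc n) \<omega> then l \<omega> / ((1 - \<theta>) * (1 - v \<omega>) / (\<theta> + (1 - \<theta>) * v \<omega>) + l \<omega>) else 0) \<in> borel_measurable (FF K (Suc n))"
    by measurable
  also have "(\<lambda>\<omega>. if k \<in> SS K (Suc n) \<omega> then l \<omega> / ((1 - \<theta>) * (1 - v \<omega>) / (\<theta> + (1 - \<theta>) * v \<omega>) + l \<omega>) else 0)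
     = (\<lambda>\<omega>. if k \<in> SS K (Suc n) \<omega> then V k (Suc (Suc n)) \<omega> else 0)"
    using SS_decreasing[of K n] by (auto simp: fun_eq_iff v_def l_def V_Suc[of k "Suc n"])
  finally show ?case .
qed

lemma sigma_finite_subalgebra_FF: "sigma_finite_subalgebra M (FF K n)"
  by (intro finite_measure_subalgebra_is_sigma_finite finite_measure_subalgebra.intro
      finite_measure_subalgebra_axioms.intro subalgebra_FF) (rule finite_measure_axioms)

text \<open>The conditional expectation of f times the indicator of tau < Suc n, with f the activity
  indicator, is computed twice: pulling out f gives f times \<open>post\<close>, and the defining
  integrals give the masked V. Both are compared where f = 1.\<close>

lemma post_eq_V: "AE \<omega> in M. \<forall>k\<in>SS K n \<omega>. post K n k \<omega> = V k (Suc n) \<omega>"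
proof -
  interpret F: sigma_finite_subalgebra M "FF K n"
    by (rule sigma_finite_subalgebra_FF)
  note from_F = measurable_from_subalg[OF subalgebra_FF[of K n]]
  have "AE \<omega> in M. k \<in> SS K n \<omega> \<longrightarrow> post K n k \<omega> = V k (Suc n) \<omega>" if k: "k \<in> {1..K}" for k
  proof -
    let ?g = "\<lambda>\<omega>. if tau k \<omega> < Suc n then 1 else 0 :: real"
    define f :: "'a \<Rightarrow> real" where "f \<omega> = (if k \<in> SS K n \<omega> then 1 else 0)" for \<omega>
    define v where "v \<omega> = (if k \<in> SS K n \<omega> then V k (Suc n) \<omega> else 0)" for \<omega>
    note [measurable] = SS_pred[where K = K and n = n and k = k]
    have f [measurable]: "f \<in> borel_measurable (FF K n)"
      unfolding f_def by measurable
    have v: "v \<in> borel_measurable (FF K n)"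
      unfolding v_def by (rule V_masked_meas)
    note [measurable] = from_F[OF f] from_F[OF v]
    have int: "integrable M (\<lambda>\<omega>. f \<omega> * ?g \<omega>)"
      by (rule integrable_const_bound[where B = 1], simp add: f_def, measurable)
    have int_v: "integrable M v"
      by (rule integrable_const_bound[where B = 1], simp add: v_def, measurable)
    have "AE \<omega> in M. real_cond_exp M (FF K n) (\<lambda>\<omega>. f \<omega> * ?g \<omega>) \<omega> = f \<omega> * real_cond_exp M (FF K n) ?g \<omega>"
      by (rule F.real_cond_exp_mult[OF f _ int]) measurable
    moreover have "AE \<omega> in M. real_cond_exp M (FF K n) (\<lambda>\<omega>. f \<omega> * ?g \<omega>) \<omega> = v \<omega>"
    proof (rule F.real_cond_exp_charact[OF _ int int_v v])
      fix A assume A: "A \<in> sets (FF K n)"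
      \<comment> \<open>On E the masked integrands are the unmasked ones, and E is an event of the
        full observation sigma-algebra.\<close>
      define E where "E = A \<inter> {\<omega> \<in> space M. k \<in> SS K n \<omega>}"
      have "E \<in> sets (FF K n)"
        unfolding E_def using A SS_pred[where K = K and n = n and k = k] by (intro sets.Int) (auto simp: pred_def)
      then have E: "E \<in> sigma_sets (space M) (box_events K (Suc n))"
        using FF_subset_sigma by blast
      have A_space: "A \<subseteq> space M"
        using sets.sets_into_space[OF A] by simp
      have [measurable]: "E \<in> sets M"
        using E sets.sigma_sets_subset[OF box_events_sets] by blast
      have "{\<omega> \<in> E. tau k \<omega> < Suc n} = E \<inter> {\<omega> \<in> space M. tau k \<omega> < Suc n}"
        using A_space by (auto simp: E_def)
      then have [measurable]: "{\<omega> \<in> E. tau k \<omega> < Suc n} \<in> sets M"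
        by simp
      have "(\<integral>\<omega>\<in>A. f \<omega> * ?g \<omega> \<partial>M) = (\<integral>\<omega>. indicator {\<omega> \<in> E. tau k \<omega> < Suc n} \<omega> \<partial>M)"
        unfolding set_lebesgue_integral_def
        by (intro Bochner_Integration.integral_cong) (auto simp: E_def f_def indicator_def)
      also have "\<dots> = measure M {\<omega> \<in> E. tau k \<omega> < Suc n}"
        using sets.sets_into_space[of "{\<omega> \<in> E. tau k \<omega> < Suc n}" M] by (simp add: Int_absorb2)
      also have "\<dots> = (\<integral>\<omega>. V k (Suc n) \<omega> * indicator E \<omega> \<partial>M)"
        by (rule prob_tau_less_sigma[OF k E])
      also have "\<dots> = (\<integral>\<omega>\<in>A. v \<omega> \<partial>M)"
        unfolding set_lebesgue_integral_def
        by (intro Bochner_Integration.integral_cong) (auto simp: E_def v_def indicator_def)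
      finally show "(\<integral>\<omega>\<in>A. f \<omega> * ?g \<omega> \<partial>M) = (\<integral>\<omega>\<in>A. v \<omega> \<partial>M)" .
    qed
    ultimately show ?thesis
      by eventually_elim (auto simp: post_def f_def v_def)
  qed
  then have "AE \<omega> in M. \<forall>k\<in>{1..K}. k \<in> SS K n \<omega> \<longrightarrow> post K n k \<omega> = V k (Suc n) \<omega>"
    by (subst AE_ball_countable) auto
  then show ?thesis
  proof eventually_elim
    case (elim \<omega>)
    then show ?case
      using SS_subset[of K n \<omega>] by blast
  qed
qed

text \<open>The weight of stream k, its indicator of being kept divided by the number kept, is
  measurable at conditioning time; only the posterior remains under the conditional expectation, and
  kept streams were active, where it is V.\<close>

lemma LFNR_eq_sum:
  "AE \<omega> in M. LFNR M N X tau \<alpha> K (Suc n) \<omega>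
     = (\<Sum>k\<in>SS K (Suc n) \<omega>. V k (Suc n) \<omega>) / real (max (card (SS K (Suc n) \<omega>)) 1)"
proof -
  interpret F: sigma_finite_subalgebra M "FF K n"
    by (rule sigma_finite_subalgebra_FF)
  note from_F = measurable_from_subalg[OF subalgebra_FF[of K n]]
  let ?g = "\<lambda>k \<omega>. if tau k \<omega> < Suc n then 1 else 0 :: real"
  note [measurable] = SS_Suc_pred'[where K = K and n = n]
  define f :: "nat \<Rightarrow> 'a \<Rightarrow> real" where
    "f k \<omega> = (if k \<in> SS K (Suc n) \<omega> then 1 else 0) / real (max (card (SS K (Suc n) \<omega>)) 1)" for k \<omega>
  \<comment> \<open>A sum over the fixed range 1..K makes the random cardinality visibly
    measurable.\<close>
  have card_eq: "real (max (card (SS K (Suc n) \<omega>)) 1) = max (\<Sum>k\<in>{1..K}. if k \<in> SS K (Suc n) \<omega> then 1 else 0) 1" for \<omega>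
  proof -
    have "(\<Sum>k\<in>{1..K}. if k \<in> SS K (Suc n) \<omega> then 1 else 0) = real (card (SS K (Suc n) \<omega>))"
      using SS_subset[of K "Suc n" \<omega>] by (simp add: sum.If_cases Int_absorb1)
    then show ?thesis
      by (simp add: of_nat_max)
  qed
  have f: "f k \<in> borel_measurable (FF K n)" for k
    unfolding f_def card_eq by measurable
  note [measurable] = from_F[OF f]
  have "\<bar>f k \<omega>\<bar> \<le> 1" for k \<omega>
    by (auto simp: f_def)
  then have int: "integrable M (\<lambda>\<omega>. f k \<omega> * ?g k \<omega>)" for k
    by (intro integrable_const_bound[where B = 1]) auto
  have to_sum: "(\<Sum>k\<in>SS K (Suc n) \<omega>. h k) / real (max (card (SS K (Suc n) \<omega>)) 1) = (\<Sum>k\<in>{1..K}. f k \<omega> * h k)" for \<omega> h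
  proof -
    have "(\<Sum>k\<in>{1..K}. f k \<omega> * h k) = (\<Sum>k\<in>SS K (Suc n) \<omega>. h k / real (max (card (SS K (Suc n) \<omega>)) 1))"
      using SS_subset[of K "Suc n" \<omega>] by (intro sum.mono_neutral_cong_right) (auto simp: f_def)
    then show ?thesis
      by (simp add: sum_divide_distrib)
  qed
  have "LFNR M N X tau \<alpha> K (Suc n) = real_cond_exp M (FF K n) (FNP M N X tau \<alpha> K (Suc n))"
    by (simp add: LFNR_def Fil_def FF_def)
  also have "FNP M N X tau \<alpha> K (Suc n) = (\<lambda>\<omega>. \<Sum>k\<in>{1..K}. f k \<omega> * ?g k \<omega>)"
  proof
    fix \<omega>
    have "FNP M N X tau \<alpha> K (Suc n) \<omega> = (\<Sum>k\<in>SS K (Suc n) \<omega>. ?g k \<omega>) / real (max (card (SS K (Suc n) \<omega>)) 1)"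
      by (simp add: FNP_def Sset_def SS_def del: proc.simps)
    then show "FNP M N X tau \<alpha> K (Suc n) \<omega> = (\<Sum>k\<in>{1..K}. f k \<omega> * ?g k \<omega>)"
      by (simp only: to_sum)
  qed
  finally have 1: "LFNR M N X tau \<alpha> K (Suc n) = real_cond_exp M (FF K n) (\<lambda>\<omega>. \<Sum>k\<in>{1..K}. f k \<omega> * ?g k \<omega>)" .
  have "AE \<omega> in M. real_cond_exp M (FF K n) (\<lambda>\<omega>. \<Sum>k\<in>{1..K}. f k \<omega> * ?g k \<omega>) \<omega> = (\<Sum>k\<in>{1..K}. real_cond_exp M (FF K n) (\<lambda>\<omega>. f k \<omega> * ?g k \<omega>) \<omega>)"
    by (rule F.real_cond_exp_sum[OF int])
  moreover have "AE \<omega> in M. \<forall>k\<in>{1..K}. real_cond_exp M (FF K n) (\<lambda>\<omega>. f k \<omega> * ?g k \<omega>) \<omega> = f k \<omega> * post K n k \<omega>"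
    unfolding post_def by (subst AE_ball_countable) (auto intro!: F.real_cond_exp_mult f int)
  moreover have "AE \<omega> in M. \<forall>k\<in>SS K n \<omega>. post K n k \<omega> = V k (Suc n) \<omega>"
    by (rule post_eq_V)
  ultimately show ?thesis
  proof eventually_elim
    case (elim \<omega>)
    have "(\<Sum>k\<in>{1..K}. real_cond_exp M (FF K n) (\<lambda>\<omega>. f k \<omega> * ?g k \<omega>) \<omega>) = (\<Sum>k\<in>{1..K}. f k \<omega> * post K n k \<omega>)"
      using elim(2) by (intro sum.cong refl) blast
    also have "\<dots> = (\<Sum>k\<in>{1..K}. f k \<omega> * V k (Suc n) \<omega>)"
      using elim(3) SS_decreasing[of K n \<omega>] by (intro sum.cong refl) (auto simp: f_def)
    finally show ?case
      unfolding 1 to_sum elim(1) .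
  qed
qed

text \<open>The exceptional sets for all K and n are merged here; conditional expectations disappear
  from the argument after this point.\<close>

lemma procedure_in_terms_of_V:
  "AE \<omega> in M. \<forall>K n.
     SS K (Suc n) \<omega> = onestep \<alpha> (SS K n \<omega>) (\<lambda>k. V k (Suc n) \<omega>)
     \<and> (\<forall>k\<in>SS K n \<omega>. post K n k \<omega> = V k (Suc n) \<omega>)
     \<and> LFNR M N X tau \<alpha> K (Suc n) \<omega> = (\<Sum>k\<in>SS K (Suc n) \<omega>. V k (Suc n) \<omega>) / real (max (card (SS K (Suc n) \<omega>)) 1)"
proof (subst AE_all_countable, rule allI, subst AE_all_countable, rule allI)
  fix K n
  from post_eq_V[of K n] LFNR_eq_sum[of K n]
  show "AE \<omega> in M. SS K (Suc n) \<omega> = onestep \<alpha> (SS K n \<omega>) (\<lambda>k. V k (Suc n) \<omega>)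
     \<and> (\<forall>k\<in>SS K n \<omega>. post K n k \<omega> = V k (Suc n) \<omega>)
     \<and> LFNR M N X tau \<alpha> K (Suc n) \<omega> = (\<Sum>k\<in>SS K (Suc n) \<omega>. V k (Suc n) \<omega>) / real (max (card (SS K (Suc n) \<omega>)) 1)"
  proof eventually_elim
    case (elim \<omega>)
    have "SS K (Suc n) \<omega> = onestep \<alpha> (SS K n \<omega>) (\<lambda>k. V k (Suc n) \<omega>)"
      unfolding SS_Suc using elim(1) by (intro onestep_cong[OF finite_SS alpha(1)]) blast
    with elim show ?case
      by blast
  qed
qed

end


section \<open>The limiting thresholds\<close>

lemma length_lamlist: "length (lamlist M V \<alpha> n) = Suc n"
  by (induction n) auto

text \<open>The list merely makes a course-of-values recursion primitive: entries do not change once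
  appended.\<close>

lemma lamlist_nth: "s \<le> n \<Longrightarrow> lamlist M V \<alpha> n ! s = lam M V \<alpha> s"
proof (induction n)
  case 0
  then show ?case by (simp add: lam_def)
next
  case (Suc n)
  show ?case
  proof (cases "s = Suc n")
    case False
    with Suc show ?thesis
      by (simp add: nth_append length_lamlist)
  qed (simp add: lam_def)
qed

lemma lam_0 [simp]: "lam M V \<alpha> 0 = 1"
  by (simp add: lam_def)

lemma lam_Suc:
  "lam M V \<alpha> (Suc n) = Sup {l \<in> {0..1}. cexp_event M (V (Suc n))
     {\<omega> \<in> space M. V (Suc n) \<omega> \<le> l \<and> (\<forall>s\<le>n. V s \<omega> \<le> lam M V \<alpha> s)} \<le> \<alpha>}"
proof -
  have "(\<forall>s\<le>n. V s \<omega> \<le> lamlist M V \<alpha> n ! s) \<longleftrightarrow> (\<forall>s\<le>n. V s \<omega> \<le> lam M V \<alpha> s)" for \<omega>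
    by (simp add: lamlist_nth)
  then show ?thesis
    unfolding lam_def[of M V \<alpha> "Suc n"] by (simp add: nth_append length_lamlist)
qed

lemma (in finite_measure) integral_of_bool:
  assumes "{\<omega> \<in> space M. Q \<omega>} \<in> sets M"
  shows "(\<integral>\<omega>. of_bool (Q \<omega>) \<partial>M) = measure M {\<omega> \<in> space M. Q \<omega>}"
proof -
  have "(\<integral>\<omega>. of_bool (Q \<omega>) \<partial>M) = (\<integral>\<omega>. indicator {\<omega> \<in> space M. Q \<omega>} \<omega> \<partial>M)"
    by (intro Bochner_Integration.integral_cong) (auto simp: indicator_def)
  also have "\<dots> = measure M {\<omega> \<in> space M. Q \<omega>}"
    using assms by (simp add: Int_absorb2)
  finally show ?thesis .
qed

context detection
begin

definition lm :: "nat \<Rightarrow> real" where "lm t = lam M (V 1) \<alpha> t"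

definition acc :: "nat \<Rightarrow> nat \<Rightarrow> 'a \<Rightarrow> bool" where
  "acc k n \<omega> \<longleftrightarrow> (\<forall>s\<le>n. V k s \<omega> \<le> lm s)"

definition accx :: "nat \<Rightarrow> (nat \<Rightarrow> 'b) \<Rightarrow> bool" where
  "accx n x \<longleftrightarrow> (\<forall>s\<le>n. vfun s x \<le> lm s)"

lemma acc_0 [simp]: "acc k 0 \<omega>"
  by (simp add: acc_def lm_def)

lemma acc_Suc: "acc k (Suc n) \<omega> \<longleftrightarrow> acc k n \<omega> \<and> V k (Suc n) \<omega> \<le> lm (Suc n)"
  by (auto simp: acc_def le_Suc_eq)

lemma accx_block: "n \<le> T \<Longrightarrow> accx n (block k T \<omega>) \<longleftrightarrow> acc k n \<omega>"
  by (simp add: accx_def acc_def vfun_block)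

lemma acc_meas [measurable]: "Measurable.pred M (acc k n)"
  unfolding acc_def by measurable

lemma vfun_meas_le:
  assumes "s \<le> T"
  shows "vfun s \<in> borel_measurable (XT T)"
proof -
  have "vfun s = (\<lambda>x. vfun s (restrict x {1..s}))"
    by (intro ext vfun_cong) auto
  also have "\<dots> \<in> borel_measurable (XT T)"
    using measurable_restrict_XT[OF assms] by measurable
  finally show ?thesis .
qed

lemma accx_meas:
  assumes "n \<le> T"
  shows "Measurable.pred (XT T) (accx n)"
  using assms
proof (induction n)
  case 0
  show ?case
    unfolding accx_def using vfun_meas_le[of 0 T] by simp
next
  case (Suc n)
  then have [measurable]: "Measurable.pred (XT T) (accx n)" "vfun (Suc n) \<in> borel_measurable (XT T)"
    by (auto intro: vfun_meas_le)
  have "accx (Suc n) = (\<lambda>x. accx n x \<and> vfun (Suc n) x \<le> lm (Suc n))"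
    by (auto simp: accx_def le_Suc_eq fun_eq_iff)
  then show ?case
    by simp
qed

text \<open>A mean restricted to the accepted past rather than conditioned on it: it is linear in u
  and directly the limit of averages over all K streams.\<close>

definition restr_mean :: "nat \<Rightarrow> (real \<Rightarrow> real) \<Rightarrow> real" where
  "restr_mean n u = (\<integral>\<omega>. u (V 1 (Suc n) \<omega>) * of_bool (acc 1 n \<omega>) \<partial>M)"

text \<open>The bound is asked on [0,1] only, where V lives; \<open>excess\<close> and the identity
  are unbounded on the line.\<close>

definition unit_bounded :: "(real \<Rightarrow> real) \<Rightarrow> bool" where
  "unit_bounded u \<longleftrightarrow> u \<in> borel_measurable borel \<and> (\<forall>v. 0 \<le> v \<longrightarrow> v \<le> 1 \<longrightarrow> \<bar>u v\<bar> \<le> 1)"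

lemma unit_bounded_meas: "unit_bounded u \<Longrightarrow> u \<in> borel_measurable borel"
  and unit_boundedD: "unit_bounded u \<Longrightarrow> 0 \<le> v \<Longrightarrow> v \<le> 1 \<Longrightarrow> \<bar>u v\<bar> \<le> 1"
  by (auto simp: unit_bounded_def)

lemma unit_bounded_V: "unit_bounded u \<Longrightarrow> \<bar>u (V k n \<omega>)\<bar> \<le> 1"
  by (rule unit_boundedD) auto

lemma restr_integrable:
  assumes "unit_bounded u"
  shows "integrable M (\<lambda>\<omega>. u (V k (Suc n) \<omega>) * of_bool (acc k n \<omega>))"
proof (rule integrable_const_bound[where B = 1])
  note [measurable] = unit_bounded_meas[OF assms]
  show "(\<lambda>\<omega>. u (V k (Suc n) \<omega>) * of_bool (acc k n \<omega>)) \<in> borel_measurable M"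
    by measurable
qed (use unit_bounded_V[OF assms] in auto)

lemma restr_mean_diff:
  assumes "unit_bounded u" "unit_bounded u'"
  shows "restr_mean n u - restr_mean n u' = (\<integral>\<omega>. (u (V 1 (Suc n) \<omega>) - u' (V 1 (Suc n) \<omega>)) * of_bool (acc 1 n \<omega>) \<partial>M)"
  unfolding restr_mean_def left_diff_distrib
  by (rule Bochner_Integration.integral_diff[symmetric]) (rule restr_integrable[OF assms(1)], rule restr_integrable[OF assms(2)])

lemma restr_mean_mono:
  assumes "unit_bounded u" "unit_bounded u'" "\<And>v. 0 \<le> v \<Longrightarrow> v < 1 \<Longrightarrow> u v \<le> u' v"
  shows "restr_mean n u \<le> restr_mean n u'"
  unfolding restr_mean_def
  by (intro integral_mono restr_integrable assms(1,2) mult_right_mono assms(3)) (auto simp: V_less_1)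

lemma restr_mean_cmult: "restr_mean n (\<lambda>v. c * u v) = c * restr_mean n u"
  by (simp add: restr_mean_def mult.assoc)

lemma restr_mean_of_bool:
  assumes [measurable]: "Measurable.pred borel R"
  shows "restr_mean n (\<lambda>v. of_bool (R v)) = measure M {\<omega> \<in> space M. R (V 1 (Suc n) \<omega>) \<and> acc 1 n \<omega>}"
proof -
  have "restr_mean n (\<lambda>v. of_bool (R v)) = (\<integral>\<omega>. of_bool (R (V 1 (Suc n) \<omega>) \<and> acc 1 n \<omega>) \<partial>M)"
    unfolding restr_mean_def by (intro Bochner_Integration.integral_cong) auto
  also have "\<dots> = measure M {\<omega> \<in> space M. R (V 1 (Suc n) \<omega>) \<and> acc 1 n \<omega>}"
    by (rule integral_of_bool) measurable
  finally show ?thesis .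
qed

lemma strong_law_V:
  assumes u: "unit_bounded u"
  shows "AE \<omega> in M. (\<lambda>K. (\<Sum>k\<in>{1..K}. u (V k (Suc n) \<omega>) * of_bool (acc k n \<omega>)) / real K) \<longlonglongrightarrow> restr_mean n u"
proof -
  note [measurable] = unit_bounded_meas[OF u] accx_meas[of n "Suc n"]
  have "AE \<omega> in M. (\<lambda>K. (\<Sum>k\<in>{1..K}. (\<lambda>x. u (vfun (Suc n) x) * of_bool (accx n x)) (block k (Suc n) \<omega>)) / real K)
    \<longlonglongrightarrow> (\<integral>\<omega>. (\<lambda>x. u (vfun (Suc n) x) * of_bool (accx n x)) (block 1 (Suc n) \<omega>) \<partial>M)"
  proof (rule strong_law_block)
    show "(\<lambda>x. u (vfun (Suc n) x) * of_bool (accx n x)) \<in> borel_measurable (XT (Suc n))"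
      using accx_meas[of n "Suc n"] by measurable
    show "\<bar>u (vfun (Suc n) x) * of_bool (accx n x)\<bar> \<le> 1" for x
      using unit_boundedD[OF u, of "vfun (Suc n) x"] vfun_less_1[of "Suc n" x] by (auto simp: abs_mult)
  qed
  then show ?thesis
    by (simp add: vfun_block accx_block restr_mean_def)
qed

definition prob_acc :: "nat \<Rightarrow> real" where
  "prob_acc n = measure M {\<omega> \<in> space M. acc 1 n \<omega>}"

lemma prob_between_pos:
  assumes "prob_acc n > 0" "0 \<le> a" "a < b" "b \<le> 1"
  shows "restr_mean n (\<lambda>v. of_bool (a < v \<and> v < b)) > 0"
proof -
  define A where "A = {x \<in> space (XT n). accx n x}"
  have A: "A \<in> sets (XT n)"
    using accx_meas[of n n] by (simp add: A_def pred_def)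
  have in_A: "block 1 n \<omega> \<in> A \<longleftrightarrow> acc 1 n \<omega>" if "\<omega> \<in> space M" for \<omega>
    using measurable_space[OF block_meas that] by (simp add: A_def accx_block)
  have eq1: "{\<omega> \<in> space M. block 1 n \<omega> \<in> A} = {\<omega> \<in> space M. acc 1 n \<omega>}"
    using in_A by blast
  have eq2: "{\<omega> \<in> space M. block 1 n \<omega> \<in> A \<and> a < V 1 (Suc n) \<omega> \<and> V 1 (Suc n) \<omega> < b}
      = {\<omega> \<in> space M. (a < V 1 (Suc n) \<omega> \<and> V 1 (Suc n) \<omega> < b) \<and> acc 1 n \<omega>}"
    using in_A by blast
  have "measure M {\<omega> \<in> space M. (a < V 1 (Suc n) \<omega> \<and> V 1 (Suc n) \<omega> < b) \<and> acc 1 n \<omega>} > 0"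
    using V_full_support[OF order_refl A _ assms(2-4)] assms(1) unfolding eq1 eq2 prob_acc_def by blast
  then show ?thesis
    by (subst restr_mean_of_bool) measurable
qed

definition excess :: "real \<Rightarrow> real \<Rightarrow> real" where
  "excess l v = (v - \<alpha>) * of_bool (v \<le> l)"

lemma unit_bounded_excess: "unit_bounded (excess l)"
  using alpha unfolding unit_bounded_def excess_def by (auto simp: abs_mult)

lemma unit_bounded_of_bool: "Measurable.pred borel R \<Longrightarrow> unit_bounded (\<lambda>v. of_bool (R v))"
  unfolding unit_bounded_def by auto

lemma unit_bounded_cmult:
  assumes "\<bar>c\<bar> \<le> 1" "unit_bounded u"
  shows "unit_bounded (\<lambda>v. c * u v)"
proof -
  have [measurable]: "u \<in> borel_measurable borel"
    using assms(2) by (rule unit_bounded_meas)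
  have "\<bar>c * u v\<bar> \<le> 1" if "0 \<le> v" "v \<le> 1" for v
    using mult_mono[OF assms(1) unit_boundedD[OF assms(2) that]] by (simp add: abs_mult)
  then show ?thesis
    unfolding unit_bounded_def by auto
qed

definition psi :: "nat \<Rightarrow> real \<Rightarrow> real" where
  "psi n l = restr_mean n (excess l)"

text \<open>Up to level \<alpha> the integrand is nonpositive, and on the interval (0, l/2), which
  has positive mass, it is at most l/2 - \<alpha> < 0.\<close>

lemma psi_neg:
  assumes "prob_acc n > 0" "0 < l" "l \<le> \<alpha>"
  shows "psi n l < 0"
proof -
  have "psi n l \<le> restr_mean n (\<lambda>v. (l / 2 - \<alpha>) * of_bool (0 < v \<and> v < l / 2))"
    unfolding psi_def
  proof (rule restr_mean_mono)
    show "unit_bounded (\<lambda>v. (l / 2 - \<alpha>) * of_bool (0 < v \<and> v < l / 2))"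
      using assms alpha by (intro unit_bounded_cmult unit_bounded_of_bool) (auto simp: abs_le_iff)
    show "excess l v \<le> (l / 2 - \<alpha>) * of_bool (0 < v \<and> v < l / 2)" for v
      using assms by (auto simp: excess_def)
  qed (rule unit_bounded_excess)
  also have "\<dots> = (l / 2 - \<alpha>) * restr_mean n (\<lambda>v. of_bool (0 < v \<and> v < l / 2))"
    by (rule restr_mean_cmult)
  also have "\<dots> < 0"
    using prob_between_pos[OF assms(1), of 0 "l / 2"] assms alpha by (intro mult_neg_pos) auto
  finally show ?thesis .
qed

text \<open>Raising the level above \<alpha> only adds values V - \<alpha> > 0, and full support
  gives them positive mass.\<close>

lemma psi_strict_mono:
  assumes "prob_acc n > 0" "\<alpha> \<le> l" "l < l'" "l' \<le> 1"
  shows "psi n l < psi n l'"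
proof -
  \<comment> \<open>The midpoint keeps the factor m - \<alpha> positive even if l =
    \<alpha>.\<close>
  define m where "m = (l + l') / 2"
  have m: "l < m" "m < l'"
    using assms by (auto simp: m_def)
  have "0 < (m - \<alpha>) * restr_mean n (\<lambda>v. of_bool (m < v \<and> v < l'))"
    using prob_between_pos[OF assms(1), of m l'] assms alpha m by (intro mult_pos_pos) auto
  also have "\<dots> = restr_mean n (\<lambda>v. (m - \<alpha>) * of_bool (m < v \<and> v < l'))"
    by (rule restr_mean_cmult[symmetric])
  also have "\<dots> \<le> (\<integral>\<omega>. (excess l' (V 1 (Suc n) \<omega>) - excess l (V 1 (Suc n) \<omega>)) * of_bool (acc 1 n \<omega>) \<partial>M)"
    unfolding restr_mean_def
  proof (rule integral_mono)
    show "integrable M (\<lambda>\<omega>. (m - \<alpha>) * of_bool (m < V 1 (Suc n) \<omega> \<and> V 1 (Suc n) \<omega> < l') * of_bool (acc 1 n \<omega>))"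
      using assms alpha m by (intro restr_integrable unit_bounded_cmult unit_bounded_of_bool) (auto simp: abs_le_iff)
    show "integrable M (\<lambda>\<omega>. (excess l' (V 1 (Suc n) \<omega>) - excess l (V 1 (Suc n) \<omega>)) * of_bool (acc 1 n \<omega>))"
      using restr_integrable[OF unit_bounded_excess[of l'], of 1 n] restr_integrable[OF unit_bounded_excess[of l], of 1 n]
      by (simp add: left_diff_distrib)
    fix \<omega>
    have "(m - \<alpha>) * of_bool (m < v \<and> v < l') \<le> excess l' v - excess l v" for v
      using m assms by (auto simp: excess_def)
    then show "(m - \<alpha>) * of_bool (m < V 1 (Suc n) \<omega> \<and> V 1 (Suc n) \<omega> < l') * of_bool (acc 1 n \<omega>)
      \<le> (excess l' (V 1 (Suc n) \<omega>) - excess l (V 1 (Suc n) \<omega>)) * of_bool (acc 1 n \<omega>)"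
      by (rule mult_right_mono) simp
  qed
  also have "\<dots> = psi n l' - psi n l"
    unfolding psi_def by (rule restr_mean_diff[symmetric]) (rule unit_bounded_excess)+
  finally show ?thesis
    by simp
qed

lemma psi_eq:
  "psi n l = (\<integral>\<omega>. V 1 (Suc n) \<omega> * indicator {\<omega> \<in> space M. V 1 (Suc n) \<omega> \<le> l \<and> acc 1 n \<omega>} \<omega> \<partial>M)
    - \<alpha> * measure M {\<omega> \<in> space M. V 1 (Suc n) \<omega> \<le> l \<and> acc 1 n \<omega>}"
proof -
  define E where "E = {\<omega> \<in> space M. V 1 (Suc n) \<omega> \<le> l \<and> acc 1 n \<omega>}"
  have [measurable]: "E \<in> sets M"
    unfolding E_def by measurable
  have ind: "integrable M (indicator E :: 'a \<Rightarrow> real)"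
    by (rule integrable_real_indicator) (auto simp: emeasure_eq_measure)
  have "psi n l = (\<integral>\<omega>. V 1 (Suc n) \<omega> * indicator E \<omega> - \<alpha> * indicator E \<omega> \<partial>M)"
    unfolding psi_def restr_mean_def
    by (intro Bochner_Integration.integral_cong) (auto simp: excess_def E_def indicator_def algebra_simps)
  also have "\<dots> = (\<integral>\<omega>. V 1 (Suc n) \<omega> * indicator E \<omega> \<partial>M) - (\<integral>\<omega>. \<alpha> * indicator E \<omega> \<partial>M)"
    using ind by (intro Bochner_Integration.integral_diff V_integrable integrable_mult_right) auto
  also have "(\<integral>\<omega>. \<alpha> * indicator E \<omega> \<partial>M) = \<alpha> * measure M E"
    using sets.sets_into_space[of E M] by (simp add: Int_absorb2)
  finally show ?thesis
    by (simp add: E_def)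
qed

text \<open>Multiply by the probability of the event. On a null event the quotient defaults to 0 and
  \<open>psi\<close> is at most 0, so both sides hold.\<close>

lemma cexp_le_iff_psi:
  "cexp_event M (V 1 (Suc n)) {\<omega> \<in> space M. V 1 (Suc n) \<omega> \<le> l \<and> acc 1 n \<omega>} \<le> \<alpha> \<longleftrightarrow> psi n l \<le> 0"
proof -
  define E where "E = {\<omega> \<in> space M. V 1 (Suc n) \<omega> \<le> l \<and> acc 1 n \<omega>}"
  have E [measurable]: "E \<in> sets M"
    unfolding E_def by measurable
  show ?thesis
  proof (cases "measure M E = 0")
    case True
    have "(\<integral>\<omega>. V 1 (Suc n) \<omega> * indicator E \<omega> \<partial>M) \<le> (\<integral>\<omega>. indicator E \<omega> \<partial>M)"
    proof (rule integral_mono)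
      show "integrable M (indicator E :: 'a \<Rightarrow> real)"
        by (rule integrable_real_indicator) (auto simp: emeasure_eq_measure)
      show "integrable M (\<lambda>\<omega>. V 1 (Suc n) \<omega> * indicator E \<omega>)"
        by (rule V_integrable[OF E])
    qed (auto simp: indicator_def)
    also have "\<dots> = measure M E"
      using sets.sets_into_space[OF E] by (simp add: Int_absorb2)
    finally have "psi n l \<le> 0"
      using True by (simp add: psi_eq E_def)
    then show ?thesis
      using True alpha by (simp add: cexp_event_def E_def)
  next
    case False
    then have "measure M E > 0"
      by (simp add: zero_less_measure_iff)
    then show ?thesis
      unfolding psi_eq cexp_event_def E_def[symmetric] by (simp add: pos_divide_le_eq)
  qed
qed

lemma lm_Suc: "lm (Suc n) = Sup {l \<in> {0..1}. psi n l \<le> 0}"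
  unfolding lm_def lam_Suc cexp_le_iff_psi[symmetric] acc_def lm_def ..

text \<open>The level \<alpha> is always feasible by \<open>psi_neg\<close>, so the supremum is over
  a nonempty set and the thresholds stay away from 0.\<close>

lemma lm_bounds:
  assumes "prob_acc n > 0"
  shows "\<alpha> \<le> lm (Suc n)" "lm (Suc n) \<le> 1"
proof -
  have "\<alpha> \<in> {l \<in> {0..1}. psi n l \<le> 0}"
    using psi_neg[OF assms, of \<alpha>] alpha by auto
  then show "\<alpha> \<le> lm (Suc n)" "lm (Suc n) \<le> 1"
    unfolding lm_Suc by (auto intro!: cSup_upper cSup_least)
qed

lemma psi_neg_below:
  assumes "prob_acc n > 0" "0 < l" "l < lm (Suc n)"
  shows "psi n l < 0"
proof (cases "l \<le> \<alpha>")
  case True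
  then show ?thesis
    using psi_neg assms by blast
next
  case False
  have "\<alpha> \<in> {l \<in> {0..1}. psi n l \<le> 0}"
    using psi_neg[OF assms(1), of \<alpha>] alpha by auto
  then have ne: "{l \<in> {0..1}. psi n l \<le> 0} \<noteq> {}"
    by (rule ex_in_conv[THEN iffD1, OF exI])
  from less_cSupD[OF ne assms(3)[unfolded lm_Suc]]
  obtain l' where "l' \<in> {l \<in> {0..1}. psi n l \<le> 0}" "l < l'"
    by (elim bexE exE conjE)
  then have l': "l' \<le> 1" "psi n l' \<le> 0" "l < l'"
    by simp_all
  have "psi n l < psi n l'"
    using False l' by (intro psi_strict_mono assms(1)) simp_all
  with l' show ?thesis
    by simp
qed

lemma psi_pos_above:
  assumes "lm (Suc n) < l" "l \<le> 1" "0 \<le> l"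
  shows "psi n l > 0"
proof (rule ccontr)
  assume "\<not> ?thesis"
  then have "l \<in> {l \<in> {0..1}. psi n l \<le> 0}"
    using assms by auto
  then have "l \<le> lm (Suc n)"
    unfolding lm_Suc by (intro cSup_upper bdd_aboveI[of _ 1]) auto
  with assms show False
    by simp
qed

text \<open>Needed so that no later step conditions on a null event. Positivity at n bounds the next
  threshold below by \<alpha>, and full support puts mass between 0 and that threshold.\<close>

lemma prob_acc_pos: "prob_acc n > 0"
proof (induction n)
  case 0
  show ?case
    by (simp add: prob_acc_def prob_space)
next
  case (Suc n)
  note lm = lm_bounds[OF Suc]
  have "0 < restr_mean n (\<lambda>v. of_bool (0 < v \<and> v < lm (Suc n)))"
    using prob_between_pos[OF Suc, of 0 "lm (Suc n)"] lm alpha by auto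
  also have "\<dots> \<le> restr_mean n (\<lambda>v. of_bool (v \<le> lm (Suc n)))"
    by (intro restr_mean_mono unit_bounded_of_bool) auto
  also have "\<dots> = prob_acc (Suc n)"
    unfolding prob_acc_def
    by (subst restr_mean_of_bool) (auto simp: acc_Suc intro!: arg_cong[where f = "measure M"])
  finally show ?case .
qed

lemma lm_pos: "0 < lm n" and lm_le_1: "lm n \<le> 1"
proof -
  show "lm n \<le> 1"
    using lm_bounds[OF prob_acc_pos] by (cases n) (simp_all add: lm_def)
  have "\<alpha> \<le> lm n"
    using lm_bounds[OF prob_acc_pos] alpha by (cases n) (simp_all add: lm_def)
  then show "0 < lm n"
    using alpha by simp
qed

section \<open>Behaviour at the threshold\<close>

definition near :: "nat \<Rightarrow> nat \<Rightarrow> real \<Rightarrow> bool" where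
  "near n m v \<longleftrightarrow> \<bar>v - lm (Suc n)\<bar> \<le> 1 / real (Suc m)"

lemma unit_bounded_near: "unit_bounded (\<lambda>v. of_bool (near n m v))"
  unfolding near_def by (rule unit_bounded_of_bool) measurable

definition near_mass :: "nat \<Rightarrow> nat \<Rightarrow> real" where
  "near_mass n m = restr_mean n (\<lambda>v. of_bool (near n m v))"

text \<open>The bands decrease to the event that V equals the threshold, which is null because V has
  no atoms.\<close>

lemma near_mass_tendsto: "near_mass n \<longlonglongrightarrow> 0"
proof -
  define B where "B m = {\<omega> \<in> space M. near n m (V 1 (Suc n) \<omega>) \<and> acc 1 n \<omega>}" for m
  have [measurable]: "B m \<in> sets M" for m
    unfolding B_def near_def by measurable
  have eq: "near_mass n m = measure M (B m)" for m
    unfolding near_mass_def B_def by (rule restr_mean_of_bool) (unfold near_def, measurable)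
  have "decseq B"
  proof (rule decseq_SucI)
    fix m
    have "1 / real (Suc (Suc m)) \<le> 1 / real (Suc m)"
      by (simp add: field_simps)
    then show "B (Suc m) \<subseteq> B m"
      unfolding B_def near_def by fastforce
  qed
  then have "(\<lambda>m. measure M (B m)) \<longlonglongrightarrow> measure M (\<Inter>m. B m)"
    by (intro finite_Lim_measure_decseq) auto
  moreover have "measure M (\<Inter>m. B m) = 0"
  proof -
    have "(\<Inter>m. B m) \<subseteq> {\<omega> \<in> space M. V 1 (Suc n) \<omega> = lm (Suc n)}"
    proof
      fix \<omega> assume \<omega>: "\<omega> \<in> (\<Inter>m. B m)"
      then have near: "\<bar>V 1 (Suc n) \<omega> - lm (Suc n)\<bar> \<le> 1 / real (Suc m)" for m
        by (auto simp: B_def near_def)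
      have "V 1 (Suc n) \<omega> = lm (Suc n)"
      proof (rule ccontr)
        assume "V 1 (Suc n) \<omega> \<noteq> lm (Suc n)"
        then obtain m where "1 / real (Suc m) < \<bar>V 1 (Suc n) \<omega> - lm (Suc n)\<bar>"
          using nat_approx_posE[of "\<bar>V 1 (Suc n) \<omega> - lm (Suc n)\<bar>"] by auto
        with near[of m] show False
          by simp
      qed
      with \<omega> show "\<omega> \<in> {\<omega> \<in> space M. V 1 (Suc n) \<omega> = lm (Suc n)}"
        by (auto simp: B_def)
    qed
    then have "measure M (\<Inter>m. B m) \<le> measure M {\<omega> \<in> space M. V 1 (Suc n) \<omega> = lm (Suc n)}"
      by (intro finite_measure_mono) measurable
    then show ?thesis
      using V_atomless[of 1 n "lm (Suc n)"] by (simp add: measure_le_0_iff)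
  qed
  ultimately show ?thesis
    by (simp add: eq[abs_def])
qed

text \<open>A modulus of continuity: moving the level from the threshold to l changes
  \<open>excess\<close> only for V between the two, and by at most 1 there.\<close>

lemma psi_near:
  assumes "\<bar>l - lm (Suc n)\<bar> \<le> 1 / real (Suc m)"
  shows "\<bar>psi n l - psi n (lm (Suc n))\<bar> \<le> near_mass n m"
proof -
  have "\<bar>psi n l - psi n (lm (Suc n))\<bar>
      = \<bar>\<integral>\<omega>. (excess l (V 1 (Suc n) \<omega>) - excess (lm (Suc n)) (V 1 (Suc n) \<omega>)) * of_bool (acc 1 n \<omega>) \<partial>M\<bar>"
    unfolding psi_def by (subst restr_mean_diff[OF unit_bounded_excess unit_bounded_excess]) simp
  also have "\<dots> \<le> (\<integral>\<omega>. \<bar>(excess l (V 1 (Suc n) \<omega>) - excess (lm (Suc n)) (V 1 (Suc n) \<omega>)) * of_bool (acc 1 n \<omega>)\<bar> \<partial>M)"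
    by (rule integral_abs_bound)
  also have "\<dots> \<le> near_mass n m"
    unfolding near_mass_def restr_mean_def
  proof (rule integral_mono)
    show "integrable M (\<lambda>\<omega>. of_bool (near n m (V 1 (Suc n) \<omega>)) * of_bool (acc 1 n \<omega>) :: real)"
      by (rule restr_integrable[OF unit_bounded_near])
    show "integrable M (\<lambda>\<omega>. \<bar>(excess l (V 1 (Suc n) \<omega>) - excess (lm (Suc n)) (V 1 (Suc n) \<omega>)) * of_bool (acc 1 n \<omega>)\<bar>)"
      using restr_integrable[OF unit_bounded_excess[of l], of 1 n] restr_integrable[OF unit_bounded_excess[of "lm (Suc n)"], of 1 n]
      by (intro integrable_abs) (simp add: left_diff_distrib)
    fix \<omega>
    have "\<bar>excess l v - excess (lm (Suc n)) v\<bar> \<le> of_bool (near n m v)" if "0 \<le> v" "v \<le> 1" for v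
      using that assms alpha by (auto simp: excess_def near_def)
    from this[of "V 1 (Suc n) \<omega>"]
    show "\<bar>(excess l (V 1 (Suc n) \<omega>) - excess (lm (Suc n)) (V 1 (Suc n) \<omega>)) * of_bool (acc 1 n \<omega>)\<bar>
        \<le> of_bool (near n m (V 1 (Suc n) \<omega>)) * of_bool (acc 1 n \<omega>)"
      by simp
  qed
  finally show ?thesis .
qed

lemma eventually_inverse_Suc_less:
  assumes "(e :: real) > 0"
  shows "eventually (\<lambda>m. 1 / real (Suc m) < e) sequentially"
  using order_tendstoD(2)[OF LIMSEQ_inverse_real_of_nat assms] by (simp add: inverse_eq_divide)

text \<open>Left continuity: \<open>psi\<close> is negative at levels just below the threshold, and
  the error of passing to the threshold vanishes.\<close>

lemma psi_lm_nonpos: "psi n (lm (Suc n)) \<le> 0"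
proof (rule tendsto_lowerbound[OF near_mass_tendsto])
  show "\<forall>\<^sub>F m in sequentially. psi n (lm (Suc n)) \<le> near_mass n m"
    using eventually_inverse_Suc_less[OF lm_pos[of "Suc n"]]
  proof eventually_elim
    case (elim m)
    define l where "l = lm (Suc n) - 1 / real (Suc m)"
    have "psi n l < 0"
      using elim by (intro psi_neg_below prob_acc_pos) (auto simp: l_def)
    moreover have "\<bar>psi n l - psi n (lm (Suc n))\<bar> \<le> near_mass n m"
      by (rule psi_near) (simp add: l_def)
    ultimately show ?case
      by simp
  qed
qed simp

text \<open>Right continuity, which needs feasible room above the threshold. At threshold 1 the
  value may be strictly negative; this is the phase in which the mean has not yet reached
  \<alpha>.\<close>

lemma psi_lm_nonneg:
  assumes "lm (Suc n) < 1"
  shows "psi n (lm (Suc n)) \<ge> 0"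
proof (rule ccontr)
  assume neg: "\<not> ?thesis"
  have "eventually (\<lambda>m. near_mass n m < - psi n (lm (Suc n))) sequentially"
    by (rule order_tendstoD(2)[OF near_mass_tendsto]) (use neg in simp)
  moreover have "eventually (\<lambda>m. 1 / real (Suc m) < 1 - lm (Suc n)) sequentially"
    using assms by (intro eventually_inverse_Suc_less) simp
  ultimately have "eventually (\<lambda>m. False) sequentially"
  proof eventually_elim
    case (elim m)
    define l where "l = lm (Suc n) + 1 / real (Suc m)"
    have "psi n l > 0"
      using elim lm_pos[of "Suc n"] by (intro psi_pos_above) (auto simp: l_def)
    moreover have "\<bar>psi n l - psi n (lm (Suc n))\<bar> \<le> near_mass n m"
      by (rule psi_near) (simp add: l_def)
    ultimately show ?case
      using elim by simp
  qed
  then show False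
    by simp
qed

section \<open>The value of the limiting error rate\<close>

definition lim_lfnr :: "nat \<Rightarrow> real" where
  "lim_lfnr n = cexp_event M (V 1 n) {\<omega> \<in> space M. acc 1 n \<omega>}"

lemma lim_lfnr_eq: "(\<integral>\<omega>. V 1 n \<omega> * indicator {\<omega> \<in> space M. acc 1 n \<omega>} \<omega> \<partial>M) = lim_lfnr n * prob_acc n"
  using prob_acc_pos[of n] by (simp add: lim_lfnr_def cexp_event_def prob_acc_def)

text \<open>\<open>psi\<close> at level 1 is the excess before truncation, \<open>psi\<close> at the
  threshold the excess after it. If the former is at most 0, the threshold is 1 and nothing is cut;
  otherwise the latter vanishes and the mean is exactly \<alpha>.\<close>

lemma lim_lfnr_Suc: "lim_lfnr (Suc n) = min \<alpha> (\<theta> + (1 - \<theta>) * lim_lfnr n)"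
proof -
  define A where "A = {x \<in> space (XT n). accx n x}"
  have A: "A \<in> sets (XT n)"
    using accx_meas[of n n] by (simp add: A_def pred_def)
  have in_A: "block 1 n \<omega> \<in> A \<longleftrightarrow> acc 1 n \<omega>" if "\<omega> \<in> space M" for \<omega>
    using measurable_space[OF block_meas that] by (simp add: A_def accx_block)
  have ind: "(\<integral>\<omega>. V 1 s \<omega> * indicator A (block 1 n \<omega>) \<partial>M) = (\<integral>\<omega>. V 1 s \<omega> * indicator {\<omega> \<in> space M. acc 1 n \<omega>} \<omega> \<partial>M)" for s
    by (intro Bochner_Integration.integral_cong) (auto simp: indicator_def in_A)
  have "{\<omega> \<in> space M. block 1 n \<omega> \<in> A} = {\<omega> \<in> space M. acc 1 n \<omega>}"
    using in_A by blast
  then have full: "(\<integral>\<omega>. V 1 (Suc n) \<omega> * indicator {\<omega> \<in> space M. acc 1 n \<omega>} \<omega> \<partial>M) = (\<theta> + (1 - \<theta>) * lim_lfnr n) * prob_acc n"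
    using expectation_V_Suc[OF order_refl A] unfolding ind lim_lfnr_eq
    by (simp add: prob_acc_def algebra_simps)
  have psi_1: "psi n 1 = (\<theta> + (1 - \<theta>) * lim_lfnr n - \<alpha>) * prob_acc n"
    unfolding psi_eq by (simp add: full algebra_simps) (simp add: prob_acc_def)
  have psi_lm: "psi n (lm (Suc n)) = (lim_lfnr (Suc n) - \<alpha>) * prob_acc (Suc n)"
  proof -
    have "{\<omega> \<in> space M. V 1 (Suc n) \<omega> \<le> lm (Suc n) \<and> acc 1 n \<omega>} = {\<omega> \<in> space M. acc 1 (Suc n) \<omega>}"
      by (auto simp: acc_Suc)
    then show ?thesis
      unfolding psi_eq by (simp add: lim_lfnr_eq left_diff_distrib) (simp add: prob_acc_def)
  qed
  show ?thesis
  proof (cases "psi n 1 \<le> 0")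
    case True
    \<comment> \<open>A threshold below 1 would make \<open>psi n 1\<close> positive by
      \<open>psi_pos_above\<close>.\<close>
    then have "lm (Suc n) = 1"
      using psi_pos_above[of n 1] lm_le_1[of "Suc n"] by (cases "lm (Suc n) = 1") auto
    then have "psi n (lm (Suc n)) = psi n 1" "prob_acc (Suc n) = prob_acc n"
      by (simp_all add: prob_acc_def acc_Suc)
    then have "lim_lfnr (Suc n) = \<theta> + (1 - \<theta>) * lim_lfnr n"
      using prob_acc_pos[of n] unfolding psi_1 psi_lm by simp
    moreover have "\<theta> + (1 - \<theta>) * lim_lfnr n \<le> \<alpha>"
      using True prob_acc_pos[of n] unfolding psi_1 by (simp add: mult_le_0_iff)
    ultimately show ?thesis
      by simp
  next
    case False
    then have "lm (Suc n) \<noteq> 1"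
      using psi_lm_nonpos[of n] by auto
    then have "psi n (lm (Suc n)) = 0"
      using psi_lm_nonpos[of n] psi_lm_nonneg[of n] lm_le_1[of "Suc n"] by simp
    then have "lim_lfnr (Suc n) = \<alpha>"
      using prob_acc_pos[of "Suc n"] unfolding psi_lm by simp
    moreover have "\<theta> + (1 - \<theta>) * lim_lfnr n > \<alpha>"
      using False prob_acc_pos[of n] unfolding psi_1 by (simp add: mult_le_0_iff not_le zero_less_mult_iff)
    ultimately show ?thesis
      by simp
  qed
qed

text \<open>1 - (1 - \<theta>)^n solves the recursion without truncation, and since \<theta> + (1 -
  \<theta>) \<alpha> \<ge> \<alpha>, the minimum stays at \<alpha> once it is reached.\<close>

lemma lim_lfnr_closed: "lim_lfnr n = min \<alpha> (1 - (1 - \<theta>) ^ n)"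
proof (induction n)
  case 0
  show ?case
    using alpha by (simp add: lim_lfnr_def cexp_event_def)
next
  case (Suc n)
  have "\<theta> + (1 - \<theta>) * (1 - (1 - \<theta>) ^ n) = 1 - (1 - \<theta>) ^ Suc n"
    by (simp add: algebra_simps)
  moreover have "\<theta> + (1 - \<theta>) * \<alpha> \<ge> \<alpha>"
  proof -
    have "\<theta> + (1 - \<theta>) * \<alpha> - \<alpha> = \<theta> * (1 - \<alpha>)"
      by (simp add: algebra_simps)
    then show ?thesis
      using theta alpha by (smt (verit) mult_nonneg_nonneg)
  qed
  moreover have "(1 - \<theta>) * min \<alpha> (1 - (1 - \<theta>) ^ n) = min ((1 - \<theta>) * \<alpha>) ((1 - \<theta>) * (1 - (1 - \<theta>) ^ n))"
    using theta by (simp add: min_mult_distrib_left)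
  ultimately show ?case
    unfolding lim_lfnr_Suc Suc by (simp add: min_def split: if_splits)
qed

lemma lim_lfnr_cases: "lim_lfnr n = (if real n < ln (1 - \<alpha>) / ln (1 - \<theta>) then 1 - (1 - \<theta>) ^ n else \<alpha>)"
proof -
  have neg: "ln (1 - \<theta>) < 0"
    using theta by simp
  \<comment> \<open>ln (1 - \<theta>) is negative, so clearing the denominator reverses the
    inequality. At equality the two branches coincide.\<close>
  have "real n < ln (1 - \<alpha>) / ln (1 - \<theta>) \<longleftrightarrow> ln (1 - \<alpha>) < real n * ln (1 - \<theta>)"
    using neg by (simp add: neg_less_divide_eq)
  also have "real n * ln (1 - \<theta>) = ln ((1 - \<theta>) ^ n)"
    using theta by (simp add: ln_realpow)
  also have "ln (1 - \<alpha>) < \<dots> \<longleftrightarrow> 1 - \<alpha> < (1 - \<theta>) ^ n"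
    using theta alpha by (intro ln_less_cancel_iff) auto
  finally show ?thesis
    by (auto simp: lim_lfnr_closed min_def)
qed

end


section \<open>Convergence along a fixed trajectory\<close>

lemma sum_diff_le_card_sym_diff:
  fixes h :: "'i \<Rightarrow> real"
  assumes "finite A" "finite B" "\<And>k. \<bar>h k\<bar> \<le> 1"
  shows "\<bar>sum h A - sum h B\<bar> \<le> real (card (sym_diff A B))"
proof -
  have "sum h A - sum h B = sum h (A - B) - sum h (B - A)"
    using sum.Int_Diff[OF assms(1), of h B] sum.Int_Diff[OF assms(2), of h A] by (simp add: Int_commute)
  moreover have "\<bar>sum h C\<bar> \<le> real (card C)" for C
    using sum_norm_bound[of C h 1] assms(3) by simp
  then have "\<bar>sum h (A - B) - sum h (B - A)\<bar> \<le> real (card (A - B)) + real (card (B - A))"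
    by (smt (verit))
  moreover have "card (sym_diff A B) = card (A - B) + card (B - A)"
    using assms by (intro card_Un_disjoint) auto
  ultimately show ?thesis
    by simp
qed

context detection
begin

text \<open>Active set of an idealised procedure that knows the limiting thresholds; membership
  depends on the stream's own data only.\<close>

definition Acc :: "nat \<Rightarrow> nat \<Rightarrow> 'a \<Rightarrow> nat set" where
  "Acc K n \<omega> = {k \<in> {1..K}. acc k n \<omega>}"

definition disc :: "nat \<Rightarrow> nat \<Rightarrow> 'a \<Rightarrow> real" where
  "disc K n \<omega> = real (card (sym_diff (SS K n \<omega>) (Acc K n \<omega>)))"

definition obeys_LLN :: "nat \<Rightarrow> 'a \<Rightarrow> (real \<Rightarrow> real) \<Rightarrow> bool" where
  "obeys_LLN n \<omega> u \<longleftrightarrow>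
     (\<lambda>K. (\<Sum>k\<in>{1..K}. u (V k (Suc n) \<omega>) * of_bool (acc k n \<omega>)) / real K) \<longlonglongrightarrow> restr_mean n u"

text \<open>Lies inside a level set that is eventually kept and has positive mass for suitable m, so
  it supplies a kept stream close below the threshold.\<close>

definition band :: "nat \<Rightarrow> nat \<Rightarrow> real \<Rightarrow> bool" where
  "band n m v \<longleftrightarrow> lm (Suc n) - 2 / real (Suc m) < v \<and> v < lm (Suc n) - 1 / real (Suc m)"

text \<open>All functions to which the law of large numbers is applied; the family is countable, so
  one null set serves them all.\<close>

definition tests :: "nat \<Rightarrow> (real \<Rightarrow> real) set" where
  "tests n = range (\<lambda>m. excess (lm (Suc n) + 1 / real (Suc m))) \<union> range (\<lambda>m. excess (lm (Suc n) - 1 / real (Suc m)))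
     \<union> range (\<lambda>m v. of_bool (near n m v)) \<union> range (\<lambda>m v. of_bool (band n m v))
     \<union> {\<lambda>v. v * of_bool (v \<le> lm (Suc n)), \<lambda>v. of_bool (v \<le> lm (Suc n))}"

lemma tests_unit_bounded:
  assumes "u \<in> tests n"
  shows "unit_bounded u"
proof -
  have "unit_bounded (\<lambda>v. of_bool (band n m v))" for m
    unfolding band_def by (rule unit_bounded_of_bool) measurable
  moreover have "unit_bounded (\<lambda>v. of_bool (v \<le> lm (Suc n)))"
    by (rule unit_bounded_of_bool) measurable
  moreover have "unit_bounded (\<lambda>v. v * of_bool (v \<le> lm (Suc n)))"
    unfolding unit_bounded_def by auto
  ultimately show ?thesis
    using assms unit_bounded_excess unit_bounded_near by (auto simp: tests_def)
qed

lemma AE_obeys_LLN: "AE \<omega> in M. \<forall>n. \<forall>u\<in>tests n. obeys_LLN n \<omega> u"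
proof (subst AE_all_countable, rule allI)
  fix n
  have "countable (tests n)"
    by (auto simp: tests_def)
  then show "AE \<omega> in M. \<forall>u\<in>tests n. obeys_LLN n \<omega> u"
    unfolding obeys_LLN_def by (subst AE_ball_countable) (blast intro: strong_law_V tests_unit_bounded)+
qed

lemma finite_Acc [simp]: "finite (Acc K n \<omega>)"
  by (simp add: Acc_def)

lemma sum_Acc: "(\<Sum>k\<in>Acc K n \<omega>. h k) = (\<Sum>k\<in>{1..K}. h k * of_bool (acc k n \<omega>) :: real)"
  unfolding Acc_def by (intro sum.mono_neutral_cong_left) auto

text \<open>Exchanging the idealised active set for the true one costs at most \<open>disc\<close>
  in the sum, as u is bounded by 1 on the range of V.\<close>

lemma SS_mean_tendsto:
  assumes "(\<lambda>K. disc K n \<omega> / real K) \<longlonglongrightarrow> 0" "obeys_LLN n \<omega> u" "unit_bounded u"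
  shows "(\<lambda>K. (\<Sum>k\<in>SS K n \<omega>. u (V k (Suc n) \<omega>)) / real K) \<longlonglongrightarrow> restr_mean n u"
proof -
  let ?S = "\<lambda>K. (\<Sum>k\<in>SS K n \<omega>. u (V k (Suc n) \<omega>)) / real K"
  let ?A = "\<lambda>K. (\<Sum>k\<in>Acc K n \<omega>. u (V k (Suc n) \<omega>)) / real K"
  have "(\<lambda>K. ?S K - ?A K) \<longlonglongrightarrow> 0"
  proof (rule Lim_null_comparison[OF _ assms(1)], rule always_eventually, rule allI)
    fix K
    have "\<bar>(\<Sum>k\<in>SS K n \<omega>. u (V k (Suc n) \<omega>)) - (\<Sum>k\<in>Acc K n \<omega>. u (V k (Suc n) \<omega>))\<bar> \<le> disc K n \<omega>"
      unfolding disc_def by (rule sum_diff_le_card_sym_diff[OF finite_SS finite_Acc unit_bounded_V[OF assms(3)]])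
    then show "norm (?S K - ?A K) \<le> disc K n \<omega> / real K"
      by (simp add: diff_divide_distrib[symmetric] divide_right_mono)
  qed
  moreover have "?A \<longlonglongrightarrow> restr_mean n u"
    using assms(2) by (simp add: obeys_LLN_def sum_Acc)
  ultimately have "(\<lambda>K. (?S K - ?A K) + ?A K) \<longlonglongrightarrow> 0 + restr_mean n u"
    by (rule tendsto_add)
  then show ?thesis
    by simp
qed

lemma sum_excess: "(\<Sum>k\<in>SS K n \<omega>. excess l (V k (Suc n) \<omega>)) = (\<Sum>k\<in>{k \<in> SS K n \<omega>. V k (Suc n) \<omega> \<le> l}. V k (Suc n) \<omega> - \<alpha>)"
  by (intro sum.mono_neutral_cong_right finite_SS) (auto simp: excess_def)

text \<open>On a fixed trajectory, the empirical excess at each level is eventually of the sign of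
  its limit \<open>psi\<close>, which traps the empirical threshold.\<close>
lemma eventually_level_subset:
  assumes step: "\<And>K. SS K (Suc n) \<omega> = onestep \<alpha> (SS K n \<omega>) (\<lambda>k. V k (Suc n) \<omega>)"
    and d: "(\<lambda>K. disc K n \<omega> / real K) \<longlonglongrightarrow> 0"
    and lln: "\<forall>u\<in>tests n. obeys_LLN n \<omega> u"
    and m: "1 / real (Suc m) < lm (Suc n)"
  shows "\<forall>\<^sub>F K in sequentially. {k \<in> SS K n \<omega>. V k (Suc n) \<omega> \<le> lm (Suc n) - 1 / real (Suc m)} \<subseteq> SS K (Suc n) \<omega>"
proof -
  define l where "l = lm (Suc n) - 1 / real (Suc m)"
  have "excess l \<in> tests n"
    by (auto simp: tests_def l_def)
  then have "(\<lambda>K. (\<Sum>k\<in>SS K n \<omega>. excess l (V k (Suc n) \<omega>)) / real K) \<longlonglongrightarrow> psi n l"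
    unfolding psi_def using lln by (intro SS_mean_tendsto d unit_bounded_excess) auto
  moreover have "psi n l < 0"
    using m by (intro psi_neg_below prob_acc_pos) (auto simp: l_def)
  ultimately have "\<forall>\<^sub>F K in sequentially. (\<Sum>k\<in>SS K n \<omega>. excess l (V k (Suc n) \<omega>)) / real K < 0"
    by (rule order_tendstoD)
  then show ?thesis
  proof eventually_elim
    case (elim K)
    then have "(\<Sum>k\<in>{k \<in> SS K n \<omega>. V k (Suc n) \<omega> \<le> l}. V k (Suc n) \<omega> - \<alpha>) \<le> 0"
      unfolding sum_excess by (auto simp: divide_less_0_iff)
    then show ?case
      unfolding step l_def[symmetric] by (rule level_set_subset_onestep[OF finite_SS alpha(1)])
  qed
qed

text \<open>A positive limiting excess eventually excludes every stream beyond the level. Levels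
  above 1 are outside the scope of \<open>psi_pos_above\<close>, but the claim is trivial there
  since V \<le> 1.\<close>

lemma eventually_subset_level:
  assumes step: "\<And>K. SS K (Suc n) \<omega> = onestep \<alpha> (SS K n \<omega>) (\<lambda>k. V k (Suc n) \<omega>)"
    and d: "(\<lambda>K. disc K n \<omega> / real K) \<longlonglongrightarrow> 0"
    and lln: "\<forall>u\<in>tests n. obeys_LLN n \<omega> u"
  shows "\<forall>\<^sub>F K in sequentially. \<forall>k\<in>SS K (Suc n) \<omega>. V k (Suc n) \<omega> \<le> lm (Suc n) + 1 / real (Suc m)"
proof (cases "lm (Suc n) + 1 / real (Suc m) \<le> 1")
  case True
  define l where "l = lm (Suc n) + 1 / real (Suc m)"
  have "excess l \<in> tests n"
    by (auto simp: tests_def l_def)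
  then have "(\<lambda>K. (\<Sum>k\<in>SS K n \<omega>. excess l (V k (Suc n) \<omega>)) / real K) \<longlonglongrightarrow> psi n l"
    unfolding psi_def using lln by (intro SS_mean_tendsto d unit_bounded_excess) auto
  moreover have "psi n l > 0"
    using True lm_pos[of "Suc n"] by (intro psi_pos_above) (auto simp: l_def)
  ultimately have "\<forall>\<^sub>F K in sequentially. (\<Sum>k\<in>SS K n \<omega>. excess l (V k (Suc n) \<omega>)) / real K > 0"
    by (rule order_tendstoD)
  then show ?thesis
  proof eventually_elim
    case (elim K)
    then have "(\<Sum>k\<in>{k \<in> SS K n \<omega>. V k (Suc n) \<omega> \<le> l}. V k (Suc n) \<omega> - \<alpha>) > 0"
      unfolding sum_excess by (auto simp: zero_less_divide_iff)
    from onestep_subset_level_set[OF finite_SS alpha(1) this] show ?case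
      unfolding step l_def[symmetric] by blast
  qed
next
  case False
  have "V k (Suc n) \<omega> \<le> lm (Suc n) + 1 / real (Suc m)" for k
    using False V_le_1[of k "Suc n" \<omega>] by linarith
  then show ?thesis
    by simp
qed

text \<open>Away from the threshold the true and the idealised procedure eventually decide alike, so
  new disagreements come from streams near it, whose fraction tends to the arbitrarily small
  \<open>near_mass\<close>.\<close>

lemma disc_tendsto_Suc:
  assumes step: "\<And>K. SS K (Suc n) \<omega> = onestep \<alpha> (SS K n \<omega>) (\<lambda>k. V k (Suc n) \<omega>)"
    and d: "(\<lambda>K. disc K n \<omega> / real K) \<longlonglongrightarrow> 0"
    and lln: "\<forall>u\<in>tests n. obeys_LLN n \<omega> u"
  shows "(\<lambda>K. disc K (Suc n) \<omega> / real K) \<longlonglongrightarrow> 0"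
proof (rule order_tendstoI)
  fix e :: real assume "0 < e"
  have "\<forall>\<^sub>F m in sequentially. near_mass n m < e / 2"
    using \<open>0 < e\<close> by (intro order_tendstoD[OF near_mass_tendsto]) simp
  then have "\<forall>\<^sub>F m in sequentially. near_mass n m < e / 2 \<and> 1 / real (Suc m) < lm (Suc n)"
    using eventually_inverse_Suc_less[OF lm_pos[of "Suc n"]] by (rule eventually_conj)
  then obtain m where m: "near_mass n m < e / 2" "1 / real (Suc m) < lm (Suc n)"
    using eventually_happens'[OF sequentially_bot] by blast
  let ?B = "\<lambda>K. {k \<in> Acc K n \<omega>. near n m (V k (Suc n) \<omega>)}"
  have card_B: "real (card (?B K)) = (\<Sum>k\<in>{1..K}. of_bool (near n m (V k (Suc n) \<omega>)) * of_bool (acc k n \<omega>))" for K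
  proof -
    have "real (card (?B K)) = (\<Sum>k\<in>Acc K n \<omega>. of_bool (near n m (V k (Suc n) \<omega>)))"
      by (simp add: of_bool_def sum.If_cases Int_def)
    then show ?thesis
      by (simp only: sum_Acc)
  qed
  have "(\<lambda>v. of_bool (near n m v)) \<in> tests n"
    by (auto simp: tests_def)
  from bspec[OF lln this] have "(\<lambda>K. real (card (?B K)) / real K) \<longlonglongrightarrow> near_mass n m"
    unfolding obeys_LLN_def near_mass_def card_B .
  from tendsto_add[OF d this] have lim: "(\<lambda>K. disc K n \<omega> / real K + real (card (?B K)) / real K) \<longlonglongrightarrow> 0 + near_mass n m" .
  then have "\<forall>\<^sub>F K in sequentially. disc K n \<omega> / real K + real (card (?B K)) / real K < e"
    using order_tendstoD(2)[OF lim, of e] m(1) \<open>0 < e\<close> by simp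
  with eventually_level_subset[OF step d lln m(2)] eventually_subset_level[OF step d lln, of m]
  show "\<forall>\<^sub>F K in sequentially. disc K (Suc n) \<omega> / real K < e"
  proof eventually_elim
    case (elim K)
    \<comment> \<open>For a stream in both sets at n: if only the procedure keeps it, V exceeds the
      threshold by at most 1/(m+1); if only the idealised rule keeps it, V is at most the threshold
      but less than 1/(m+1) below it.\<close>
    have "sym_diff (SS K (Suc n) \<omega>) (Acc K (Suc n) \<omega>) \<subseteq> sym_diff (SS K n \<omega>) (Acc K n \<omega>) \<union> ?B K"
    proof
      fix k assume k: "k \<in> sym_diff (SS K (Suc n) \<omega>) (Acc K (Suc n) \<omega>)"
      show "k \<in> sym_diff (SS K n \<omega>) (Acc K n \<omega>) \<union> ?B K"
      proof (cases "k \<in> SS K (Suc n) \<omega>")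
        case True
        then have "k \<in> SS K n \<omega>" "V k (Suc n) \<omega> \<le> lm (Suc n) + 1 / real (Suc m)"
          using SS_decreasing elim by blast+
        moreover have "k \<notin> Acc K (Suc n) \<omega>"
          using k True by blast
        ultimately show ?thesis
          by (cases "k \<in> Acc K n \<omega>") (auto simp: Acc_def acc_Suc near_def)
      next
        case False
        then have "k \<in> Acc K (Suc n) \<omega>"
          using k by blast
        then have A: "k \<in> Acc K n \<omega>" "V k (Suc n) \<omega> \<le> lm (Suc n)"
          by (auto simp: Acc_def acc_Suc)
        show ?thesis
        proof (cases "k \<in> SS K n \<omega>")
          case True
          then have "V k (Suc n) \<omega> > lm (Suc n) - 1 / real (Suc m)"
            using False elim(1) by force
          then show ?thesis
            using A by (auto simp: near_def)
        qed (use A in blast)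
      qed
    qed
    then have "card (sym_diff (SS K (Suc n) \<omega>) (Acc K (Suc n) \<omega>)) \<le> card (sym_diff (SS K n \<omega>) (Acc K n \<omega>) \<union> ?B K)"
      by (intro card_mono) (auto simp: finite_SS)
    also have "\<dots> \<le> card (sym_diff (SS K n \<omega>) (Acc K n \<omega>)) + card (?B K)"
      by (rule card_Un_le)
    finally have "disc K (Suc n) \<omega> \<le> disc K n \<omega> + real (card (?B K))"
      unfolding disc_def by linarith
    then have "disc K (Suc n) \<omega> / real K \<le> disc K n \<omega> / real K + real (card (?B K)) / real K"
      by (simp add: add_divide_distrib[symmetric] divide_right_mono)
    with elim show ?case
      by linarith
  qed
next
  fix e :: real assume "e < 0"
  then have "e < disc K (Suc n) \<omega> / real K" for K
    by (rule less_le_trans) (simp add: disc_def)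
  then show "\<forall>\<^sub>F K in sequentially. e < disc K (Suc n) \<omega> / real K"
    by simp
qed

lemma disc_tendsto:
  assumes step: "\<And>K n. SS K (Suc n) \<omega> = onestep \<alpha> (SS K n \<omega>) (\<lambda>k. V k (Suc n) \<omega>)"
    and lln: "\<And>n. \<forall>u\<in>tests n. obeys_LLN n \<omega> u"
  shows "(\<lambda>K. disc K n \<omega> / real K) \<longlonglongrightarrow> 0"
proof (induction n)
  case 0
  have "Acc K 0 \<omega> = {1..K}" for K
    by (auto simp: Acc_def)
  then have "disc K 0 \<omega> = 0" for K
    by (simp add: disc_def SS_0)
  then show ?case
    by simp
next
  case (Suc n)
  show ?case
    using step Suc lln by (rule disc_tendsto_Suc)
qed

text \<open>Here the set and V belong to the same time. Splitting the last acceptance off as a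
  cutoff inside the test function leaves acceptance up to n, the form covered by the law of large
  numbers.\<close>

lemma SS_Suc_mean_tendsto:
  assumes d: "(\<lambda>K. disc K (Suc n) \<omega> / real K) \<longlonglongrightarrow> 0"
    and u: "unit_bounded u" and lln: "obeys_LLN n \<omega> (\<lambda>v. u v * of_bool (v \<le> lm (Suc n)))"
  shows "(\<lambda>K. (\<Sum>k\<in>SS K (Suc n) \<omega>. u (V k (Suc n) \<omega>)) / real K) \<longlonglongrightarrow> restr_mean n (\<lambda>v. u v * of_bool (v \<le> lm (Suc n)))"
proof -
  let ?S = "\<lambda>K. (\<Sum>k\<in>SS K (Suc n) \<omega>. u (V k (Suc n) \<omega>)) / real K"
  let ?A = "\<lambda>K. (\<Sum>k\<in>Acc K (Suc n) \<omega>. u (V k (Suc n) \<omega>)) / real K"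
  have "(\<lambda>K. ?S K - ?A K) \<longlonglongrightarrow> 0"
  proof (rule Lim_null_comparison[OF _ d], rule always_eventually, rule allI)
    fix K
    have "\<bar>(\<Sum>k\<in>SS K (Suc n) \<omega>. u (V k (Suc n) \<omega>)) - (\<Sum>k\<in>Acc K (Suc n) \<omega>. u (V k (Suc n) \<omega>))\<bar> \<le> disc K (Suc n) \<omega>"
      unfolding disc_def by (rule sum_diff_le_card_sym_diff[OF finite_SS finite_Acc unit_bounded_V[OF u]])
    then show "norm (?S K - ?A K) \<le> disc K (Suc n) \<omega> / real K"
      by (simp add: diff_divide_distrib[symmetric] divide_right_mono)
  qed
  moreover have "?A \<longlonglongrightarrow> restr_mean n (\<lambda>v. u v * of_bool (v \<le> lm (Suc n)))"
  proof -
    have eq: "u (V k (Suc n) \<omega>) * of_bool (acc k (Suc n) \<omega>)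
        = u (V k (Suc n) \<omega>) * of_bool (V k (Suc n) \<omega> \<le> lm (Suc n)) * of_bool (acc k n \<omega>)" for k
      by (auto simp: acc_Suc)
    from lln show ?thesis
      unfolding obeys_LLN_def sum_Acc eq .
  qed
  ultimately have "(\<lambda>K. (?S K - ?A K) + ?A K) \<longlonglongrightarrow> 0 + restr_mean n (\<lambda>v. u v * of_bool (v \<le> lm (Suc n)))"
    by (rule tendsto_add)
  then show ?thesis
    by simp
qed

lemma card_SS_tendsto:
  assumes d: "(\<lambda>K. disc K (Suc n) \<omega> / real K) \<longlonglongrightarrow> 0" and lln: "\<forall>u\<in>tests n. obeys_LLN n \<omega> u"
  shows "(\<lambda>K. real (card (SS K (Suc n) \<omega>)) / real K) \<longlonglongrightarrow> prob_acc (Suc n)"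
proof -
  have "(\<lambda>v. of_bool (v \<le> lm (Suc n))) \<in> tests n"
    by (simp add: tests_def)
  then have "(\<lambda>K. (\<Sum>k\<in>SS K (Suc n) \<omega>. 1) / real K) \<longlonglongrightarrow> restr_mean n (\<lambda>v. 1 * of_bool (v \<le> lm (Suc n)))"
    using lln by (intro SS_Suc_mean_tendsto[OF d, where u = "\<lambda>_. 1"]) (auto simp: unit_bounded_def)
  moreover have "restr_mean n (\<lambda>v. of_bool (v \<le> lm (Suc n))) = prob_acc (Suc n)"
    unfolding prob_acc_def
    by (subst restr_mean_of_bool) (auto simp: acc_Suc intro!: arg_cong[where f = "measure M"])
  ultimately show ?thesis
    by simp
qed

lemma mean_SS_tendsto:
  assumes d: "(\<lambda>K. disc K (Suc n) \<omega> / real K) \<longlonglongrightarrow> 0" and lln: "\<forall>u\<in>tests n. obeys_LLN n \<omega> u"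
  shows "(\<lambda>K. (\<Sum>k\<in>SS K (Suc n) \<omega>. V k (Suc n) \<omega>) / real (max (card (SS K (Suc n) \<omega>)) 1)) \<longlonglongrightarrow> lim_lfnr (Suc n)"
proof -
  have "(\<lambda>v. v * of_bool (v \<le> lm (Suc n))) \<in> tests n"
    by (simp add: tests_def)
  then have "(\<lambda>K. (\<Sum>k\<in>SS K (Suc n) \<omega>. V k (Suc n) \<omega>) / real K) \<longlonglongrightarrow> restr_mean n (\<lambda>v. v * of_bool (v \<le> lm (Suc n)))"
    using lln by (intro SS_Suc_mean_tendsto[OF d, where u = "\<lambda>v. v"]) (auto simp: unit_bounded_def)
  moreover have "restr_mean n (\<lambda>v. v * of_bool (v \<le> lm (Suc n))) = lim_lfnr (Suc n) * prob_acc (Suc n)"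
    unfolding restr_mean_def lim_lfnr_eq[symmetric]
    by (intro Bochner_Integration.integral_cong) (auto simp: acc_Suc indicator_def)
  ultimately have "(\<lambda>K. ((\<Sum>k\<in>SS K (Suc n) \<omega>. V k (Suc n) \<omega>) / real K) / (real (card (SS K (Suc n) \<omega>)) / real K))
      \<longlonglongrightarrow> lim_lfnr (Suc n) * prob_acc (Suc n) / prob_acc (Suc n)"
    using prob_acc_pos[of "Suc n"] card_SS_tendsto[OF d lln] by (intro tendsto_divide) auto
  \<comment> \<open>The kept fraction has a positive limit, so eventually the set is nonempty: the
    guard by 1 disappears and K cancels.\<close>
  moreover have "\<forall>\<^sub>F K in sequentially. ((\<Sum>k\<in>SS K (Suc n) \<omega>. V k (Suc n) \<omega>) / real K) / (real (card (SS K (Suc n) \<omega>)) / real K)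
      = (\<Sum>k\<in>SS K (Suc n) \<omega>. V k (Suc n) \<omega>) / real (max (card (SS K (Suc n) \<omega>)) 1)"
    using order_tendstoD(1)[OF card_SS_tendsto[OF d lln] prob_acc_pos]
  proof eventually_elim
    case (elim K)
    then have "card (SS K (Suc n) \<omega>) \<ge> 1" "real K > 0"
      by (auto simp: zero_less_divide_iff)
    then show ?case
      by (simp add: max_absorb1)
  qed
  ultimately show ?thesis
    using prob_acc_pos[of "Suc n"] by (simp add: tendsto_cong)
qed

text \<open>The upper bound is \<open>eventually_subset_level\<close>. The lower bound needs a kept
  stream just below the threshold, which full support provides through \<open>band\<close>.\<close>

lemma Max_SS_tendsto:
  assumes step: "\<And>K. SS K (Suc n) \<omega> = onestep \<alpha> (SS K n \<omega>) (\<lambda>k. V k (Suc n) \<omega>)"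
    and d: "(\<lambda>K. disc K n \<omega> / real K) \<longlonglongrightarrow> 0"
    and lln: "\<forall>u\<in>tests n. obeys_LLN n \<omega> u"
  shows "(\<lambda>K. Max ((\<lambda>k. V k (Suc n) \<omega>) ` SS K (Suc n) \<omega>)) \<longlonglongrightarrow> lm (Suc n)"
proof (rule tendstoI)
  fix e :: real assume "0 < e"
  have "\<forall>\<^sub>F m in sequentially. 1 / real (Suc m) < min (e / 2) (lm (Suc n) / 2)"
    using \<open>0 < e\<close> lm_pos[of "Suc n"] by (intro eventually_inverse_Suc_less) simp
  \<comment> \<open>The band reaches 2/(m+1) below the threshold: e / 2 keeps it within distance e,
    and half the threshold keeps it above 0.\<close>
  then obtain m where m: "1 / real (Suc m) < min (e / 2) (lm (Suc n) / 2)"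
    using eventually_happens'[OF sequentially_bot] by blast
  have m_pos: "0 < 1 / real (Suc m)"
    by simp
  have two: "2 / real (Suc m) = 2 * (1 / real (Suc m))"
    by simp
  have "(\<lambda>v. of_bool (band n m v)) \<in> tests n"
    by (auto simp: tests_def)
  then have "(\<lambda>K. (\<Sum>k\<in>SS K n \<omega>. of_bool (band n m (V k (Suc n) \<omega>))) / real K) \<longlonglongrightarrow> restr_mean n (\<lambda>v. of_bool (band n m v))"
    using lln by (intro SS_mean_tendsto d tests_unit_bounded[of _ n]) auto
  moreover have "restr_mean n (\<lambda>v. of_bool (band n m v)) > 0"
    unfolding band_def two using m m_pos lm_le_1[of "Suc n"]
    by (intro prob_between_pos prob_acc_pos) linarith+
  ultimately have "\<forall>\<^sub>F K in sequentially. (\<Sum>k\<in>SS K n \<omega>. of_bool (band n m (V k (Suc n) \<omega>))) / real K > (0 :: real)"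
    by (rule order_tendstoD)
  moreover have "1 / real (Suc m) < lm (Suc n)"
    using m m_pos by linarith
  note eventually_level_subset[OF step d lln this]
  moreover note eventually_subset_level[OF step d lln, of m]
  ultimately show "\<forall>\<^sub>F K in sequentially. dist (Max ((\<lambda>k. V k (Suc n) \<omega>) ` SS K (Suc n) \<omega>)) (lm (Suc n)) < e"
  proof eventually_elim
    case (elim K)
    have "\<exists>k\<in>SS K n \<omega>. band n m (V k (Suc n) \<omega>)"
    proof (rule ccontr)
      assume "\<not> ?thesis"
      then have "(\<Sum>k\<in>SS K n \<omega>. of_bool (band n m (V k (Suc n) \<omega>))) = (0 :: real)"
        by (intro sum.neutral) auto
      with elim(1) show False
        by simp
    qed
    then obtain k where k: "k \<in> SS K n \<omega>" "lm (Suc n) - 2 / real (Suc m) < V k (Suc n) \<omega>" "V k (Suc n) \<omega> \<le> lm (Suc n) - 1 / real (Suc m)"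
      by (auto simp: band_def)
    \<comment> \<open>It also ensures that the set is nonempty, without which \<open>Max\<close> is
      unspecified.\<close>
    then have k': "k \<in> SS K (Suc n) \<omega>"
      using elim(2) by blast
    have "V k (Suc n) \<omega> \<le> Max ((\<lambda>k. V k (Suc n) \<omega>) ` SS K (Suc n) \<omega>)"
      using k' finite_SS by (intro Max_ge) auto
    moreover have "Max ((\<lambda>k. V k (Suc n) \<omega>) ` SS K (Suc n) \<omega>) \<le> lm (Suc n) + 1 / real (Suc m)"
      using k' finite_SS elim(3) by (intro Max.boundedI) auto
    ultimately show ?case
      using k(2) m m_pos unfolding dist_real_def two by linarith
  qed
qed

section \<open>The almost sure limits\<close>

theorem asymptotics:
  "(AE \<omega> in M. (\<lambda>K. lamhat M N X tau \<alpha> K (Suc n) \<omega>) \<longlonglongrightarrow> lm (Suc n))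
   \<and> (AE \<omega> in M. (\<lambda>K. LFNR M N X tau \<alpha> K (Suc n) \<omega>) \<longlonglongrightarrow> lim_lfnr (Suc n))
   \<and> (AE \<omega> in M. (\<lambda>K. real (card (Sset M N X tau \<alpha> K (Suc (Suc n)) \<omega>)) / real K) \<longlonglongrightarrow> prob_acc (Suc n))"
proof -
  have Sset: "Sset M N X tau \<alpha> K (Suc j) = SS K j" for K j
    by (simp add: Sset_def SS_def)
  have Wpost: "Wpost M N X tau \<alpha> K k (Suc n) = post K n k" for K k
    by (simp add: Wpost_def Fil_def post_def FF_def)
  have "AE \<omega> in M. ((\<lambda>K. lamhat M N X tau \<alpha> K (Suc n) \<omega>) \<longlonglongrightarrow> lm (Suc n))
    \<and> ((\<lambda>K. LFNR M N X tau \<alpha> K (Suc n) \<omega>) \<longlonglongrightarrow> lim_lfnr (Suc n))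
    \<and> ((\<lambda>K. real (card (SS K (Suc n) \<omega>)) / real K) \<longlonglongrightarrow> prob_acc (Suc n))"
    using procedure_in_terms_of_V AE_obeys_LLN
  proof eventually_elim
    case (elim \<omega>)
    have step: "SS K (Suc n) \<omega> = onestep \<alpha> (SS K n \<omega>) (\<lambda>k. V k (Suc n) \<omega>)" for K n
      using elim(1) by blast
    have post: "post K n k \<omega> = V k (Suc n) \<omega>" if "k \<in> SS K n \<omega>" for K n k
      using elim(1) that by blast
    have lfnr: "LFNR M N X tau \<alpha> K (Suc n) \<omega> = (\<Sum>k\<in>SS K (Suc n) \<omega>. V k (Suc n) \<omega>) / real (max (card (SS K (Suc n) \<omega>)) 1)" for K n
      using elim(1) by blast
    have lln: "\<forall>u\<in>tests n. obeys_LLN n \<omega> u" for n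
      using elim(2) by blast
    have d: "(\<lambda>K. disc K n \<omega> / real K) \<longlonglongrightarrow> 0" for n
      using step lln by (rule disc_tendsto)
    have "lamhat M N X tau \<alpha> K (Suc n) \<omega> = Max ((\<lambda>k. V k (Suc n) \<omega>) ` SS K (Suc n) \<omega>)" for K
    proof -
      have "(\<lambda>k. post K n k \<omega>) ` SS K (Suc n) \<omega> = (\<lambda>k. V k (Suc n) \<omega>) ` SS K (Suc n) \<omega>"
        using post SS_decreasing by (intro image_cong refl) blast
      then show ?thesis
        by (simp add: lamhat_def Sset Wpost)
    qed
    then show ?case
      unfolding lfnr using Max_SS_tendsto[OF step d lln] mean_SS_tendsto[OF d lln] card_SS_tendsto[OF d lln]
      by simp
  qed
  then show ?thesis
    unfolding Sset by (simp add: AE_conj_iff)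
qed

end

theorem theorem2:
  fixes M :: "'a measure" and N :: "'b measure"
    and p q :: "'b \<Rightarrow> real" and \<theta> \<alpha> :: real
    and tau :: "nat \<Rightarrow> 'a \<Rightarrow> nat" and X :: "nat \<Rightarrow> nat \<Rightarrow> 'a \<Rightarrow> 'b"
  assumes M: "prob_space M"
    and theta: "0 < \<theta>" "\<theta> < 1"
    and alpha: "0 < \<alpha>" "\<alpha> < 1"
    and p_meas: "p \<in> borel_measurable N" and q_meas: "q \<in> borel_measurable N"
    and p_nn: "\<And>y. p y \<ge> 0" and q_nn: "\<And>y. q y \<ge> 0"
    and p_prob: "prob_space (density N (\<lambda>y. ennreal (p y)))"
    and q_prob: "prob_space (density N (\<lambda>y. ennreal (q y)))"
    and tau_meas: "\<And>k. tau k \<in> measurable M (count_space UNIV)"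
    and X_meas: "\<And>k t. X k t \<in> measurable M N"
    and model: "\<And>n T (m :: nat \<Rightarrow> nat) (A :: nat \<Rightarrow> nat \<Rightarrow> 'b set).
        (\<And>k t. A k t \<in> sets N) \<Longrightarrow>
        measure M {\<omega> \<in> space M. \<forall>k\<in>{1..n}. tau k \<omega> = m k \<and> (\<forall>t\<in>{1..T}. X k t \<omega> \<in> A k t)}
        = (\<Prod>k\<in>{1..n}. \<theta> * (1 - \<theta>) ^ m k *
             (\<Prod>t\<in>{1..T}. measure (density N (\<lambda>y. ennreal (if t \<le> m k then p y else q y))) (A k t)))"
    and A1_p: "LR_has_good_density (density N (\<lambda>y. ennreal (p y))) p q"
    and A1_q: "LR_has_good_density (density N (\<lambda>y. ennreal (q y))) p q"
    and t: "t \<ge> 1"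
  shows
   "(AE \<omega> in M. (\<lambda>K. lamhat M N X tau \<alpha> K t \<omega>) \<longlonglongrightarrow> lam M (Vseq \<theta> p q X) \<alpha> t)
    \<and> (AE \<omega> in M. (\<lambda>K. LFNR M N X tau \<alpha> K t \<omega>) \<longlonglongrightarrow>
          cexp_event M (Vseq \<theta> p q X t)
            {\<omega> \<in> space M. \<forall>s\<le>t. Vseq \<theta> p q X s \<omega> \<le> lam M (Vseq \<theta> p q X) \<alpha> s})
    \<and> cexp_event M (Vseq \<theta> p q X t)
            {\<omega> \<in> space M. \<forall>s\<le>t. Vseq \<theta> p q X s \<omega> \<le> lam M (Vseq \<theta> p q X) \<alpha> s}
        = (if real t < ln (1 - \<alpha>) / ln (1 - \<theta>) then 1 - (1 - \<theta>) ^ t else \<alpha>)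
    \<and> (AE \<omega> in M. (\<lambda>K. real (card (Sset M N X tau \<alpha> K (Suc t) \<omega>)) / real K) \<longlonglongrightarrow>
          measure M {\<omega> \<in> space M. \<forall>s\<in>{1..t}. Vseq \<theta> p q X s \<omega> \<le> lam M (Vseq \<theta> p q X) \<alpha> s})"
proof -
  interpret prob_space M by (rule M)
  interpret detection M N p q \<theta> tau X \<alpha>
    by (intro detection.intro stream_model.intro stream_model_axioms.intro detection_axioms.intro;
        (fact | (rule model, assumption)))
  obtain n where n: "t = Suc n"
    using t not0_implies_Suc[of t] by auto
  have V_eq: "Vseq \<theta> p q X = V 1"
    by (intro ext Vseq_eq)
  have "{\<omega> \<in> space M. \<forall>s\<in>{1..t}. V 1 s \<omega> \<le> lm s} = {\<omega> \<in> space M. acc 1 t \<omega>}"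
  proof -
    \<comment> \<open>Time 0 adds no constraint, as V_0 = 0 while the threshold there is
      positive.\<close>
    have "(\<forall>s\<in>{1..t}. V 1 s \<omega> \<le> lm s) \<longleftrightarrow> (\<forall>s\<le>t. V 1 s \<omega> \<le> lm s)" for \<omega>
    proof
      assume *: "\<forall>s\<in>{1..t}. V 1 s \<omega> \<le> lm s"
      show "\<forall>s\<le>t. V 1 s \<omega> \<le> lm s"
      proof (intro allI impI)
        fix s assume "s \<le> t"
        then show "V 1 s \<omega> \<le> lm s"
          using * lm_pos[of 0] by (cases "s = 0") auto
      qed
    qed simp
    then show ?thesis
      by (simp add: acc_def)
  qed
  then have card_lim: "measure M {\<omega> \<in> space M. \<forall>s\<in>{1..t}. V 1 s \<omega> \<le> lam M (V 1) \<alpha> s} = prob_acc t"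
    by (simp add: prob_acc_def lm_def)
  have lfnr_lim: "cexp_event M (V 1 t) {\<omega> \<in> space M. \<forall>s\<le>t. V 1 s \<omega> \<le> lam M (V 1) \<alpha> s} = lim_lfnr t"
    by (simp add: lim_lfnr_def acc_def lm_def)
  show ?thesis
    unfolding V_eq card_lim lfnr_lim
    using asymptotics[of n] lim_lfnr_cases[of t] unfolding n lm_def by blast
qed

end
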